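(* (1) The cartesian 2-functor $\mathcal{L}\mathsf{ex}\to\mathcal{A}\mathsf{dTr}$, $\mathsf{C}\mapsto(\mathsf{C},(\mathsf{all},\mathsf{all}))$, extends to (i.e. lifts along the forgetful 2-functor $\mathcal{A}\mathsf{dTr}_\bullet\to\mathcal{A}\mathsf{dTr}$ to) a cartesian 2-functor $\mathcal{L}\mathsf{ex}\to\mathcal{A}\mathsf{dTr}_{\bullet}$ which on objects sends a lex category $\mathsf{C}$ to the adequate triple $(\mathsf{C},(\mathsf{all},\mathsf{all}))$ pointed by the terminal object $1\in\mathsf{C}$. (2) The cartesian 2-functor $\mathcal{R}\mathsf{ex}^{\mathsf{co}}\to\mathcal{A}\mathsf{dTr}$, $\mathsf{C}\mapsto(\mathsf{C}^{\mathsf{op}},(\mathsf{all},\mathsf{all}))$, extends in the same sense to a cartesian 2-functor $\mathcal{R}\mathsf{ex}^{\mathsf{co}}\to\mathcal{A}\mathsf{dTr}_{\bullet}$ which on objects sends a rex category $\mathsf{C}$ to the adequate triple $(\mathsf{C}^{\mathsf{op}},(\mathsf{all},\mathsf{all}))$ pointed by the initial object $0\in\mathsf{C}$.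
   Context: All 2-categories are strict; a 2-category is cartesian if it has finite strict 2-products, and a 2-functor is cartesian if it preserves them. $\mathcal{L}\mathsf{ex}$ is the 2-category of (locally small) categories with finite limits (lex categories), finite-limit-preserving functors, and all natural transformations. $\mathcal{R}\mathsf{ex}$ is the 2-category of categories with finite colimits (rex categories), finite-colimit-preserving functors and all natural transformations. $\mathcal{K}^{\mathsf{co}}$ is the 2-category $\mathcal{K}$ with its 2-cells reversed. Lex and rex categories are taken with a choice of terminal, resp. initial, object. An adequate triple $(\mathsf{C},(L,R))$ is a category $\mathsf{C}$ with two classes of maps $L,R$, each containing identities and closed under composition, such that every cospan $x\xrightarrow{r} z\xleftarrow{\ell} y$ with $r\in R$, $\ell\in L$ has a pullback, and in any such pullback square the map $p\to x$ is in $L$ and the map $p\to y$ is in $R$ (these are the $L$-$R$ pullbacks). $\mathcal{A}\mathsf{dTr}$ is the 2-category of adequate triples, functors preserving the classes $L$ and $R$ and preserving $L$-$R$ pullbacks, and arbitrary natural transformations. $\mathsf{all}$ denotes the class of all maps. The 2-category $\mathcal{A}\mathsf{dTr}_{\bullet}$ of pointed adequate triples has as objects adequate triples $(\mathsf{C},(L,R))$ with an object $c\in\mathsf{C}$; a 1-cell $(\mathsf{C},c)\to(\mathsf{D},d)$ is a map $f$ of adequate triples together with an isomorphism $f(c)\to d$ lying in the left class of $\mathsf{D}$; a 2-cell is a natural transformation compatible with these isomorphisms (as in the pseudo-slice under the terminal adequate triple). *)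

theory Defs
  imports Main "HOL-Library.FuncSet"
begin

section \<open>Categories, functors and natural transformations\<close>

text \<open>
  Categories are presented by hom-sets: the objects form a subset of a type \<open>'o\<close> and every
  hom-set is a subset of a type \<open>'m\<close>. Reading the elements of \<open>'o\<close> as large and those of \<open>'m\<close>
  as small, these are the locally small categories; both types have to be infinite for finite
  products of categories to be available up to isomorphism. Hom-sets of different pairs of objects
  need not be disjoint, so identities and composition carry their objects as arguments:
  \<open>Comp C x y z g f\<close> is the composite of \<open>f : x \<rightarrow> y\<close> and \<open>g : y \<rightarrow> z\<close>.
\<close>

record ('o, 'm) cat =
  Obj :: "'o set"
  Hom :: "'o \<Rightarrow> 'o \<Rightarrow> 'm set"
  Ident :: "'o \<Rightarrow> 'm"
  Comp :: "'o \<Rightarrow> 'o \<Rightarrow> 'o \<Rightarrow> 'm \<Rightarrow> 'm \<Rightarrow> 'm"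

text \<open>
  All structure is kept extensional (empty or \<open>undefined\<close> outside its domain), so that equality of
  records is equality of categories and of functors. Strict equations between 1-cells and between
  2-cells are then plain equations.
\<close>

definition make_cat ::
  "'o set \<Rightarrow> ('o \<Rightarrow> 'o \<Rightarrow> 'm set) \<Rightarrow> ('o \<Rightarrow> 'm) \<Rightarrow>
   ('o \<Rightarrow> 'o \<Rightarrow> 'o \<Rightarrow> 'm \<Rightarrow> 'm \<Rightarrow> 'm) \<Rightarrow> ('o, 'm) cat" where
  "make_cat X H i m =
    \<lparr> Obj = X,
      Hom = (\<lambda>x y. if x \<in> X \<and> y \<in> X then H x y else {}),
      Ident = restrict i X,
      Comp = (\<lambda>x y z g f. if x \<in> X \<and> y \<in> X \<and> z \<in> X \<and> f \<in> H x y \<and> g \<in> H y z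
                          then m x y z g f else undefined) \<rparr>"

locale category =
  fixes C :: "('o, 'm) cat"
  assumes extensional: "C = make_cat (Obj C) (Hom C) (Ident C) (Comp C)"
    and ident_in_hom: "x \<in> Obj C \<Longrightarrow> Ident C x \<in> Hom C x x"
    and comp_in_hom: "\<lbrakk> f \<in> Hom C x y; g \<in> Hom C y z \<rbrakk> \<Longrightarrow> Comp C x y z g f \<in> Hom C x z"
    and comp_ident_right: "f \<in> Hom C x y \<Longrightarrow> Comp C x x y f (Ident C x) = f"
    and comp_ident_left: "f \<in> Hom C x y \<Longrightarrow> Comp C x y y (Ident C y) f = f"
    and comp_assoc: "\<lbrakk> f \<in> Hom C w x; g \<in> Hom C x y; h \<in> Hom C y z \<rbrakk> \<Longrightarrow>
      Comp C w x z (Comp C x y z h g) f = Comp C w y z h (Comp C w x y g f)"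

definition Opp :: "('o, 'm) cat \<Rightarrow> ('o, 'm) cat" where
  "Opp C = \<lparr> Obj = Obj C, Hom = (\<lambda>x y. Hom C y x), Ident = Ident C,
             Comp = (\<lambda>x y z g f. Comp C z y x f g) \<rparr>"

definition prod_cat :: "('o, 'm) cat \<Rightarrow> ('p, 'n) cat \<Rightarrow> ('o \<times> 'p, 'm \<times> 'n) cat" where
  "prod_cat C D = make_cat (Obj C \<times> Obj D)
     (\<lambda>(x, x') (y, y'). Hom C x y \<times> Hom D x' y')
     (\<lambda>(x, x'). (Ident C x, Ident D x'))
     (\<lambda>(x, x') (y, y') (z, z') (g, g') (f, f'). (Comp C x y z g f, Comp D x' y' z' g' f'))"

record ('o, 'm, 'p, 'n) fctr =
  FOb :: "'o \<Rightarrow> 'p"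
  FAr :: "'o \<Rightarrow> 'o \<Rightarrow> 'm \<Rightarrow> 'n"

definition make_fctr ::
  "('o, 'm) cat \<Rightarrow> ('o \<Rightarrow> 'p) \<Rightarrow> ('o \<Rightarrow> 'o \<Rightarrow> 'm \<Rightarrow> 'n) \<Rightarrow> ('o, 'm, 'p, 'n) fctr" where
  "make_fctr C a h =
    \<lparr> FOb = restrict a (Obj C),
      FAr = (\<lambda>x y f. if x \<in> Obj C \<and> y \<in> Obj C \<and> f \<in> Hom C x y then h x y f else undefined) \<rparr>"

locale is_functor = dom: category C + cod: category D
  for C :: "('o, 'm) cat" and D :: "('p, 'n) cat" +
  fixes F :: "('o, 'm, 'p, 'n) fctr"
  assumes extensional: "F = make_fctr C (FOb F) (FAr F)"
    and maps_obj: "x \<in> Obj C \<Longrightarrow> FOb F x \<in> Obj D"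
    and maps_hom: "f \<in> Hom C x y \<Longrightarrow> FAr F x y f \<in> Hom D (FOb F x) (FOb F y)"
    and maps_ident: "x \<in> Obj C \<Longrightarrow> FAr F x x (Ident C x) = Ident D (FOb F x)"
    and maps_comp: "\<lbrakk> f \<in> Hom C x y; g \<in> Hom C y z \<rbrakk> \<Longrightarrow>
      FAr F x z (Comp C x y z g f) =
      Comp D (FOb F x) (FOb F y) (FOb F z) (FAr F y z g) (FAr F x y f)"

definition id_fctr :: "('o, 'm) cat \<Rightarrow> ('o, 'm, 'o, 'm) fctr" where
  "id_fctr C = make_fctr C (\<lambda>x. x) (\<lambda>x y f. f)"

text \<open>\<open>fctr_comp C G F\<close> is the composite of \<open>F\<close>, with domain \<open>C\<close>, and \<open>G\<close>.\<close>

definition fctr_comp ::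
  "('o, 'm) cat \<Rightarrow> ('p, 'n, 'q, 'k) fctr \<Rightarrow> ('o, 'm, 'p, 'n) fctr \<Rightarrow> ('o, 'm, 'q, 'k) fctr" where
  "fctr_comp C G F = make_fctr C (\<lambda>x. FOb G (FOb F x))
     (\<lambda>x y f. FAr G (FOb F x) (FOb F y) (FAr F x y f))"

definition Opp_fctr :: "('o, 'm, 'p, 'n) fctr \<Rightarrow> ('o, 'm, 'p, 'n) fctr" where
  "Opp_fctr F = \<lparr> FOb = FOb F, FAr = (\<lambda>x y. FAr F y x) \<rparr>"

definition nat_trans ::
  "('o, 'm) cat \<Rightarrow> ('p, 'n) cat \<Rightarrow> ('o, 'm, 'p, 'n) fctr \<Rightarrow> ('o, 'm, 'p, 'n) fctr \<Rightarrow>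
   ('o \<Rightarrow> 'n) set" where
  "nat_trans C D F G =
    {\<alpha>. \<alpha> \<in> (\<Pi>\<^sub>E x \<in> Obj C. Hom D (FOb F x) (FOb G x)) \<and>
        (\<forall>x \<in> Obj C. \<forall>y \<in> Obj C. \<forall>f \<in> Hom C x y.
           Comp D (FOb F x) (FOb F y) (FOb G y) (\<alpha> y) (FAr F x y f) =
           Comp D (FOb F x) (FOb G x) (FOb G y) (FAr G x y f) (\<alpha> x))}"

text \<open>\<open>functor_cat C D S\<close>: the functors from \<open>C\<close> to \<open>D\<close> belonging to \<open>S\<close>, with all natural
  transformations between them.\<close>

definition functor_cat ::
  "('o, 'm) cat \<Rightarrow> ('p, 'n) cat \<Rightarrow> ('o, 'm, 'p, 'n) fctr set \<Rightarrow>
   (('o, 'm, 'p, 'n) fctr, 'o \<Rightarrow> 'n) cat" where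
  "functor_cat C D S = make_cat {F \<in> S. is_functor C D F}
     (nat_trans C D)
     (\<lambda>F. \<lambda>x \<in> Obj C. Ident D (FOb F x))
     (\<lambda>F G H \<beta> \<alpha>. \<lambda>x \<in> Obj C. Comp D (FOb F x) (FOb G x) (FOb H x) (\<beta> x) (\<alpha> x))"


section \<open>Finite limits and colimits, pullbacks\<close>

definition is_iso :: "('o, 'm) cat \<Rightarrow> 'o \<Rightarrow> 'o \<Rightarrow> 'm \<Rightarrow> bool" where
  "is_iso C x y f \<longleftrightarrow> f \<in> Hom C x y \<and>
     (\<exists>g \<in> Hom C y x. Comp C x y x g f = Ident C x \<and> Comp C y x y f g = Ident C y)"

definition is_terminal :: "('o, 'm) cat \<Rightarrow> 'o \<Rightarrow> bool" where
  "is_terminal C t \<longleftrightarrow> t \<in> Obj C \<and> (\<forall>x \<in> Obj C. \<exists>!f. f \<in> Hom C x t)"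

definition is_initial :: "('o, 'm) cat \<Rightarrow> 'o \<Rightarrow> bool" where
  "is_initial C i \<longleftrightarrow> i \<in> Obj C \<and> (\<forall>x \<in> Obj C. \<exists>!f. f \<in> Hom C i x)"

text \<open>The square \<open>p1 : p \<rightarrow> x\<close>, \<open>p2 : p \<rightarrow> y\<close> over the cospan \<open>r : x \<rightarrow> z\<close>, \<open>l : y \<rightarrow> z\<close>.\<close>

definition is_pullback ::
  "('o, 'm) cat \<Rightarrow> 'o \<Rightarrow> 'o \<Rightarrow> 'o \<Rightarrow> 'o \<Rightarrow> 'm \<Rightarrow> 'm \<Rightarrow> 'm \<Rightarrow> 'm \<Rightarrow> bool" where
  "is_pullback C p x y z p1 p2 r l \<longleftrightarrow>
     p1 \<in> Hom C p x \<and> p2 \<in> Hom C p y \<and> r \<in> Hom C x z \<and> l \<in> Hom C y z \<and>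
     Comp C p x z r p1 = Comp C p y z l p2 \<and>
     (\<forall>q \<in> Obj C. \<forall>q1 \<in> Hom C q x. \<forall>q2 \<in> Hom C q y.
        Comp C q x z r q1 = Comp C q y z l q2 \<longrightarrow>
        (\<exists>!h. h \<in> Hom C q p \<and> Comp C q p x p1 h = q1 \<and> Comp C q p y p2 h = q2))"

definition is_cone ::
  "('o, 'm) cat \<Rightarrow> ('j, 'k) cat \<Rightarrow> ('j, 'k, 'o, 'm) fctr \<Rightarrow> 'o \<Rightarrow> ('j \<Rightarrow> 'm) \<Rightarrow> bool" where
  "is_cone C J D x c \<longleftrightarrow> x \<in> Obj C \<and> (\<forall>j \<in> Obj J. c j \<in> Hom C x (FOb D j)) \<and>
     (\<forall>j \<in> Obj J. \<forall>k \<in> Obj J. \<forall>u \<in> Hom J j k.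
        Comp C x (FOb D j) (FOb D k) (FAr D j k u) (c j) = c k)"

definition is_limit ::
  "('o, 'm) cat \<Rightarrow> ('j, 'k) cat \<Rightarrow> ('j, 'k, 'o, 'm) fctr \<Rightarrow> 'o \<Rightarrow> ('j \<Rightarrow> 'm) \<Rightarrow> bool" where
  "is_limit C J D x c \<longleftrightarrow> is_cone C J D x c \<and>
     (\<forall>y d. is_cone C J D y d \<longrightarrow>
        (\<exists>!h. h \<in> Hom C y x \<and> (\<forall>j \<in> Obj J. Comp C y x (FOb D j) (c j) h = d j)))"

definition is_cocone ::
  "('o, 'm) cat \<Rightarrow> ('j, 'k) cat \<Rightarrow> ('j, 'k, 'o, 'm) fctr \<Rightarrow> 'o \<Rightarrow> ('j \<Rightarrow> 'm) \<Rightarrow> bool" where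
  "is_cocone C J D x c \<longleftrightarrow> x \<in> Obj C \<and> (\<forall>j \<in> Obj J. c j \<in> Hom C (FOb D j) x) \<and>
     (\<forall>j \<in> Obj J. \<forall>k \<in> Obj J. \<forall>u \<in> Hom J j k.
        Comp C (FOb D j) (FOb D k) x (c k) (FAr D j k u) = c j)"

definition is_colimit ::
  "('o, 'm) cat \<Rightarrow> ('j, 'k) cat \<Rightarrow> ('j, 'k, 'o, 'm) fctr \<Rightarrow> 'o \<Rightarrow> ('j \<Rightarrow> 'm) \<Rightarrow> bool" where
  "is_colimit C J D x c \<longleftrightarrow> is_cocone C J D x c \<and>
     (\<forall>y d. is_cocone C J D y d \<longrightarrow>
        (\<exists>!h. h \<in> Hom C x y \<and> (\<forall>j \<in> Obj J. Comp C (FOb D j) x y h (c j) = d j)))"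

text \<open>Every finite category is isomorphic to one whose objects and arrows are natural numbers,
  so it suffices to consider diagrams of such shapes.\<close>

definition finite_cat :: "(nat, nat) cat \<Rightarrow> bool" where
  "finite_cat J \<longleftrightarrow> category J \<and> finite (Obj J) \<and>
     (\<forall>x \<in> Obj J. \<forall>y \<in> Obj J. finite (Hom J x y))"

definition has_finite_limits :: "('o, 'm) cat \<Rightarrow> bool" where
  "has_finite_limits C \<longleftrightarrow> (\<forall>J (D :: (nat, nat, 'o, 'm) fctr).
     finite_cat J \<and> is_functor J C D \<longrightarrow> (\<exists>x c. is_limit C J D x c))"

definition has_finite_colimits :: "('o, 'm) cat \<Rightarrow> bool" where
  "has_finite_colimits C \<longleftrightarrow> (\<forall>J (D :: (nat, nat, 'o, 'm) fctr).
     finite_cat J \<and> is_functor J C D \<longrightarrow> (\<exists>x c. is_colimit C J D x c))"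

definition preserves_finite_limits ::
  "('o, 'm) cat \<Rightarrow> ('p, 'n) cat \<Rightarrow> ('o, 'm, 'p, 'n) fctr \<Rightarrow> bool" where
  "preserves_finite_limits C C' F \<longleftrightarrow> (\<forall>J (D :: (nat, nat, 'o, 'm) fctr) x c.
     finite_cat J \<and> is_functor J C D \<and> is_limit C J D x c \<longrightarrow>
     is_limit C' J (fctr_comp J F D) (FOb F x) (\<lambda>j. FAr F x (FOb D j) (c j)))"

definition preserves_finite_colimits ::
  "('o, 'm) cat \<Rightarrow> ('p, 'n) cat \<Rightarrow> ('o, 'm, 'p, 'n) fctr \<Rightarrow> bool" where
  "preserves_finite_colimits C C' F \<longleftrightarrow> (\<forall>J (D :: (nat, nat, 'o, 'm) fctr) x c.
     finite_cat J \<and> is_functor J C D \<and> is_colimit C J D x c \<longrightarrow>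
     is_colimit C' J (fctr_comp J F D) (FOb F x) (\<lambda>j. FAr F (FOb D j) x (c j)))"


section \<open>Strict 2-categories, 2-functors and finite 2-products\<close>

text \<open>
  A 2-category is a category enriched in categories: \<open>HomCat K a b\<close> is the category of 1-cells
  \<open>a \<rightarrow> b\<close> and 2-cells between them, with vertical composition, and \<open>CompF K a b c\<close> is the
  composition functor from \<open>HomCat K b c \<times> HomCat K a b\<close> to \<open>HomCat K a c\<close>, whose action on arrows
  is horizontal composition.
\<close>

record ('a, 'b, 'c) tcat =
  Ob :: "'a set"
  HomCat :: "'a \<Rightarrow> 'a \<Rightarrow> ('b, 'c) cat"
  Id1 :: "'a \<Rightarrow> 'b"
  CompF :: "'a \<Rightarrow> 'a \<Rightarrow> 'a \<Rightarrow> ('b \<times> 'b, 'c \<times> 'c, 'b, 'c) fctr"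

abbreviation comp1 :: "('a, 'b, 'c) tcat \<Rightarrow> 'a \<Rightarrow> 'a \<Rightarrow> 'a \<Rightarrow> 'b \<Rightarrow> 'b \<Rightarrow> 'b" where
  "comp1 K a b c g f \<equiv> FOb (CompF K a b c) (g, f)"

text \<open>\<open>hcomp K a b c g g' f f' \<beta> \<alpha>\<close> is the horizontal composite of \<open>\<alpha> : f \<Rightarrow> f'\<close>, between 1-cells
  \<open>a \<rightarrow> b\<close>, and \<open>\<beta> : g \<Rightarrow> g'\<close>, between 1-cells \<open>b \<rightarrow> c\<close>.\<close>

abbreviation hcomp ::
  "('a, 'b, 'c) tcat \<Rightarrow> 'a \<Rightarrow> 'a \<Rightarrow> 'a \<Rightarrow> 'b \<Rightarrow> 'b \<Rightarrow> 'b \<Rightarrow> 'b \<Rightarrow> 'c \<Rightarrow> 'c \<Rightarrow> 'c" where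
  "hcomp K a b c g g' f f' \<beta> \<alpha> \<equiv> FAr (CompF K a b c) (g, f) (g', f') (\<beta>, \<alpha>)"

abbreviation id2 :: "('a, 'b, 'c) tcat \<Rightarrow> 'a \<Rightarrow> 'a \<Rightarrow> 'b \<Rightarrow> 'c" where
  "id2 K a b f \<equiv> Ident (HomCat K a b) f"

locale two_category =
  fixes K :: "('a, 'b, 'c) tcat"
  assumes homcat: "\<lbrakk> a \<in> Ob K; b \<in> Ob K \<rbrakk> \<Longrightarrow> category (HomCat K a b)"
    and id1: "a \<in> Ob K \<Longrightarrow> Id1 K a \<in> Obj (HomCat K a a)"
    and comp_functor: "\<lbrakk> a \<in> Ob K; b \<in> Ob K; c \<in> Ob K \<rbrakk> \<Longrightarrow>
      is_functor (prod_cat (HomCat K b c) (HomCat K a b)) (HomCat K a c) (CompF K a b c)"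
    and unit_right_1: "\<lbrakk> a \<in> Ob K; b \<in> Ob K; f \<in> Obj (HomCat K a b) \<rbrakk> \<Longrightarrow>
      comp1 K a a b f (Id1 K a) = f"
    and unit_left_1: "\<lbrakk> a \<in> Ob K; b \<in> Ob K; f \<in> Obj (HomCat K a b) \<rbrakk> \<Longrightarrow>
      comp1 K a b b (Id1 K b) f = f"
    and unit_right_2: "\<lbrakk> a \<in> Ob K; b \<in> Ob K; \<alpha> \<in> Hom (HomCat K a b) f f' \<rbrakk> \<Longrightarrow>
      hcomp K a a b f f' (Id1 K a) (Id1 K a) \<alpha> (id2 K a a (Id1 K a)) = \<alpha>"
    and unit_left_2: "\<lbrakk> a \<in> Ob K; b \<in> Ob K; \<alpha> \<in> Hom (HomCat K a b) f f' \<rbrakk> \<Longrightarrow>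
      hcomp K a b b (Id1 K b) (Id1 K b) f f' (id2 K b b (Id1 K b)) \<alpha> = \<alpha>"
    and assoc_1: "\<lbrakk> a \<in> Ob K; b \<in> Ob K; c \<in> Ob K; d \<in> Ob K;
        f \<in> Obj (HomCat K a b); g \<in> Obj (HomCat K b c); h \<in> Obj (HomCat K c d) \<rbrakk> \<Longrightarrow>
      comp1 K a b d (comp1 K b c d h g) f = comp1 K a c d h (comp1 K a b c g f)"
    and assoc_2: "\<lbrakk> a \<in> Ob K; b \<in> Ob K; c \<in> Ob K; d \<in> Ob K;
        \<alpha> \<in> Hom (HomCat K a b) f f'; \<beta> \<in> Hom (HomCat K b c) g g';
        \<gamma> \<in> Hom (HomCat K c d) h h' \<rbrakk> \<Longrightarrow>
      hcomp K a b d (comp1 K b c d h g) (comp1 K b c d h' g') f f'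
        (hcomp K b c d h h' g g' \<gamma> \<beta>) \<alpha> =
      hcomp K a c d h h' (comp1 K a b c g f) (comp1 K a b c g' f') \<gamma>
        (hcomp K a b c g g' f f' \<beta> \<alpha>)"

text \<open>\<open>K\<^sup>c\<^sup>o\<close>: the same objects and 1-cells, with 2-cells reversed.\<close>

definition co :: "('a, 'b, 'c) tcat \<Rightarrow> ('a, 'b, 'c) tcat" where
  "co K = \<lparr> Ob = Ob K, HomCat = (\<lambda>a b. Opp (HomCat K a b)), Id1 = Id1 K,
            CompF = (\<lambda>a b c. Opp_fctr (CompF K a b c)) \<rparr>"

record ('a, 'b, 'c, 'd, 'e, 'f) tfun =
  T0 :: "'a \<Rightarrow> 'd"
  T1 :: "'a \<Rightarrow> 'a \<Rightarrow> ('b, 'c, 'e, 'f) fctr"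

locale two_functor = dom: two_category K + cod: two_category L
  for K :: "('a, 'b, 'c) tcat" and L :: "('d, 'e, 'f) tcat" +
  fixes T :: "('a, 'b, 'c, 'd, 'e, 'f) tfun"
  assumes maps_ob: "a \<in> Ob K \<Longrightarrow> T0 T a \<in> Ob L"
    and hom_functor: "\<lbrakk> a \<in> Ob K; b \<in> Ob K \<rbrakk> \<Longrightarrow>
      is_functor (HomCat K a b) (HomCat L (T0 T a) (T0 T b)) (T1 T a b)"
    and maps_id1: "a \<in> Ob K \<Longrightarrow> FOb (T1 T a a) (Id1 K a) = Id1 L (T0 T a)"
    and maps_comp1: "\<lbrakk> a \<in> Ob K; b \<in> Ob K; c \<in> Ob K;
        f \<in> Obj (HomCat K a b); g \<in> Obj (HomCat K b c) \<rbrakk> \<Longrightarrow>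
      FOb (T1 T a c) (comp1 K a b c g f) =
      comp1 L (T0 T a) (T0 T b) (T0 T c) (FOb (T1 T b c) g) (FOb (T1 T a b) f)"
    and maps_hcomp: "\<lbrakk> a \<in> Ob K; b \<in> Ob K; c \<in> Ob K;
        \<alpha> \<in> Hom (HomCat K a b) f f'; \<beta> \<in> Hom (HomCat K b c) g g' \<rbrakk> \<Longrightarrow>
      FAr (T1 T a c) (comp1 K a b c g f) (comp1 K a b c g' f') (hcomp K a b c g g' f f' \<beta> \<alpha>) =
      hcomp L (T0 T a) (T0 T b) (T0 T c)
        (FOb (T1 T b c) g) (FOb (T1 T b c) g') (FOb (T1 T a b) f) (FOb (T1 T a b) f')
        (FAr (T1 T b c) g g' \<beta>) (FAr (T1 T a b) f f' \<alpha>)"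

text \<open>
  \<open>p\<close> with projections \<open>pr i : p \<rightarrow> A i\<close> is a strict 2-product of the family \<open>A\<close> over \<open>I\<close>: for all
  \<open>x\<close>, composition with the projections is an isomorphism of categories from \<open>HomCat K x p\<close> to the
  product of the \<open>HomCat K x (A i)\<close>, that is, bijective on 1-cells and on 2-cells.
\<close>

definition is_2product ::
  "('a, 'b, 'c) tcat \<Rightarrow> 'i set \<Rightarrow> ('i \<Rightarrow> 'a) \<Rightarrow> 'a \<Rightarrow> ('i \<Rightarrow> 'b) \<Rightarrow> bool" where
  "is_2product K I A p pr \<longleftrightarrow> p \<in> Ob K \<and> (\<forall>i \<in> I. pr i \<in> Obj (HomCat K p (A i))) \<and>
     (\<forall>x \<in> Ob K.
        (\<forall>f. (\<forall>i \<in> I. f i \<in> Obj (HomCat K x (A i))) \<longrightarrow>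
           (\<exists>!h. h \<in> Obj (HomCat K x p) \<and> (\<forall>i \<in> I. comp1 K x p (A i) (pr i) h = f i))) \<and>
        (\<forall>h \<in> Obj (HomCat K x p). \<forall>h' \<in> Obj (HomCat K x p). \<forall>\<phi>.
           (\<forall>i \<in> I. \<phi> i \<in> Hom (HomCat K x (A i))
              (comp1 K x p (A i) (pr i) h) (comp1 K x p (A i) (pr i) h')) \<longrightarrow>
           (\<exists>!\<theta>. \<theta> \<in> Hom (HomCat K x p) h h' \<and>
              (\<forall>i \<in> I. hcomp K x p (A i) (pr i) (pr i) h h' (id2 K p (A i) (pr i)) \<theta> = \<phi> i))))"

definition cartesian_2category :: "('a, 'b, 'c) tcat \<Rightarrow> bool" where
  "cartesian_2category K \<longleftrightarrow> two_category K \<and>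
     (\<forall>(I :: nat set) A. finite I \<and> (\<forall>i \<in> I. A i \<in> Ob K) \<longrightarrow> (\<exists>p pr. is_2product K I A p pr))"

definition cartesian_2functor ::
  "('a, 'b, 'c) tcat \<Rightarrow> ('d, 'e, 'f) tcat \<Rightarrow> ('a, 'b, 'c, 'd, 'e, 'f) tfun \<Rightarrow> bool" where
  "cartesian_2functor K L T \<longleftrightarrow>
     cartesian_2category K \<and> cartesian_2category L \<and> two_functor K L T \<and>
     (\<forall>(I :: nat set) A p pr.
        finite I \<and> (\<forall>i \<in> I. A i \<in> Ob K) \<and> is_2product K I A p pr \<longrightarrow>
        is_2product L I (\<lambda>i. T0 T (A i)) (T0 T p) (\<lambda>i. FOb (T1 T p (A i)) (pr i)))"

text \<open>\<open>S\<close>, with domain \<open>K\<close>, lifts \<open>T\<close> along \<open>U\<close>: the composite of \<open>S\<close> and \<open>U\<close> is equal to \<open>T\<close>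
  on objects, 1-cells and 2-cells.\<close>

definition lifts_along ::
  "('a, 'b, 'c) tcat \<Rightarrow> ('g, 'h, 'k, 'd, 'e, 'f) tfun \<Rightarrow> ('a, 'b, 'c, 'g, 'h, 'k) tfun \<Rightarrow>
   ('a, 'b, 'c, 'd, 'e, 'f) tfun \<Rightarrow> bool" where
  "lifts_along K U S T \<longleftrightarrow>
     (\<forall>a \<in> Ob K. T0 U (T0 S a) = T0 T a) \<and>
     (\<forall>a \<in> Ob K. \<forall>b \<in> Ob K.
        fctr_comp (HomCat K a b) (T1 U (T0 S a) (T0 S b)) (T1 S a b) = T1 T a b)"


section \<open>2-categories of structured categories\<close>

text \<open>
  \<open>structured_2cat X U S\<close> has as objects the elements of \<open>X\<close>, each with an underlying category
  \<open>U a\<close>; as 1-cells \<open>a \<rightarrow> b\<close> the functors \<open>U a \<rightarrow> U b\<close> belonging to \<open>S a b\<close>; and as 2-cells all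
  natural transformations. The component at \<open>x\<close> of the horizontal composite of \<open>\<alpha> : F \<Rightarrow> F'\<close> and
  \<open>\<beta> : G \<Rightarrow> G'\<close> is \<open>G' (\<alpha> x)\<close> after \<open>\<beta> (F x)\<close>.
\<close>

definition structured_2cat ::
  "'a set \<Rightarrow> ('a \<Rightarrow> ('o, 'm) cat) \<Rightarrow> ('a \<Rightarrow> 'a \<Rightarrow> ('o, 'm, 'o, 'm) fctr set) \<Rightarrow>
   ('a, ('o, 'm, 'o, 'm) fctr, 'o \<Rightarrow> 'm) tcat" where
  "structured_2cat X U S =
    \<lparr> Ob = X,
      HomCat = (\<lambda>a b. functor_cat (U a) (U b) (S a b)),
      Id1 = (\<lambda>a. id_fctr (U a)),
      CompF = (\<lambda>a b c. make_fctr
        (prod_cat (functor_cat (U b) (U c) (S b c)) (functor_cat (U a) (U b) (S a b)))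
        (\<lambda>(G, F). fctr_comp (U a) G F)
        (\<lambda>(G, F) (G', F') (\<beta>, \<alpha>). \<lambda>x \<in> Obj (U a).
           Comp (U c) (FOb G (FOb F x)) (FOb G' (FOb F x)) (FOb G' (FOb F' x))
             (FAr G' (FOb F x) (FOb F' x) (\<alpha> x)) (\<beta> (FOb F x)))) \<rparr>"

text \<open>A lex category \<open>(C, t)\<close> is a category with finite limits and a chosen terminal object \<open>t\<close>,
  which functors need not preserve on the nose.\<close>

definition Lex :: "(('o, 'm) cat \<times> 'o, ('o, 'm, 'o, 'm) fctr, 'o \<Rightarrow> 'm) tcat" where
  "Lex = structured_2cat
     {(C, t). category C \<and> has_finite_limits C \<and> is_terminal C t}
     fst
     (\<lambda>(C, _) (D, _). {F. preserves_finite_limits C D F})"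

definition Rex :: "(('o, 'm) cat \<times> 'o, ('o, 'm, 'o, 'm) fctr, 'o \<Rightarrow> 'm) tcat" where
  "Rex = structured_2cat
     {(C, i). category C \<and> has_finite_colimits C \<and> is_initial C i}
     fst
     (\<lambda>(C, _) (D, _). {F. preserves_finite_colimits C D F})"


section \<open>Adequate triples\<close>

type_synonym ('o, 'm) arrow_class = "'o \<Rightarrow> 'o \<Rightarrow> 'm set"

definition wide_class :: "('o, 'm) cat \<Rightarrow> ('o, 'm) arrow_class \<Rightarrow> bool" where
  "wide_class C L \<longleftrightarrow> (\<forall>x y. L x y \<subseteq> Hom C x y) \<and> (\<forall>x \<in> Obj C. Ident C x \<in> L x x) \<and>
     (\<forall>x y z. \<forall>f \<in> L x y. \<forall>g \<in> L y z. Comp C x y z g f \<in> L x z)"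

type_synonym ('o, 'm) triple = "('o, 'm) cat \<times> ('o, 'm) arrow_class \<times> ('o, 'm) arrow_class"

definition adequate_triple :: "('o, 'm) triple \<Rightarrow> bool" where
  "adequate_triple = (\<lambda>(C, (L, R)).
     category C \<and> wide_class C L \<and> wide_class C R \<and>
     (\<forall>x y z. \<forall>r \<in> R x z. \<forall>l \<in> L y z.
        (\<exists>p p1 p2. is_pullback C p x y z p1 p2 r l) \<and>
        (\<forall>p p1 p2. is_pullback C p x y z p1 p2 r l \<longrightarrow> p1 \<in> L p x \<and> p2 \<in> R p y)))"

definition triple_map :: "('o, 'm) triple \<Rightarrow> ('o, 'm) triple \<Rightarrow> ('o, 'm, 'o, 'm) fctr \<Rightarrow> bool" where
  "triple_map = (\<lambda>(C, (L, R)) (D, (L', R')) F.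
     (\<forall>x y. \<forall>f \<in> L x y. FAr F x y f \<in> L' (FOb F x) (FOb F y)) \<and>
     (\<forall>x y. \<forall>f \<in> R x y. FAr F x y f \<in> R' (FOb F x) (FOb F y)) \<and>
     (\<forall>p x y z p1 p2. \<forall>r \<in> R x z. \<forall>l \<in> L y z. is_pullback C p x y z p1 p2 r l \<longrightarrow>
        is_pullback D (FOb F p) (FOb F x) (FOb F y) (FOb F z)
          (FAr F p x p1) (FAr F p y p2) (FAr F x z r) (FAr F y z l)))"

definition AdTr :: "(('o, 'm) triple, ('o, 'm, 'o, 'm) fctr, 'o \<Rightarrow> 'm) tcat" where
  "AdTr = structured_2cat {A. adequate_triple A} fst (\<lambda>A B. {F. triple_map A B F})"

text \<open>
  Pointed adequate triples. A 1-cell \<open>(A, c) \<rightarrow> (B, d)\<close> is a pair \<open>(F, i)\<close> of a 1-cell \<open>F : A \<rightarrow> B\<close>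
  and an isomorphism \<open>i : F c \<rightarrow> d\<close> in the left class of \<open>B\<close>. A 2-cell \<open>(F, i) \<Rightarrow> (G, j)\<close> is a
  2-cell \<open>\<alpha> : F \<Rightarrow> G\<close> such that \<open>j\<close> after \<open>\<alpha> c\<close> is \<open>i\<close>. The isomorphism attached to the composite
  of \<open>(F, i)\<close> and \<open>(G, j)\<close> is \<open>j\<close> after \<open>G i\<close>.
\<close>

definition pointed_cells ::
  "('o, 'm) triple \<times> 'o \<Rightarrow> ('o, 'm) triple \<times> 'o \<Rightarrow>
   (('o, 'm, 'o, 'm) fctr \<times> 'm, 'o \<Rightarrow> 'm) cat" where
  "pointed_cells = (\<lambda>(A, c) (B, d). case B of (D, (L, R)) \<Rightarrow> make_cat
     {(F, i). F \<in> Obj (HomCat AdTr A B) \<and> is_iso D (FOb F c) d i \<and> i \<in> L (FOb F c) d}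
     (\<lambda>(F, i) (G, j). {\<alpha> \<in> Hom (HomCat AdTr A B) F G.
        Comp D (FOb F c) (FOb G c) d j (\<alpha> c) = i})
     (\<lambda>(F, i). Ident (HomCat AdTr A B) F)
     (\<lambda>(F, i) (G, j) (H, k) \<beta> \<alpha>. Comp (HomCat AdTr A B) F G H \<beta> \<alpha>))"

definition AdTr_pt ::
  "(('o, 'm) triple \<times> 'o, ('o, 'm, 'o, 'm) fctr \<times> 'm, 'o \<Rightarrow> 'm) tcat" where
  "AdTr_pt =
    \<lparr> Ob = {(A, c). A \<in> Ob AdTr \<and> c \<in> Obj (fst A)},
      HomCat = pointed_cells,
      Id1 = (\<lambda>(A, c). (Id1 AdTr A, Ident (fst A) c)),
      CompF = (\<lambda>(A, c) (B, d) (E, e). make_fctr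
        (prod_cat (pointed_cells (B, d) (E, e)) (pointed_cells (A, c) (B, d)))
        (\<lambda>((G, j), (F, i)). (comp1 AdTr A B E G F,
           Comp (fst E) (FOb G (FOb F c)) (FOb G d) e j (FAr G (FOb F c) d i)))
        (\<lambda>((G, j), (F, i)) ((G', j'), (F', i')) (\<beta>, \<alpha>). hcomp AdTr A B E G G' F F' \<beta> \<alpha>)) \<rparr>"

definition forget_point ::
  "(('o, 'm) triple \<times> 'o, ('o, 'm, 'o, 'm) fctr \<times> 'm, 'o \<Rightarrow> 'm,
    ('o, 'm) triple, ('o, 'm, 'o, 'm) fctr, 'o \<Rightarrow> 'm) tfun" where
  "forget_point =
    \<lparr> T0 = fst,
      T1 = (\<lambda>a b. make_fctr (HomCat AdTr_pt a b) fst (\<lambda>_ _ \<alpha>. \<alpha>)) \<rparr>"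


section \<open>The 2-functors from lex and rex categories\<close>

definition all_triple :: "('o, 'm) cat \<Rightarrow> ('o, 'm) triple" where
  "all_triple C = (C, (Hom C, Hom C))"

definition Lex_to_AdTr ::
  "(('o, 'm) cat \<times> 'o, ('o, 'm, 'o, 'm) fctr, 'o \<Rightarrow> 'm,
    ('o, 'm) triple, ('o, 'm, 'o, 'm) fctr, 'o \<Rightarrow> 'm) tfun" where
  "Lex_to_AdTr =
    \<lparr> T0 = (\<lambda>(C, t). all_triple C),
      T1 = (\<lambda>a b. make_fctr (HomCat Lex a b) (\<lambda>F. F) (\<lambda>_ _ \<alpha>. \<alpha>)) \<rparr>"

text \<open>A 2-cell \<open>F \<Rightarrow> G\<close> of \<open>Rex\<^sup>c\<^sup>o\<close> is a natural transformation from \<open>G\<close> to \<open>F\<close>; the same family of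
  components is a natural transformation between the opposite functors, from that of \<open>F\<close> to that
  of \<open>G\<close>.\<close>

definition Rex_co_to_AdTr ::
  "(('o, 'm) cat \<times> 'o, ('o, 'm, 'o, 'm) fctr, 'o \<Rightarrow> 'm,
    ('o, 'm) triple, ('o, 'm, 'o, 'm) fctr, 'o \<Rightarrow> 'm) tfun" where
  "Rex_co_to_AdTr =
    \<lparr> T0 = (\<lambda>(C, i). all_triple (Opp C)),
      T1 = (\<lambda>a b. make_fctr (HomCat (co Rex) a b) Opp_fctr (\<lambda>_ _ \<alpha>. \<alpha>)) \<rparr>"

end

theory Submission
  imports Defs
begin

text \<open>
  A functor that preserves finite limits preserves terminal objects and pullbacks, since these are
  limits over the empty category and over the cospan. It is therefore a map between the triples in
  which both classes consist of all arrows. If \<open>t\<close> and \<open>u\<close> are the chosen terminal objects of its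
  domain and codomain, then \<open>F t\<close> is terminal, so there is exactly one arrow \<open>F t \<rightarrow> u\<close>, and it is an
  isomorphism. Attaching this arrow to \<open>F\<close> gives the lift to pointed adequate triples. Every
  equation to be checked for the attached arrows compares two arrows into a terminal object, so the
  lift is a 2-functor (\<open>two_functor_Lex_to_AdTr_pt\<close>).

  In the 2-categories of lex categories and of adequate triples, pointed or not, the strict product
  of a finite family is the product category with componentwise structure: limits, the two classes
  of arrows and pullbacks in it are componentwise
  (\<open>Lex_2product\<close>, \<open>AdTr_2product\<close>, \<open>AdTr_pt_2product\<close>). For a family of lex categories the chosen
  terminal object of the product is the tuple of the chosen ones, so the lift sends the product of
  the family to the product of the images, projections included (\<open>cartesian_Lex_to_AdTr_pt\<close>). This
  suffices for a 2-functor to be cartesian, because 2-products are unique up to isomorphism and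
  2-functors preserve isomorphisms (\<open>preserves_2product\<close>). The product category must have its objects
  and arrows in the given types; as these are infinite, they contain codes for finite tuples.

  The 2-functor that forgets points is cartesian for the same reason. Cartesian 2-functors compose
  (\<open>cartesian_2functor_lifts_along\<close>), so the 2-functor from lex categories to adequate triples is
  cartesian because its lift is.

  The statement for rex categories is the one for lex categories, precomposed with the passage to
  opposite categories. The latter is an isomorphism from \<open>co Rex\<close> to \<open>Lex\<close>: 2-cells are reversed because
  the opposite of a natural transformation goes the other way. An isomorphism of 2-categories is
  cartesian (\<open>cartesian_surjective_2equivalence\<close>).
\<close>

section \<open>Categories and functors\<close>

lemma make_cat_simps [simp]:
  "Obj (make_cat X H i m) = X"
  "Hom (make_cat X H i m) x y = (if x \<in> X \<and> y \<in> X then H x y else {})"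
  "x \<in> X \<Longrightarrow> Ident (make_cat X H i m) x = i x"
  "\<lbrakk>x \<in> X; y \<in> X; z \<in> X; f \<in> H x y; g \<in> H y z\<rbrakk> \<Longrightarrow> Comp (make_cat X H i m) x y z g f = m x y z g f"
  by (simp_all add: make_cat_def)

text \<open>Categories and functors built by \<open>make_cat\<close> and \<open>make_fctr\<close> are extensional because truncating
  twice is the same as truncating once.\<close>

lemma make_cat_idem:
  "make_cat (Obj (make_cat X H i m)) (Hom (make_cat X H i m))
     (Ident (make_cat X H i m)) (Comp (make_cat X H i m)) = make_cat X H i m"
  by (auto simp: make_cat_def fun_eq_iff)

lemma category_make_cat:
  assumes "\<And>x. x \<in> X \<Longrightarrow> i x \<in> H x x"
    and "\<And>x y z f g. \<lbrakk>x \<in> X; y \<in> X; z \<in> X; f \<in> H x y; g \<in> H y z\<rbrakk> \<Longrightarrow> m x y z g f \<in> H x z"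
    and "\<And>x y f. \<lbrakk>x \<in> X; y \<in> X; f \<in> H x y\<rbrakk> \<Longrightarrow> m x x y f (i x) = f"
    and "\<And>x y f. \<lbrakk>x \<in> X; y \<in> X; f \<in> H x y\<rbrakk> \<Longrightarrow> m x y y (i y) f = f"
    and "\<And>w x y z f g h. \<lbrakk>w \<in> X; x \<in> X; y \<in> X; z \<in> X; f \<in> H w x; g \<in> H x y; h \<in> H y z\<rbrakk> \<Longrightarrow>
      m w x z (m x y z h g) f = m w y z h (m w x y g f)"
  shows "category (make_cat X H i m)"
  by (unfold_locales, simp only: make_cat_idem) (auto simp: assms split: if_splits)

context category
begin

lemma hom_obj: assumes "f \<in> Hom C x y" shows "x \<in> Obj C" "y \<in> Obj C"
proof -
  have "Hom C x y = Hom (make_cat (Obj C) (Hom C) (Ident C) (Comp C)) x y"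
    using extensional by simp
  then show "x \<in> Obj C" "y \<in> Obj C" using assms by (auto split: if_splits)
qed

end

lemma make_fctr_simps [simp]:
  "x \<in> Obj C \<Longrightarrow> FOb (make_fctr C a h) x = a x"
  "\<lbrakk>category C; f \<in> Hom C x y\<rbrakk> \<Longrightarrow> FAr (make_fctr C a h) x y f = h x y f"
  by (auto simp: make_fctr_def dest: category.hom_obj)

lemma make_fctr_idem:
  "make_fctr C (FOb (make_fctr C a h)) (FAr (make_fctr C a h)) = make_fctr C a h"
  by (auto simp: make_fctr_def fun_eq_iff)

lemma make_fctr_cong:
  assumes "\<And>x. x \<in> Obj C \<Longrightarrow> a x = a' x"
    and "\<And>x y f. \<lbrakk>x \<in> Obj C; y \<in> Obj C; f \<in> Hom C x y\<rbrakk> \<Longrightarrow> h x y f = h' x y f"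
  shows "make_fctr C a h = make_fctr C a' h'"
  using assms by (auto simp: make_fctr_def fun_eq_iff)

lemma is_functor_make_fctr:
  assumes "category C" "category D"
    and "\<And>x. x \<in> Obj C \<Longrightarrow> a x \<in> Obj D"
    and "\<And>x y f. \<lbrakk>x \<in> Obj C; y \<in> Obj C; f \<in> Hom C x y\<rbrakk> \<Longrightarrow> h x y f \<in> Hom D (a x) (a y)"
    and "\<And>x. x \<in> Obj C \<Longrightarrow> h x x (Ident C x) = Ident D (a x)"
    and "\<And>x y z f g. \<lbrakk>x \<in> Obj C; y \<in> Obj C; z \<in> Obj C; f \<in> Hom C x y; g \<in> Hom C y z\<rbrakk> \<Longrightarrow>
      h x z (Comp C x y z g f) = Comp D (a x) (a y) (a z) (h y z g) (h x y f)"
  shows "is_functor C D (make_fctr C a h)"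
proof -
  interpret C: category C by fact
  interpret D: category D by fact
  show ?thesis
  proof (unfold_locales, simp only: make_fctr_idem)
    fix x y z f g assume f: "f \<in> Hom C x y" and g: "g \<in> Hom C y z"
    note o = C.hom_obj[OF f] C.hom_obj[OF g]
    have "Comp C x y z g f \<in> Hom C x z" using f g by (rule C.comp_in_hom)
    then show "FAr (make_fctr C a h) x z (Comp C x y z g f) =
      Comp D (FOb (make_fctr C a h) x) (FOb (make_fctr C a h) y) (FOb (make_fctr C a h) z)
       (FAr (make_fctr C a h) y z g) (FAr (make_fctr C a h) x y f)"
      using o f g assms by simp
  next
    fix x y f assume f: "f \<in> Hom C x y"
    then show "FAr (make_fctr C a h) x y f \<in> Hom D (FOb (make_fctr C a h) x) (FOb (make_fctr C a h) y)"
      using C.hom_obj[OF f] assms by simp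
  qed (auto simp: assms C.ident_in_hom)
qed

text \<open>Extensionality is what makes strict equations between functors provable from their values on
  objects and arrows.\<close>

lemma fctr_eqI:
  assumes "is_functor C D F" "is_functor C D' G"
    and "\<And>x. x \<in> Obj C \<Longrightarrow> FOb F x = FOb G x"
    and "\<And>x y f. \<lbrakk>x \<in> Obj C; y \<in> Obj C; f \<in> Hom C x y\<rbrakk> \<Longrightarrow> FAr F x y f = FAr G x y f"
  shows "F = G"
  using is_functor.extensional[OF assms(1)] is_functor.extensional[OF assms(2)]
    make_fctr_cong[of C "FOb F" "FOb G" "FAr F" "FAr G"] assms(3,4) by simp

lemma is_functor_id: "category C \<Longrightarrow> is_functor C C (id_fctr C)"
  unfolding id_fctr_def by (rule is_functor_make_fctr) auto

lemma id_fctr_simps [simp]: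
  "x \<in> Obj C \<Longrightarrow> FOb (id_fctr C) x = x"
  "\<lbrakk>category C; f \<in> Hom C x y\<rbrakk> \<Longrightarrow> FAr (id_fctr C) x y f = f"
  by (simp_all add: id_fctr_def)

lemma fctr_comp_simps [simp]:
  "x \<in> Obj C \<Longrightarrow> FOb (fctr_comp C G F) x = FOb G (FOb F x)"
  "\<lbrakk>category C; f \<in> Hom C x y\<rbrakk> \<Longrightarrow>
     FAr (fctr_comp C G F) x y f = FAr G (FOb F x) (FOb F y) (FAr F x y f)"
  by (simp_all add: fctr_comp_def)

lemma is_functor_comp:
  assumes "is_functor C D F" "is_functor D E G"
  shows "is_functor C E (fctr_comp C G F)"
proof -
  interpret F: is_functor C D F by fact
  interpret G: is_functor D E G by fact
  show ?thesis unfolding fctr_comp_def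
    by (rule is_functor_make_fctr)
      (auto intro!: F.dom.category_axioms G.cod.category_axioms F.maps_obj G.maps_obj
        F.maps_hom G.maps_hom simp: F.maps_ident G.maps_ident[OF F.maps_obj] F.maps_comp G.maps_comp[OF F.maps_hom F.maps_hom])
qed

lemma fctr_comp_assoc:
  assumes "is_functor B C F" "is_functor C D G"
  shows "fctr_comp B (fctr_comp C H G) F = fctr_comp B H (fctr_comp B G F)"
proof -
  interpret F: is_functor B C F by fact
  interpret G: is_functor C D G by fact
  show ?thesis unfolding fctr_comp_def[of B]
    by (rule make_fctr_cong)
      (auto simp: F.maps_obj F.maps_hom fctr_comp_def F.cod.category_axioms F.dom.category_axioms)
qed

lemma fctr_comp_id_right: "is_functor C D F \<Longrightarrow> fctr_comp C F (id_fctr C) = F"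
  by (rule fctr_eqI[of C D _ D], rule is_functor_comp, rule is_functor_id)
     (auto simp: is_functor_def)

lemma fctr_comp_id_left: "is_functor C D F \<Longrightarrow> fctr_comp C (id_fctr D) F = F"
  by (rule fctr_eqI[of C D _ D], rule is_functor_comp, assumption, rule is_functor_id)
     (auto simp: is_functor_def is_functor.maps_obj is_functor.maps_hom)

lemma prod_cat_simps [simp]:
  "Obj (prod_cat C D) = Obj C \<times> Obj D"
  "\<lbrakk>x \<in> Obj C; x' \<in> Obj D\<rbrakk> \<Longrightarrow> Ident (prod_cat C D) (x, x') = (Ident C x, Ident D x')"
  by (simp_all add: prod_cat_def)

lemma prod_cat_hom [simp]:
  "\<lbrakk>category C; category D\<rbrakk> \<Longrightarrow>
    Hom (prod_cat C D) (x, x') (y, y') = Hom C x y \<times> Hom D x' y'"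
  by (auto simp: prod_cat_def dest: category.hom_obj)

lemma prod_cat_comp [simp]:
  "\<lbrakk>category C; category D; f \<in> Hom C x y; g \<in> Hom C y z; f' \<in> Hom D x' y'; g' \<in> Hom D y' z'\<rbrakk> \<Longrightarrow>
    Comp (prod_cat C D) (x, x') (y, y') (z, z') (g, g') (f, f') =
      (Comp C x y z g f, Comp D x' y' z' g' f')"
  using category.hom_obj[of C] category.hom_obj[of D] by (auto simp: prod_cat_def)

lemma category_prod_cat: "\<lbrakk>category C; category D\<rbrakk> \<Longrightarrow> category (prod_cat C D)"
  unfolding prod_cat_def
  by (rule category_make_cat)
     (auto intro: category.ident_in_hom category.comp_in_hom
       simp: category.comp_ident_left category.comp_ident_right category.comp_assoc)

lemma nat_transD:
  assumes "\<alpha> \<in> nat_trans C D F G"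
  shows "x \<in> Obj C \<Longrightarrow> \<alpha> x \<in> Hom D (FOb F x) (FOb G x)"
    and "\<lbrakk>x \<in> Obj C; y \<in> Obj C; f \<in> Hom C x y\<rbrakk> \<Longrightarrow>
      Comp D (FOb F x) (FOb F y) (FOb G y) (\<alpha> y) (FAr F x y f) =
      Comp D (FOb F x) (FOb G x) (FOb G y) (FAr G x y f) (\<alpha> x)"
    and "\<alpha> \<in> extensional (Obj C)"
  using assms by (auto simp: nat_trans_def PiE_def Pi_def)

lemma nat_transI:
  assumes "\<alpha> \<in> extensional (Obj C)" "\<And>x. x \<in> Obj C \<Longrightarrow> \<alpha> x \<in> Hom D (FOb F x) (FOb G x)"
    and "\<And>x y f. \<lbrakk>x \<in> Obj C; y \<in> Obj C; f \<in> Hom C x y\<rbrakk> \<Longrightarrow>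
      Comp D (FOb F x) (FOb F y) (FOb G y) (\<alpha> y) (FAr F x y f) =
      Comp D (FOb F x) (FOb G x) (FOb G y) (FAr G x y f) (\<alpha> x)"
  shows "\<alpha> \<in> nat_trans C D F G"
  using assms by (auto simp: nat_trans_def PiE_def Pi_def)

lemma nat_trans_eqI:
  assumes "\<alpha> \<in> nat_trans C D F G" "\<beta> \<in> nat_trans C D F' G'" "\<And>x. x \<in> Obj C \<Longrightarrow> \<alpha> x = \<beta> x"
  shows "\<alpha> = \<beta>"
  using assms by (auto intro: extensionalityI dest: nat_transD(3))

lemma nat_trans_ident:
  assumes "is_functor C D F"
  shows "(\<lambda>x \<in> Obj C. Ident D (FOb F x)) \<in> nat_trans C D F F"
proof -
  interpret F: is_functor C D F by fact
  show ?thesis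
    by (rule nat_transI)
       (auto simp: F.cod.ident_in_hom F.maps_obj F.cod.comp_ident_left[OF F.maps_hom]
         F.cod.comp_ident_right[OF F.maps_hom])
qed

lemma nat_trans_vcomp:
  assumes "is_functor C D F" "is_functor C D G" "is_functor C D H"
    and a: "\<alpha> \<in> nat_trans C D F G" and b: "\<beta> \<in> nat_trans C D G H"
  shows "(\<lambda>x \<in> Obj C. Comp D (FOb F x) (FOb G x) (FOb H x) (\<beta> x) (\<alpha> x)) \<in> nat_trans C D F H"
proof -
  interpret F: is_functor C D F by fact
  interpret G: is_functor C D G by fact
  interpret H: is_functor C D H by fact
  let ?F = "FOb F" and ?G = "FOb G" and ?H = "FOb H"
  show ?thesis
  proof (rule nat_transI)
    fix x y f assume x: "x \<in> Obj C" and y: "y \<in> Obj C" and f: "f \<in> Hom C x y"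
    note h = nat_transD(1)[OF a x] nat_transD(1)[OF a y] nat_transD(1)[OF b x]
      nat_transD(1)[OF b y] F.maps_hom[OF f] G.maps_hom[OF f] H.maps_hom[OF f]
    show "Comp D (?F x) (?F y) (?H y) ((\<lambda>x\<in>Obj C. Comp D (?F x) (?G x) (?H x) (\<beta> x) (\<alpha> x)) y)
        (FAr F x y f) =
      Comp D (?F x) (?H x) (?H y) (FAr H x y f)
        ((\<lambda>x\<in>Obj C. Comp D (?F x) (?G x) (?H x) (\<beta> x) (\<alpha> x)) x)"
      using x y h nat_transD(2)[OF a x y f] nat_transD(2)[OF b x y f]
        F.cod.comp_assoc[OF h(5) h(2) h(4)] F.cod.comp_assoc[OF h(1) h(6) h(4)]
        F.cod.comp_assoc[OF h(1) h(3) h(7)] by simp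
  qed (auto intro: F.cod.comp_in_hom nat_transD[OF a] nat_transD[OF b])
qed

lemma functor_cat_simps [simp]:
  "F \<in> Obj (functor_cat C D S) \<longleftrightarrow> F \<in> S \<and> is_functor C D F"
  "\<alpha> \<in> Hom (functor_cat C D S) F G \<longleftrightarrow>
    F \<in> S \<and> G \<in> S \<and> is_functor C D F \<and> is_functor C D G \<and> \<alpha> \<in> nat_trans C D F G"
  by (auto simp: functor_cat_def)

lemma functor_cat_ident [simp]:
  "\<lbrakk>F \<in> S; is_functor C D F\<rbrakk> \<Longrightarrow> Ident (functor_cat C D S) F = (\<lambda>x \<in> Obj C. Ident D (FOb F x))"
  by (simp add: functor_cat_def)

lemma functor_cat_comp [simp]:
  "\<lbrakk>F \<in> S; G \<in> S; H \<in> S; is_functor C D F; is_functor C D G; is_functor C D H;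
    \<alpha> \<in> nat_trans C D F G; \<beta> \<in> nat_trans C D G H\<rbrakk> \<Longrightarrow>
   Comp (functor_cat C D S) F G H \<beta> \<alpha> =
     (\<lambda>x \<in> Obj C. Comp D (FOb F x) (FOb G x) (FOb H x) (\<beta> x) (\<alpha> x))"
  by (simp add: functor_cat_def)

lemma category_functor_cat: "category (functor_cat C D S)"
  unfolding functor_cat_def
proof (rule category_make_cat, goal_cases)
  case (1 F) then show ?case by (auto intro: nat_trans_ident)
next
  case (2 F G H \<alpha> \<beta>) then show ?case by (auto intro: nat_trans_vcomp)
next
  case (3 F G \<alpha>)
  then interpret F: is_functor C D F by simp
  interpret G: is_functor C D G using 3 by simp
  show ?case using 3
    by (auto intro!: extensionalityI[of _ "Obj C" \<alpha>] F.cod.comp_ident_right nat_transD(1)[of \<alpha> C D]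
        simp: nat_transD(3)[of \<alpha> C D])
next
  case (4 F G \<alpha>)
  then interpret F: is_functor C D F by simp
  interpret G: is_functor C D G using 4 by simp
  show ?case using 4
    by (auto intro!: extensionalityI[of _ "Obj C" \<alpha>] F.cod.comp_ident_left nat_transD(1)[of \<alpha> C D]
        simp: nat_transD(3)[of \<alpha> C D])
next
  case (5 F G H K \<alpha> \<beta> \<gamma>)
  then interpret F: is_functor C D F by simp
  from 5 have a: "\<alpha> \<in> nat_trans C D F G" "\<beta> \<in> nat_trans C D G H" "\<gamma> \<in> nat_trans C D H K" by auto
  show ?case
    by (auto intro!: restrict_ext F.cod.comp_assoc a[THEN nat_transD(1)])
qed

section \<open>Horizontal composition and 2-categories of structured categories\<close>

text \<open>A commutative square, pasted in front of a further arrow, in the right-nested form in which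
  composites are kept below.\<close>

lemma (in category) comp_square_right:
  assumes "Comp C x y z g f = Comp C x y' z g' f'"
    and "f \<in> Hom C x y" "g \<in> Hom C y z" "f' \<in> Hom C x y'" "g' \<in> Hom C y' z" "h \<in> Hom C w x"
  shows "Comp C w y z g (Comp C w x y f h) = Comp C w y' z g' (Comp C w x y' f' h)"
  using assms comp_assoc[OF assms(6,2,3)] comp_assoc[OF assms(6,4,5)] by simp

text \<open>The horizontal composite used in \<open>structured_2cat\<close>, which depends on the two outer categories
  only.\<close>

definition hcomp_trans ::
  "('o, 'm) cat \<Rightarrow> ('q, 'k) cat \<Rightarrow> ('p, 'n, 'q, 'k) fctr \<Rightarrow> ('p, 'n, 'q, 'k) fctr \<Rightarrow>
   ('o, 'm, 'p, 'n) fctr \<Rightarrow> ('o, 'm, 'p, 'n) fctr \<Rightarrow> ('p \<Rightarrow> 'k) \<Rightarrow> ('o \<Rightarrow> 'n) \<Rightarrow> 'o \<Rightarrow> 'k" where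
  "hcomp_trans C E G G' F F' \<beta> \<alpha> = (\<lambda>x \<in> Obj C.
     Comp E (FOb G (FOb F x)) (FOb G' (FOb F x)) (FOb G' (FOb F' x))
       (FAr G' (FOb F x) (FOb F' x) (\<alpha> x)) (\<beta> (FOb F x)))"

text \<open>Naturality pastes the square of \<open>\<beta>\<close> at \<open>FAr F x y f\<close> and the image under \<open>G'\<close> of the square of
  \<open>\<alpha>\<close> at \<open>f\<close>.\<close>

lemma hcomp_trans_in:
  assumes "is_functor C D F" "is_functor C D F'" "is_functor D E G" "is_functor D E G'"
    and a: "\<alpha> \<in> nat_trans C D F F'" and b: "\<beta> \<in> nat_trans D E G G'"
  shows "hcomp_trans C E G G' F F' \<beta> \<alpha> \<in> nat_trans C E (fctr_comp C G F) (fctr_comp C G' F')"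
proof -
  interpret F: is_functor C D F by fact
  interpret F': is_functor C D F' by fact
  interpret G: is_functor D E G by fact
  interpret G': is_functor D E G' by fact
  show ?thesis
  proof (rule nat_transI)
    fix x y f assume x: "x \<in> Obj C" and y: "y \<in> Obj C" and f: "f \<in> Hom C x y"
    note o = F.maps_obj[OF x] F.maps_obj[OF y] F'.maps_obj[OF x] F'.maps_obj[OF y]
    note ax = nat_transD(1)[OF a x] and ay = nat_transD(1)[OF a y]
    note bx = nat_transD(1)[OF b o(1)] and b_y = nat_transD(1)[OF b o(2)]
    note Ff = F.maps_hom[OF f] and F'f = F'.maps_hom[OF f]
    have 1: "Comp E (FOb G (FOb F x)) (FOb G (FOb F y)) (FOb G' (FOb F y))
               (\<beta> (FOb F y)) (FAr G (FOb F x) (FOb F y) (FAr F x y f))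
           = Comp E (FOb G (FOb F x)) (FOb G' (FOb F x)) (FOb G' (FOb F y))
               (FAr G' (FOb F x) (FOb F y) (FAr F x y f)) (\<beta> (FOb F x))"
      by (rule nat_transD(2)[OF b o(1,2) Ff])
    have 2: "Comp E (FOb G' (FOb F x)) (FOb G' (FOb F y)) (FOb G' (FOb F' y))
               (FAr G' (FOb F y) (FOb F' y) (\<alpha> y)) (FAr G' (FOb F x) (FOb F y) (FAr F x y f))
           = Comp E (FOb G' (FOb F x)) (FOb G' (FOb F' x)) (FOb G' (FOb F' y))
               (FAr G' (FOb F' x) (FOb F' y) (FAr F' x y f)) (FAr G' (FOb F x) (FOb F' x) (\<alpha> x))"
      using G'.maps_comp[OF Ff ay] G'.maps_comp[OF ax F'f] nat_transD(2)[OF a x y f] by simp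
    show "Comp E (FOb (fctr_comp C G F) x) (FOb (fctr_comp C G F) y) (FOb (fctr_comp C G' F') y)
        (hcomp_trans C E G G' F F' \<beta> \<alpha> y) (FAr (fctr_comp C G F) x y f) =
      Comp E (FOb (fctr_comp C G F) x) (FOb (fctr_comp C G' F') x) (FOb (fctr_comp C G' F') y)
        (FAr (fctr_comp C G' F') x y f) (hcomp_trans C E G G' F F' \<beta> \<alpha> x)"
      using x y f 1 F.dom.category_axioms
        G.cod.comp_assoc[OF G.maps_hom[OF Ff] b_y G'.maps_hom[OF ay]]
        G.cod.comp_square_right[OF 2 G'.maps_hom[OF Ff] G'.maps_hom[OF ay] G'.maps_hom[OF ax] G'.maps_hom[OF F'f] bx]
      by (simp add: hcomp_trans_def)
  next
    fix x assume x: "x \<in> Obj C"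
    then show "hcomp_trans C E G G' F F' \<beta> \<alpha> x
      \<in> Hom E (FOb (fctr_comp C G F) x) (FOb (fctr_comp C G' F') x)"
      using G.cod.comp_in_hom[OF nat_transD(1)[OF b F.maps_obj[OF x]] G'.maps_hom[OF nat_transD(1)[OF a x]]]
      by (simp add: hcomp_trans_def)
  qed (simp add: hcomp_trans_def)
qed

lemma hcomp_trans_ident:
  assumes "is_functor C D F" "is_functor D E G"
  shows "hcomp_trans C E G G F F (\<lambda>x \<in> Obj D. Ident E (FOb G x)) (\<lambda>x \<in> Obj C. Ident D (FOb F x)) =
    (\<lambda>x \<in> Obj C. Ident E (FOb G (FOb F x)))"
proof -
  interpret F: is_functor C D F by fact
  interpret G: is_functor D E G by fact
  show ?thesis
    by (auto simp: hcomp_trans_def F.maps_obj G.maps_ident G.maps_obj G.cod.comp_ident_left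
        G.cod.ident_in_hom intro!: restrict_ext)
qed

text \<open>The interchange law. The two sides differ by the order in which \<open>\<beta>'\<close> and \<open>\<alpha>\<close> are applied, and
  the naturality square of \<open>\<beta>'\<close> at the arrow \<open>\<alpha> x\<close> exchanges them.\<close>

lemma hcomp_trans_vcomp:
  assumes "is_functor C D F" "is_functor C D F'" "is_functor C D F''"
    "is_functor D E G" "is_functor D E G'" "is_functor D E G''"
    and a: "\<alpha> \<in> nat_trans C D F F'" and a': "\<alpha>' \<in> nat_trans C D F' F''"
    and b: "\<beta> \<in> nat_trans D E G G'" and b': "\<beta>' \<in> nat_trans D E G' G''"
    and x: "x \<in> Obj C"
  shows "hcomp_trans C E G G'' F F''
      (\<lambda>y \<in> Obj D. Comp E (FOb G y) (FOb G' y) (FOb G'' y) (\<beta>' y) (\<beta> y))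
      (\<lambda>y \<in> Obj C. Comp D (FOb F y) (FOb F' y) (FOb F'' y) (\<alpha>' y) (\<alpha> y)) x =
    Comp E (FOb G (FOb F x)) (FOb G' (FOb F' x)) (FOb G'' (FOb F'' x))
      (hcomp_trans C E G' G'' F' F'' \<beta>' \<alpha>' x) (hcomp_trans C E G G' F F' \<beta> \<alpha> x)"
proof -
  interpret F: is_functor C D F by fact
  interpret F': is_functor C D F' by fact
  interpret F'': is_functor C D F'' by fact
  interpret G: is_functor D E G by fact
  interpret G': is_functor D E G' by fact
  interpret G'': is_functor D E G'' by fact
  note Fx = F.maps_obj[OF x] and F'x = F'.maps_obj[OF x]
  note ax = nat_transD(1)[OF a x] and a'x = nat_transD(1)[OF a' x]
  note bx = nat_transD(1)[OF b Fx] and b'x = nat_transD(1)[OF b' Fx] and b'x' = nat_transD(1)[OF b' F'x]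
  let ?F = "FOb F x" and ?F' = "FOb F' x" and ?F'' = "FOb F'' x"
  let ?u = "FAr G'' ?F ?F' (\<alpha> x)" and ?u' = "FAr G'' ?F' ?F'' (\<alpha>' x)" and ?v = "FAr G' ?F ?F' (\<alpha> x)"
  note u = G''.maps_hom[OF ax] and u' = G''.maps_hom[OF a'x] and v = G'.maps_hom[OF ax]
  have nat: "Comp E (FOb G' ?F) (FOb G' ?F') (FOb G'' ?F') (\<beta>' ?F') ?v =
    Comp E (FOb G' ?F) (FOb G'' ?F) (FOb G'' ?F') ?u (\<beta>' ?F)"
    by (rule nat_transD(2)[OF b' Fx F'x ax])
  show ?thesis
    using x Fx F'x G''.maps_comp[OF ax a'x]
      G.cod.comp_assoc[OF G.cod.comp_in_hom[OF bx b'x] u u']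
      G.cod.comp_assoc[OF bx b'x u] G.cod.comp_assoc[OF G.cod.comp_in_hom[OF bx v] b'x' u']
      G.cod.comp_square_right[OF nat v b'x' b'x u bx]
    by (simp add: hcomp_trans_def)
qed

lemma hcomp_trans_unit_right:
  assumes "is_functor C D F" "is_functor C D F'" "\<alpha> \<in> nat_trans C D F F'"
  shows "hcomp_trans C D F F' (id_fctr C) (id_fctr C) \<alpha> (\<lambda>x \<in> Obj C. Ident C (FOb (id_fctr C) x)) = \<alpha>"
proof -
  interpret F: is_functor C D F by fact
  interpret F': is_functor C D F' by fact
  show ?thesis
    by (rule extensionalityI[of _ "Obj C"])
      (auto simp: hcomp_trans_def F'.maps_ident F.cod.comp_ident_left[OF nat_transD(1)[OF assms(3)]]
        nat_transD(3)[OF assms(3)])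
qed

lemma hcomp_trans_unit_left:
  assumes "is_functor C D F" "is_functor C D F'" "\<alpha> \<in> nat_trans C D F F'"
  shows "hcomp_trans C D (id_fctr D) (id_fctr D) F F' (\<lambda>x \<in> Obj D. Ident D (FOb (id_fctr D) x)) \<alpha> = \<alpha>"
proof -
  interpret F: is_functor C D F by fact
  interpret F': is_functor C D F' by fact
  show ?thesis
    by (rule extensionalityI[of _ "Obj C"])
      (auto simp: hcomp_trans_def F.maps_obj F'.maps_obj F.cod.category_axioms
        nat_transD(1)[OF assms(3)] F.cod.comp_ident_right[OF nat_transD(1)[OF assms(3)]]
        nat_transD(3)[OF assms(3)])
qed

lemma hcomp_trans_assoc:
  assumes "is_functor B C F" "is_functor B C F'" "is_functor C D G" "is_functor C D G'"
    "is_functor D E H" "is_functor D E H'"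
    and a: "\<alpha> \<in> nat_trans B C F F'" and b: "\<beta> \<in> nat_trans C D G G'" and c: "\<gamma> \<in> nat_trans D E H H'"
  shows "hcomp_trans B E (fctr_comp C H G) (fctr_comp C H' G') F F' (hcomp_trans C E H H' G G' \<gamma> \<beta>) \<alpha> =
    hcomp_trans B E H H' (fctr_comp B G F) (fctr_comp B G' F') \<gamma> (hcomp_trans B D G G' F F' \<beta> \<alpha>)"
proof -
  interpret F: is_functor B C F by fact
  interpret F': is_functor B C F' by fact
  interpret G: is_functor C D G by fact
  interpret G': is_functor C D G' by fact
  interpret H: is_functor D E H by fact
  interpret H': is_functor D E H' by fact
  have "hcomp_trans B E (fctr_comp C H G) (fctr_comp C H' G') F F' (hcomp_trans C E H H' G G' \<gamma> \<beta>) \<alpha> x =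
    hcomp_trans B E H H' (fctr_comp B G F) (fctr_comp B G' F') \<gamma> (hcomp_trans B D G G' F F' \<beta> \<alpha>) x"
    if x: "x \<in> Obj B" for x
  proof -
    note Fx = F.maps_obj[OF x] and F'x = F'.maps_obj[OF x]
    note ax = nat_transD(1)[OF a x]
    note bx = nat_transD(1)[OF b Fx] and cx = nat_transD(1)[OF c G.maps_obj[OF Fx]]
    show ?thesis
      using x Fx F'x ax H'.maps_comp[OF bx G'.maps_hom[OF ax]]
        H.cod.comp_assoc[OF cx H'.maps_hom[OF bx] H'.maps_hom[OF G'.maps_hom[OF ax]]]
      by (simp add: hcomp_trans_def F.cod.category_axioms)
  qed
  then show ?thesis
    by (intro extensionalityI[of _ "Obj B"]) (auto simp: hcomp_trans_def)
qed

lemma structured_2cat_simps [simp]: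
  "Ob (structured_2cat X U S) = X"
  "HomCat (structured_2cat X U S) a b = functor_cat (U a) (U b) (S a b)"
  "Id1 (structured_2cat X U S) a = id_fctr (U a)"
  by (simp_all add: structured_2cat_def)

lemma structured_comp1 [simp]:
  "\<lbrakk>F \<in> S a b; is_functor (U a) (U b) F; G \<in> S b c; is_functor (U b) (U c) G\<rbrakk> \<Longrightarrow>
    comp1 (structured_2cat X U S) a b c G F = fctr_comp (U a) G F"
  by (simp add: structured_2cat_def)

lemma structured_hcomp [simp]:
  "\<lbrakk>\<alpha> \<in> Hom (functor_cat (U a) (U b) (S a b)) F F'; \<beta> \<in> Hom (functor_cat (U b) (U c) (S b c)) G G'\<rbrakk> \<Longrightarrow>
    hcomp (structured_2cat X U S) a b c G G' F F' \<beta> \<alpha> = hcomp_trans (U a) (U c) G G' F F' \<beta> \<alpha>"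
  by (simp add: structured_2cat_def hcomp_trans_def category_functor_cat category_prod_cat
      del: functor_cat_simps)

text \<open>A 2-category of structured categories is a sub-2-category of the 2-category of categories that
  is full on 2-cells. So the only thing left to know about the structure is that identities and
  composites of structured functors are structured.\<close>

locale structured =
  fixes X :: "'a set" and U :: "'a \<Rightarrow> ('o, 'm) cat"
    and S :: "'a \<Rightarrow> 'a \<Rightarrow> ('o, 'm, 'o, 'm) fctr set"
  assumes underlying: "a \<in> X \<Longrightarrow> category (U a)"
    and id_structured: "a \<in> X \<Longrightarrow> id_fctr (U a) \<in> S a a"
    and comp_structured: "\<lbrakk>a \<in> X; b \<in> X; c \<in> X; F \<in> S a b; G \<in> S b c;
      is_functor (U a) (U b) F; is_functor (U b) (U c) G\<rbrakk> \<Longrightarrow> fctr_comp (U a) G F \<in> S a c"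
begin

abbreviation K where "K \<equiv> structured_2cat X U S"

text \<open>Functoriality of composition is the interchange law, applied to all components.\<close>

lemma comp_functor:
  assumes "a \<in> X" "b \<in> X" "c \<in> X"
  shows "is_functor (prod_cat (HomCat K b c) (HomCat K a b)) (HomCat K a c) (CompF K a b c)"
proof -
  have eq: "CompF K a b c = make_fctr (prod_cat (HomCat K b c) (HomCat K a b))
    (\<lambda>(G, F). fctr_comp (U a) G F)
    (\<lambda>(G, F) (G', F') (\<beta>, \<alpha>). hcomp_trans (U a) (U c) G G' F F' \<beta> \<alpha>)"
    by (simp add: structured_2cat_def hcomp_trans_def)
  show ?thesis unfolding eq
  proof (rule is_functor_make_fctr, goal_cases)
    case 1 show ?case by (simp add: category_prod_cat category_functor_cat)
  next
    case 2 show ?case by (simp add: category_functor_cat)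
  next
    case (3 x)
    then obtain G F where x: "x = (G, F)" and F: "F \<in> S a b" "is_functor (U a) (U b) F"
      and G: "G \<in> S b c" "is_functor (U b) (U c) G" by (cases x) auto
    show ?case using comp_structured[OF assms F(1) G(1) F(2) G(2)] is_functor_comp[OF F(2) G(2)]
      by (simp add: x)
  next
    case (4 x y f)
    obtain G F where x: "x = (G, F)" by (cases x)
    obtain G' F' where y: "y = (G', F')" by (cases y)
    obtain \<beta> \<alpha> where f: "f = (\<beta>, \<alpha>)" by (cases f)
    have F: "is_functor (U a) (U b) F" "is_functor (U a) (U b) F'"
      "is_functor (U b) (U c) G" "is_functor (U b) (U c) G'"
      and S: "F \<in> S a b" "F' \<in> S a b" "G \<in> S b c" "G' \<in> S b c"
      and ab: "\<alpha> \<in> nat_trans (U a) (U b) F F'" "\<beta> \<in> nat_trans (U b) (U c) G G'"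
      using 4 by (simp_all add: x y f category_functor_cat)
    show ?case using hcomp_trans_in[OF F ab] is_functor_comp[OF F(1,3)] is_functor_comp[OF F(2,4)]
        comp_structured[OF assms S(1,3) F(1,3)] comp_structured[OF assms S(2,4) F(2,4)]
      by (simp add: x y f)
  next
    case (5 x)
    then obtain G F where x: "x = (G, F)" and F: "F \<in> S a b" "is_functor (U a) (U b) F"
      and G: "G \<in> S b c" "is_functor (U b) (U c) G" by (cases x) auto
    have "(\<lambda>x \<in> Obj (U a). Ident (U c) (FOb G (FOb F x))) =
      (\<lambda>x \<in> Obj (U a). Ident (U c) (FOb (fctr_comp (U a) G F) x))"
      by (rule restrict_ext) simp
    then show ?case
      using F G comp_structured[OF assms F(1) G(1) F(2) G(2)] is_functor_comp[OF F(2) G(2)]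
      by (simp add: x hcomp_trans_ident)
  next
    case (6 x y z f g)
    obtain G F where x: "x = (G, F)" by (cases x)
    obtain G' F' where y: "y = (G', F')" by (cases y)
    obtain G'' F'' where z: "z = (G'', F'')" by (cases z)
    obtain \<beta> \<alpha> where f: "f = (\<beta>, \<alpha>)" by (cases f)
    obtain \<beta>' \<alpha>' where g: "g = (\<beta>', \<alpha>')" by (cases g)
    have F: "is_functor (U a) (U b) F" "is_functor (U a) (U b) F'" "is_functor (U a) (U b) F''"
      "is_functor (U b) (U c) G" "is_functor (U b) (U c) G'" "is_functor (U b) (U c) G''"
      and S: "F \<in> S a b" "F' \<in> S a b" "F'' \<in> S a b" "G \<in> S b c" "G' \<in> S b c" "G'' \<in> S b c"
      and ab: "\<alpha> \<in> nat_trans (U a) (U b) F F'" "\<alpha>' \<in> nat_trans (U a) (U b) F' F''"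
      "\<beta> \<in> nat_trans (U b) (U c) G G'" "\<beta>' \<in> nat_trans (U b) (U c) G' G''"
      using 6 by (simp_all add: x y z f g category_functor_cat)
    note v = hcomp_trans_vcomp[OF F ab]
    have "hcomp_trans (U a) (U c) G G'' F F''
      (\<lambda>y \<in> Obj (U b). Comp (U c) (FOb G y) (FOb G' y) (FOb G'' y) (\<beta>' y) (\<beta> y))
      (\<lambda>y \<in> Obj (U a). Comp (U b) (FOb F y) (FOb F' y) (FOb F'' y) (\<alpha>' y) (\<alpha> y)) =
      (\<lambda>x \<in> Obj (U a). Comp (U c) (FOb G (FOb F x)) (FOb G' (FOb F' x)) (FOb G'' (FOb F'' x))
      (hcomp_trans (U a) (U c) G' G'' F' F'' \<beta>' \<alpha>' x) (hcomp_trans (U a) (U c) G G' F F' \<beta> \<alpha> x))"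
      by (rule extensionalityI[of _ "Obj (U a)"]) (auto simp: v, auto simp: hcomp_trans_def)
    also have "\<dots> = (\<lambda>x \<in> Obj (U a). Comp (U c) (FOb (fctr_comp (U a) G F) x)
      (FOb (fctr_comp (U a) G' F') x) (FOb (fctr_comp (U a) G'' F'') x)
      (hcomp_trans (U a) (U c) G' G'' F' F'' \<beta>' \<alpha>' x) (hcomp_trans (U a) (U c) G G' F F' \<beta> \<alpha> x))"
      by (intro restrict_ext) simp
    finally show ?case using F S ab hcomp_trans_in[OF F(1,2,4,5) ab(1,3)]
        hcomp_trans_in[OF F(2,3,5,6) ab(2,4)] is_functor_comp[OF F(1,4)] is_functor_comp[OF F(2,5)]
        is_functor_comp[OF F(3,6)] comp_structured[OF assms S(1,4) F(1,4)]
        comp_structured[OF assms S(2,5) F(2,5)] comp_structured[OF assms S(3,6) F(3,6)]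
      by (simp add: x y z f g category_functor_cat)
  qed
qed

lemma two_category: "two_category K"
proof (rule two_category.intro, goal_cases)
  case (9 a b c d \<alpha> f f' \<beta> g g' \<gamma> h h')
  then have F: "is_functor (U a) (U b) f" "is_functor (U a) (U b) f'"
      "is_functor (U b) (U c) g" "is_functor (U b) (U c) g'" "is_functor (U c) (U d) h" "is_functor (U c) (U d) h'"
      and S: "f \<in> S a b" "f' \<in> S a b" "g \<in> S b c" "g' \<in> S b c" "h \<in> S c d" "h' \<in> S c d"
      and ab: "\<alpha> \<in> nat_trans (U a) (U b) f f'"
      "\<beta> \<in> nat_trans (U b) (U c) g g'" "\<gamma> \<in> nat_trans (U c) (U d) h h'"
    by auto
  have x: "a \<in> X" "b \<in> X" "c \<in> X" "d \<in> X" using 9 by auto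
  show ?case using F S ab hcomp_trans_in[OF F(1,2,3,4) ab(1,2)] hcomp_trans_in[OF F(3-6) ab(2,3)]
    is_functor_comp[OF F(1,3)] is_functor_comp[OF F(2,4)]
    is_functor_comp[OF F(3,5)] is_functor_comp[OF F(4,6)]
    comp_structured[OF x(1-3) S(1,3) F(1,3)] comp_structured[OF x(1-3) S(2,4) F(2,4)]
    comp_structured[OF x(2-4) S(3,5) F(3,5)] comp_structured[OF x(2-4) S(4,6) F(4,6)]
    by (simp add: hcomp_trans_assoc[OF F ab])
qed (auto simp: category_functor_cat underlying id_structured is_functor_id comp_functor[simplified]
    fctr_comp_id_right fctr_comp_id_left nat_trans_ident
    hcomp_trans_unit_right hcomp_trans_unit_left comp_structured is_functor_comp fctr_comp_assoc)

end

section \<open>Products of categories on a type of codes for tuples\<close>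

text \<open>The 2-categories at hand consist of categories on one fixed pair of types, so the product of a
  family of them needs tuples of objects and tuples of arrows to be coded in these same types. All
  that matters about a coding is that components can be read off and that a code depends only on
  the components in \<open>I\<close>. Values that are not codes may exist; they are excluded by the condition
  \<open>x = tup (\<lambda>i. prj i x)\<close>.\<close>

locale tupling =
  fixes I :: "'i set"
    and tup :: "('i \<Rightarrow> 'o) \<Rightarrow> 'o" and prj :: "'i \<Rightarrow> 'o \<Rightarrow> 'o"
    and tupm :: "('i \<Rightarrow> 'm) \<Rightarrow> 'm" and prjm :: "'i \<Rightarrow> 'm \<Rightarrow> 'm"
  assumes prj_tup [simp]: "i \<in> I \<Longrightarrow> prj i (tup x) = x i"
    and tup_cong: "(\<And>i. i \<in> I \<Longrightarrow> x i = x' i) \<Longrightarrow> tup x = tup x'"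
    and prjm_tupm [simp]: "i \<in> I \<Longrightarrow> prjm i (tupm f) = f i"
    and tupm_cong: "(\<And>i. i \<in> I \<Longrightarrow> f i = f' i) \<Longrightarrow> tupm f = tupm f'"
begin

definition product :: "('i \<Rightarrow> ('o, 'm) cat) \<Rightarrow> ('o, 'm) cat" where
  "product C = make_cat {x. x = tup (\<lambda>i. prj i x) \<and> (\<forall>i \<in> I. prj i x \<in> Obj (C i))}
     (\<lambda>x y. {f. f = tupm (\<lambda>i. prjm i f) \<and> (\<forall>i \<in> I. prjm i f \<in> Hom (C i) (prj i x) (prj i y))})
     (\<lambda>x. tupm (\<lambda>i. Ident (C i) (prj i x)))
     (\<lambda>x y z g f. tupm (\<lambda>i. Comp (C i) (prj i x) (prj i y) (prj i z) (prjm i g) (prjm i f)))"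

lemma tup_prj_tup [simp]: "tup (\<lambda>i. prj i (tup x)) = tup x" by (rule tup_cong) simp
lemma tupm_prjm_tupm [simp]: "tupm (\<lambda>i. prjm i (tupm f)) = tupm f" by (rule tupm_cong) simp

lemma product_objD:
  assumes "x \<in> Obj (product C)"
  shows "tup (\<lambda>i. prj i x) = x" "i \<in> I \<Longrightarrow> prj i x \<in> Obj (C i)"
  using assms by (auto simp: product_def)

lemma tup_in_obj [simp]: "tup x \<in> Obj (product C) \<longleftrightarrow> (\<forall>i \<in> I. x i \<in> Obj (C i))"
  by (simp add: product_def)

lemma product_obj_eqI:
  assumes "x \<in> Obj (product C)" "y \<in> Obj (product D)" "\<And>i. i \<in> I \<Longrightarrow> prj i x = prj i y"
  shows "x = y"
  using tup_cong[of "\<lambda>i. prj i x" "\<lambda>i. prj i y"] assms product_objD(1) by metis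

lemma product_hom_iff:
  "f \<in> Hom (product C) x y \<longleftrightarrow> x \<in> Obj (product C) \<and> y \<in> Obj (product C) \<and>
     f = tupm (\<lambda>i. prjm i f) \<and> (\<forall>i \<in> I. prjm i f \<in> Hom (C i) (prj i x) (prj i y))"
  by (auto simp: product_def)

lemma product_homD:
  assumes "f \<in> Hom (product C) x y"
  shows "x \<in> Obj (product C)" "y \<in> Obj (product C)"
    "i \<in> I \<Longrightarrow> prjm i f \<in> Hom (C i) (prj i x) (prj i y)"
  using assms by (auto simp: product_hom_iff)

lemma tupm_in_hom:
  assumes "x \<in> Obj (product C)" "y \<in> Obj (product C)"
    "\<And>i. i \<in> I \<Longrightarrow> f i \<in> Hom (C i) (prj i x) (prj i y)"
  shows "tupm f \<in> Hom (product C) x y"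
  using assms by (simp add: product_hom_iff)

lemma product_hom_eqI:
  assumes "f \<in> Hom (product C) x y" "g \<in> Hom (product D) x' y'" "\<And>i. i \<in> I \<Longrightarrow> prjm i f = prjm i g"
  shows "f = g"
  using tupm_cong[of "\<lambda>i. prjm i f" "\<lambda>i. prjm i g"] assms by (simp add: product_hom_iff)

lemma product_ident:
  "x \<in> Obj (product C) \<Longrightarrow> Ident (product C) x = tupm (\<lambda>i. Ident (C i) (prj i x))"
  by (simp add: product_def)

lemma product_comp:
  "\<lbrakk>f \<in> Hom (product C) x y; g \<in> Hom (product C) y z\<rbrakk> \<Longrightarrow> Comp (product C) x y z g f =
    tupm (\<lambda>i. Comp (C i) (prj i x) (prj i y) (prj i z) (prjm i g) (prjm i f))"
  by (auto simp: product_def split: if_splits)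

lemma prjm_ident [simp]:
  "\<lbrakk>i \<in> I; x \<in> Obj (product C)\<rbrakk> \<Longrightarrow> prjm i (Ident (product C) x) = Ident (C i) (prj i x)"
  by (simp add: product_ident)

lemma prjm_comp [simp]:
  "\<lbrakk>i \<in> I; f \<in> Hom (product C) x y; g \<in> Hom (product C) y z\<rbrakk> \<Longrightarrow>
    prjm i (Comp (product C) x y z g f) =
    Comp (C i) (prj i x) (prj i y) (prj i z) (prjm i g) (prjm i f)"
  by (simp add: product_comp)

lemma category_product:
  assumes "\<And>i. i \<in> I \<Longrightarrow> category (C i)"
  shows "category (product C)"
  unfolding product_def
proof (rule category_make_cat, goal_cases)
  case (3 x y f)
  then have "tupm (\<lambda>i. Comp (C i) (prj i x) (prj i x) (prj i y) (prjm i f)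
               (prjm i (tupm (\<lambda>i. Ident (C i) (prj i x))))) = tupm (\<lambda>i. prjm i f)"
    by (intro tupm_cong) (simp add: category.comp_ident_right[OF assms])
  then show ?case using 3 by simp
next
  case (4 x y f)
  then have "tupm (\<lambda>i. Comp (C i) (prj i x) (prj i y) (prj i y)
               (prjm i (tupm (\<lambda>i. Ident (C i) (prj i y)))) (prjm i f)) = tupm (\<lambda>i. prjm i f)"
    by (intro tupm_cong) (simp add: category.comp_ident_left[OF assms])
  then show ?case using 4 by simp
next
  case (5 w x y z f g h)
  then show ?case by (intro tupm_cong) (simp add: category.comp_assoc[OF assms])
qed (auto intro: category.ident_in_hom[OF assms] category.comp_in_hom[OF assms])

definition projection :: "('i \<Rightarrow> ('o, 'm) cat) \<Rightarrow> 'i \<Rightarrow> ('o, 'm, 'o, 'm) fctr" where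
  "projection C i = make_fctr (product C) (prj i) (\<lambda>_ _. prjm i)"

definition pairing :: "('p, 'n) cat \<Rightarrow> ('i \<Rightarrow> ('p, 'n, 'o, 'm) fctr) \<Rightarrow> ('p, 'n, 'o, 'm) fctr" where
  "pairing B F = make_fctr B (\<lambda>x. tup (\<lambda>i. FOb (F i) x)) (\<lambda>x y f. tupm (\<lambda>i. FAr (F i) x y f))"

lemma pairing_simps [simp]:
  "x \<in> Obj B \<Longrightarrow> FOb (pairing B F) x = tup (\<lambda>i. FOb (F i) x)"
  "\<lbrakk>category B; f \<in> Hom B x y\<rbrakk> \<Longrightarrow> FAr (pairing B F) x y f = tupm (\<lambda>i. FAr (F i) x y f)"
  by (simp_all add: pairing_def)

end

locale category_family = tupling I tup prj tupm prjm
  for I :: "'i set" and tup :: "('i \<Rightarrow> 'o) \<Rightarrow> 'o" and prj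
    and tupm :: "('i \<Rightarrow> 'm) \<Rightarrow> 'm" and prjm +
  fixes C :: "'i \<Rightarrow> ('o, 'm) cat"
  assumes C: "i \<in> I \<Longrightarrow> category (C i)"
begin

lemma category_prod: "category (product C)"
  using C by (rule category_product)

lemma projection_simps [simp]:
  "x \<in> Obj (product C) \<Longrightarrow> FOb (projection C i) x = prj i x"
  "f \<in> Hom (product C) x y \<Longrightarrow> FAr (projection C i) x y f = prjm i f"
  by (simp_all add: projection_def category_prod)

lemma is_functor_projection: "i \<in> I \<Longrightarrow> is_functor (product C) (C i) (projection C i)"
  unfolding projection_def
  by (rule is_functor_make_fctr) (auto simp: C category_prod dest: product_objD product_homD)

lemma is_functor_pairing:
  assumes B: "category B" and F: "\<And>i. i \<in> I \<Longrightarrow> is_functor B (C i) (F i)"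
  shows "is_functor B (product C) (pairing B F)"
  unfolding pairing_def
proof (rule is_functor_make_fctr, goal_cases)
  case (3 x) then show ?case by (simp add: is_functor.maps_obj[OF F])
next
  case (4 x y f) then show ?case
    by (intro tupm_in_hom) (simp_all add: is_functor.maps_obj[OF F] is_functor.maps_hom[OF F])
next
  case (5 x) then show ?case
    by (subst product_ident) (auto simp: is_functor.maps_obj[OF F] is_functor.maps_ident[OF F]
      intro!: tupm_cong)
next
  case (6 x y z f g) then show ?case
    by (subst product_comp)
      (auto simp: is_functor.maps_obj[OF F] is_functor.maps_hom[OF F] is_functor.maps_comp[OF F]
      intro!: tupm_cong tupm_in_hom)
qed (use B category_prod in auto)

lemma projection_pairing:
  assumes B: "category B" and F: "\<And>i. i \<in> I \<Longrightarrow> is_functor B (C i) (F i)" and i: "i \<in> I"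
  shows "fctr_comp B (projection C i) (pairing B F) = F i"
proof (rule fctr_eqI)
  note P = is_functor_pairing[OF B F]
  show "is_functor B (C i) (fctr_comp B (projection C i) (pairing B F))"
    by (rule is_functor_comp[OF P is_functor_projection[OF i]])
  fix x y f assume f: "f \<in> Hom B x y"
  show "FAr (fctr_comp B (projection C i) (pairing B F)) x y f = FAr (F i) x y f"
    using f B i is_functor.maps_hom[OF P f] category.hom_obj[OF B f] by simp
qed (use is_functor.maps_obj[OF is_functor_pairing[OF B F]] F i in simp_all)

text \<open>A functor into the product is determined by its composites with the projections, because codes
  are determined by their components.\<close>

lemma pairing_unique:
  assumes H: "is_functor B (product C) H"
    and eq: "\<And>i. i \<in> I \<Longrightarrow> fctr_comp B (projection C i) H = F i"
  shows "H = pairing B F"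
proof -
  have B: "category B" using H by (simp add: is_functor_def)
  have F: "is_functor B (C i) (F i)" if "i \<in> I" for i
    using is_functor_comp[OF H is_functor_projection[OF that]] eq[OF that] by simp
  note P = is_functor_pairing[OF B F]
  show ?thesis
  proof (rule fctr_eqI[OF H P])
    fix x assume x: "x \<in> Obj B"
    show "FOb H x = FOb (pairing B F) x"
    proof (rule product_obj_eqI[OF is_functor.maps_obj[OF H x] is_functor.maps_obj[OF P x]])
      fix i assume i: "i \<in> I"
      show "prj i (FOb H x) = prj i (FOb (pairing B F) x)"
        using i x is_functor.maps_obj[OF H x] fctr_comp_simps(1)[OF x, of "projection C i" H] eq[OF i]
        by simp
    qed
  next
    fix x y f assume f: "f \<in> Hom B x y"
    show "FAr H x y f = FAr (pairing B F) x y f"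
    proof (rule product_hom_eqI[OF is_functor.maps_hom[OF H f] is_functor.maps_hom[OF P f]])
      fix i assume i: "i \<in> I"
      show "prjm i (FAr H x y f) = prjm i (FAr (pairing B F) x y f)"
        using i f B is_functor.maps_hom[OF H f] fctr_comp_simps(2)[OF B f, of "projection C i" H] eq[OF i]
        by simp
    qed
  qed
qed

lemma whisker_projection:
  assumes H: "is_functor B (product C) H" "is_functor B (product C) H'"
    and t: "\<theta> \<in> nat_trans B (product C) H H'" and i: "i \<in> I"
  shows "hcomp_trans B (C i) (projection C i) (projection C i) H H'
      (\<lambda>x \<in> Obj (product C). Ident (C i) (FOb (projection C i) x)) \<theta> = (\<lambda>x \<in> Obj B. prjm i (\<theta> x))"
proof -
  have "Comp (C i) (prj i (FOb H x)) (prj i (FOb H x)) (prj i (FOb H' x)) (prjm i (\<theta> x)) (Ident (C i) (prj i (FOb H x)))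
    = prjm i (\<theta> x)" if x: "x \<in> Obj B" for x
    by (rule category.comp_ident_right[OF C[OF i] product_homD(3)[OF nat_transD(1)[OF t x] i]])
  then show ?thesis
    by (auto simp: hcomp_trans_def is_functor.maps_obj[OF H(1)] is_functor.maps_obj[OF H(2)]
       nat_transD(1)[OF t] intro!: restrict_ext)
qed

lemma nat_trans_pairing:
  assumes H: "is_functor B (product C) H" "is_functor B (product C) H'"
    and p: "\<And>i. i \<in> I \<Longrightarrow>
      \<phi> i \<in> nat_trans B (C i) (fctr_comp B (projection C i) H) (fctr_comp B (projection C i) H')"
  shows "(\<lambda>x \<in> Obj B. tupm (\<lambda>i. \<phi> i x)) \<in> nat_trans B (product C) H H'" (is "?\<theta> \<in> _")
proof -
  have B: "category B" using H by (simp add: is_functor_def)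
  note o = is_functor.maps_obj[OF H(1)] is_functor.maps_obj[OF H(2)]
  have t: "?\<theta> x \<in> Hom (product C) (FOb H x) (FOb H' x)" if x: "x \<in> Obj B" for x
    using x o[OF x] nat_transD(1)[OF p x] by (auto intro!: tupm_in_hom)
  show ?thesis
  proof (rule nat_transI)
    fix x y f assume x: "x \<in> Obj B" and y: "y \<in> Obj B" and f: "f \<in> Hom B x y"
    note Hf = is_functor.maps_hom[OF H(1) f] and H'f = is_functor.maps_hom[OF H(2) f]
    note PC = category_prod
    show "Comp (product C) (FOb H x) (FOb H y) (FOb H' y) (?\<theta> y) (FAr H x y f) =
      Comp (product C) (FOb H x) (FOb H' x) (FOb H' y) (FAr H' x y f) (?\<theta> x)"
    proof (rule product_hom_eqI[OF category.comp_in_hom[OF PC Hf t[OF y]] category.comp_in_hom[OF PC t[OF x] H'f]])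
      fix i assume i: "i \<in> I"
      show "prjm i (Comp (product C) (FOb H x) (FOb H y) (FOb H' y) (?\<theta> y) (FAr H x y f)) =
        prjm i (Comp (product C) (FOb H x) (FOb H' x) (FOb H' y) (FAr H' x y f) (?\<theta> x))"
        using prjm_comp[OF i Hf t[OF y]] prjm_comp[OF i t[OF x] H'f] x y f i o[OF x] o[OF y] Hf H'f
          nat_transD(2)[OF p[OF i] x y f] B by simp
    qed
  qed (use t in simp_all)
qed

end

context tupling
begin

text \<open>The product category is the strict 2-product of the underlying categories: functors and natural
  transformations into it are families of functors and of natural transformations. It is also the
  2-product of structured categories if the projections are structured and structured functors
  have a structured pairing; 2-cells carry no structure.\<close>

lemma structured_2product:
  assumes "structured X U S" and A: "\<And>i. i \<in> I \<Longrightarrow> A i \<in> X" and p: "p \<in> X"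
    and Up: "U p = product (\<lambda>i. U (A i))"
    and P: "\<And>i. i \<in> I \<Longrightarrow> projection (\<lambda>i. U (A i)) i \<in> S p (A i)"
    and pair: "\<And>x F. \<lbrakk>x \<in> X; \<And>i. i \<in> I \<Longrightarrow> F i \<in> S x (A i);
      \<And>i. i \<in> I \<Longrightarrow> is_functor (U x) (U (A i)) (F i)\<rbrakk> \<Longrightarrow> pairing (U x) F \<in> S x p"
  shows "is_2product (structured_2cat X U S) I A p (projection (\<lambda>i. U (A i)))"
proof -
  interpret structured X U S by fact
  let ?C = "\<lambda>i. U (A i)"
  interpret P: category_family I tup prj tupm prjm ?C
    using tupling_axioms underlying A by (simp add: category_family_def category_family_axioms_def)
  have PF: "is_functor (product ?C) (?C i) (projection ?C i)" if "i \<in> I" for i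
    using that by (rule P.is_functor_projection)
  show ?thesis unfolding is_2product_def structured_2cat_simps
  proof (intro conjI ballI allI impI)
    show "p \<in> X" by fact
    fix i assume "i \<in> I" then show "projection ?C i \<in> Obj (functor_cat (U p) (U (A i)) (S p (A i)))"
      using P PF Up by simp
  next
    fix x F assume x: "x \<in> X" and "\<forall>i \<in> I. F i \<in> Obj (functor_cat (U x) (?C i) (S x (A i)))"
    then have F: "\<And>i. i \<in> I \<Longrightarrow> F i \<in> S x (A i)"
      and FF: "\<And>i. i \<in> I \<Longrightarrow> is_functor (U x) (?C i) (F i)" by auto
    note B = underlying[OF x]
    have pair: "pairing (U x) F \<in> S x p" using x F FF by (rule pair)
    have pairF: "is_functor (U x) (product ?C) (pairing (U x) F)"
      using B FF by (rule P.is_functor_pairing)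
    show "\<exists>!h. h \<in> Obj (functor_cat (U x) (U p) (S x p)) \<and>
      (\<forall>i\<in>I. comp1 K x p (A i) (projection ?C i) h = F i)"
    proof (rule ex1I, intro conjI ballI)
      show "pairing (U x) F \<in> Obj (functor_cat (U x) (U p) (S x p))" using pair pairF Up by simp
      fix i assume i: "i \<in> I"
      show "comp1 K x p (A i) (projection ?C i) (pairing (U x) F) = F i"
        using pair pairF Up P[OF i] PF[OF i] P.projection_pairing[OF B FF i] by simp
    next
      fix h assume h: "h \<in> Obj (functor_cat (U x) (U p) (S x p)) \<and>
        (\<forall>i\<in>I. comp1 K x p (A i) (projection ?C i) h = F i)"
      show "h = pairing (U x) F"
      proof (rule P.pairing_unique)
        fix i assume i: "i \<in> I"
        then show "fctr_comp (U x) (projection ?C i) h = F i"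
          using h P[OF i] PF[OF i] Up by auto
      qed (use h Up in auto)
    qed
  next
    fix x h h' \<phi>
    assume x: "x \<in> X" and "h \<in> Obj (functor_cat (U x) (U p) (S x p))"
      "h' \<in> Obj (functor_cat (U x) (U p) (S x p))"
      and phi: "\<forall>i\<in>I. \<phi> i \<in> Hom (functor_cat (U x) (?C i) (S x (A i)))
         (comp1 K x p (A i) (projection ?C i) h) (comp1 K x p (A i) (projection ?C i) h')"
    then have h: "h \<in> S x p" "is_functor (U x) (product ?C) h" "h' \<in> S x p" "is_functor (U x) (product ?C) h'"
      using Up by auto
    let ?\<theta> = "\<lambda>y \<in> Obj (U x). tupm (\<lambda>i. \<phi> i y)"
    have phi: "\<phi> i \<in> nat_trans (U x) (?C i) (fctr_comp (U x) (projection ?C i) h)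
        (fctr_comp (U x) (projection ?C i) h')" if i: "i \<in> I" for i
      using bspec[OF phi i] h Up P[OF i] PF[OF i] by simp
    have t: "?\<theta> \<in> nat_trans (U x) (product ?C) h h'"
      using h(2,4) phi by (rule P.nat_trans_pairing)
    have whisker: "hcomp K x p (A i) (projection ?C i) (projection ?C i) h h'
       (Ident (functor_cat (U p) (?C i) (S p (A i))) (projection ?C i)) \<theta> = (\<lambda>y \<in> Obj (U x). prjm i (\<theta> y))"
      if i: "i \<in> I" and t: "\<theta> \<in> nat_trans (U x) (product ?C) h h'" for i \<theta>
      using h Up P[OF i] PF[OF i] t i nat_trans_ident[OF PF[OF i]] P.whisker_projection[OF h(2,4) t i]
      by simp
    show "\<exists>!\<theta>. \<theta> \<in> Hom (functor_cat (U x) (U p) (S x p)) h h' \<and>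
      (\<forall>i\<in>I. hcomp K x p (A i) (projection ?C i) (projection ?C i) h h'
         (Ident (functor_cat (U p) (?C i) (S p (A i))) (projection ?C i)) \<theta> = \<phi> i)"
    proof (rule ex1I, intro conjI ballI)
      show "?\<theta> \<in> Hom (functor_cat (U x) (U p) (S x p)) h h'" using t h Up by simp
      fix i assume i: "i \<in> I"
      show "hcomp K x p (A i) (projection ?C i) (projection ?C i) h h'
         (Ident (functor_cat (U p) (?C i) (S p (A i))) (projection ?C i)) ?\<theta> = \<phi> i"
        unfolding whisker[OF i t]
        by (rule extensionalityI[of _ "Obj (U x)"]) (use nat_transD(3)[OF phi[OF i]] i in auto)
    next
      fix \<theta> assume th: "\<theta> \<in> Hom (functor_cat (U x) (U p) (S x p)) h h' \<and>
      (\<forall>i\<in>I. hcomp K x p (A i) (projection ?C i) (projection ?C i) h h'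
         (Ident (functor_cat (U p) (?C i) (S p (A i))) (projection ?C i)) \<theta> = \<phi> i)"
      then have th': "\<theta> \<in> nat_trans (U x) (product ?C) h h'" using Up by simp
      show "\<theta> = ?\<theta>"
      proof (rule nat_trans_eqI[OF th' t])
        fix y assume y: "y \<in> Obj (U x)"
        show "\<theta> y = ?\<theta> y"
        proof (rule product_hom_eqI[OF nat_transD(1)[OF th' y] nat_transD(1)[OF t y]])
          fix i assume i: "i \<in> I"
          have "(\<lambda>y \<in> Obj (U x). prjm i (\<theta> y)) = \<phi> i" using th whisker[OF i th'] i by auto
          from fun_cong[OF this, of y] show "prjm i (\<theta> y) = prjm i (?\<theta> y)" using y i by simp
        qed
      qed
    qed
  qed
qed

end

text \<open>An infinite type is in bijection with its square, so tuples can be coded by adding one index at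
  a time.\<close>

lemma tuple_coding:
  assumes "finite I" "infinite (UNIV :: 'a set)"
  shows "\<exists>(tup :: ('i \<Rightarrow> 'a) \<Rightarrow> 'a) prj. (\<forall>i \<in> I. \<forall>x. prj i (tup x) = x i) \<and>
     (\<forall>x x'. (\<forall>i \<in> I. x i = x' i) \<longrightarrow> tup x = tup x')"
  using assms(1)
proof induction
  case empty
  show ?case by (rule exI[of _ "\<lambda>_. undefined"]) simp
next
  case (insert j I)
  then obtain tup :: "('i \<Rightarrow> 'a) \<Rightarrow> 'a" and prj where
    t: "\<And>i x. i \<in> I \<Longrightarrow> prj i (tup x) = x i" "\<And>x x'. (\<forall>i \<in> I. x i = x' i) \<Longrightarrow> tup x = tup x'" by blast
  have "(card_of (UNIV \<times> UNIV :: ('a \<times> 'a) set), card_of (UNIV :: 'a set)) \<in> ordLeq"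
    using card_of_Times_same_infinite[OF assms(2)] ordIso_iff_ordLeq by blast
  then obtain c :: "'a \<times> 'a \<Rightarrow> 'a" where c: "inj c"
    unfolding card_of_ordLeq[symmetric] by auto
  let ?tup = "\<lambda>x. c (x j, tup x)"
  let ?prj = "\<lambda>i a. if i = j then fst (inv c a) else prj i (snd (inv c a))"
  have "\<forall>i \<in> insert j I. \<forall>x. ?prj i (?tup x) = x i" using t(1) by (auto simp: inv_f_f[OF c])
  moreover have "\<forall>x x'. (\<forall>i \<in> insert j I. x i = x' i) \<longrightarrow> ?tup x = ?tup x'" using t(2) by (metis insert_iff)
  ultimately show ?case by (intro exI[of _ ?tup] exI[of _ ?prj] conjI)
qed

lemma tupling_exists:
  assumes "finite I" "infinite (UNIV :: 'o set)" "infinite (UNIV :: 'm set)"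
  obtains tup :: "('i \<Rightarrow> 'o) \<Rightarrow> 'o" and prj and tupm :: "('i \<Rightarrow> 'm) \<Rightarrow> 'm" and prjm
  where "tupling I tup prj tupm prjm"
proof -
  obtain tup :: "('i \<Rightarrow> 'o) \<Rightarrow> 'o" and prj where
    1: "\<forall>i \<in> I. \<forall>x. prj i (tup x) = x i" "\<forall>x x'. (\<forall>i \<in> I. x i = x' i) \<longrightarrow> tup x = tup x'"
    using tuple_coding[OF assms(1,2)] by blast
  obtain tupm :: "('i \<Rightarrow> 'm) \<Rightarrow> 'm" and prjm where
    2: "\<forall>i \<in> I. \<forall>x. prjm i (tupm x) = x i" "\<forall>x x'. (\<forall>i \<in> I. x i = x' i) \<longrightarrow> tupm x = tupm x'"
    using tuple_coding[OF assms(1,3)] by blast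
  have "tupling I tup prj tupm prjm" by unfold_locales (use 1 2 in \<open>simp_all\<close>)
  then show thesis by (rule that)
qed

section \<open>2-products and 2-functors\<close>

text \<open>Whiskering \<open>\<alpha>\<close> with the 1-cell \<open>g\<close>. Bijectivity on 2-cells in the definition of 2-products is a
  condition on whiskering with the projections.\<close>

definition whisker ::
  "('a, 'b, 'c) tcat \<Rightarrow> 'a \<Rightarrow> 'a \<Rightarrow> 'a \<Rightarrow> 'b \<Rightarrow> 'b \<Rightarrow> 'b \<Rightarrow> 'c \<Rightarrow> 'c" where
  "whisker K a b c g f f' \<alpha> = hcomp K a b c g g f f' (id2 K b c g) \<alpha>"

lemma is_2product_ob:
  assumes "is_2product K I A p pr"
  shows "p \<in> Ob K" "i \<in> I \<Longrightarrow> pr i \<in> Obj (HomCat K p (A i))"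
  using assms by (simp_all add: is_2product_def)

lemma is_2product_cell:
  assumes "is_2product K I A p pr" "x \<in> Ob K" "h \<in> Obj (HomCat K x p)" "h' \<in> Obj (HomCat K x p)"
    and "\<forall>i \<in> I. \<phi> i \<in> Hom (HomCat K x (A i)) (comp1 K x p (A i) (pr i) h) (comp1 K x p (A i) (pr i) h')"
  shows "\<exists>!\<theta>. \<theta> \<in> Hom (HomCat K x p) h h' \<and> (\<forall>i \<in> I. whisker K x p (A i) (pr i) h h' \<theta> = \<phi> i)"
proof -
  have "\<forall>\<phi>. (\<forall>i \<in> I. \<phi> i \<in> Hom (HomCat K x (A i)) (comp1 K x p (A i) (pr i) h) (comp1 K x p (A i) (pr i) h'))
    \<longrightarrow> (\<exists>!\<theta>. \<theta> \<in> Hom (HomCat K x p) h h' \<and> (\<forall>i \<in> I. whisker K x p (A i) (pr i) h h' \<theta> = \<phi> i))"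
    using assms(1-4) unfolding is_2product_def whisker_def by simp
  from mp[OF spec[OF this] assms(5)] show ?thesis .
qed

text \<open>Only the values of \<open>A\<close> and \<open>pr\<close> on the index set matter, so they may be exchanged there.\<close>

lemma is_2product_restrict:
  "is_2product K I (restrict A I) p (restrict pr I) \<longleftrightarrow> is_2product K I A p pr"
  by (simp add: is_2product_def)

lemma is_2product_cong:
  assumes "is_2product K I B p pr'" "\<And>i. i \<in> I \<Longrightarrow> A i = B i" "\<And>i. i \<in> I \<Longrightarrow> pr i = pr' i"
  shows "is_2product K I A p pr"
proof -
  have "restrict A I = restrict B I" "restrict pr I = restrict pr' I"
    using assms(2,3) by (auto intro: restrict_ext)
  then show ?thesis using assms(1) by (metis is_2product_restrict)
qed

context two_category
begin

lemma comp1_in: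
  assumes "a \<in> Ob K" "b \<in> Ob K" "c \<in> Ob K" "f \<in> Obj (HomCat K a b)" "g \<in> Obj (HomCat K b c)"
  shows "comp1 K a b c g f \<in> Obj (HomCat K a c)"
  using is_functor.maps_obj[OF comp_functor[OF assms(1-3)], of "(g, f)"] assms by simp

lemma hcomp_in:
  assumes "a \<in> Ob K" "b \<in> Ob K" "c \<in> Ob K"
    "\<alpha> \<in> Hom (HomCat K a b) f f'" "\<beta> \<in> Hom (HomCat K b c) g g'"
  shows "hcomp K a b c g g' f f' \<beta> \<alpha> \<in> Hom (HomCat K a c) (comp1 K a b c g f) (comp1 K a b c g' f')"
  using is_functor.maps_hom[OF comp_functor[OF assms(1-3)], of "(\<beta>, \<alpha>)" "(g, f)" "(g', f')"]
    assms homcat by simp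

lemma hcomp_id2:
  assumes "a \<in> Ob K" "b \<in> Ob K" "c \<in> Ob K" "f \<in> Obj (HomCat K a b)" "g \<in> Obj (HomCat K b c)"
  shows "hcomp K a b c g g f f (id2 K b c g) (id2 K a b f) = id2 K a c (comp1 K a b c g f)"
  using is_functor.maps_ident[OF comp_functor[OF assms(1-3)], of "(g, f)"] assms by simp

lemma id2_in: "\<lbrakk>a \<in> Ob K; b \<in> Ob K; f \<in> Obj (HomCat K a b)\<rbrakk> \<Longrightarrow> id2 K a b f \<in> Hom (HomCat K a b) f f"
  using homcat by (simp add: category.ident_in_hom)

lemma whisker_in:
  assumes "a \<in> Ob K" "b \<in> Ob K" "c \<in> Ob K" "\<alpha> \<in> Hom (HomCat K a b) f f'" "g \<in> Obj (HomCat K b c)"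
  shows "whisker K a b c g f f' \<alpha> \<in> Hom (HomCat K a c) (comp1 K a b c g f) (comp1 K a b c g f')"
  unfolding whisker_def using assms by (intro hcomp_in id2_in)

lemma whisker_comp1:
  assumes "a \<in> Ob K" "b \<in> Ob K" "c \<in> Ob K" "d \<in> Ob K" "\<alpha> \<in> Hom (HomCat K a b) f f'"
    "g \<in> Obj (HomCat K b c)" "h \<in> Obj (HomCat K c d)"
  shows "whisker K a b d (comp1 K b c d h g) f f' \<alpha> =
    whisker K a c d h (comp1 K a b c g f) (comp1 K a b c g f') (whisker K a b c g f f' \<alpha>)"
  unfolding whisker_def using assms
  by (simp add: hcomp_id2[symmetric] assoc_2[OF assms(1-5) id2_in id2_in])

lemma whisker_Id1:
  "\<lbrakk>a \<in> Ob K; b \<in> Ob K; \<alpha> \<in> Hom (HomCat K a b) f f'\<rbrakk> \<Longrightarrow> whisker K a b b (Id1 K b) f f' \<alpha> = \<alpha>"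
  unfolding whisker_def by (rule unit_left_2)

text \<open>A comparison 1-cell or 2-cell into \<open>p\<close> is obtained from the one into \<open>q\<close> by composing or
  whiskering with the inverse \<open>k\<close> of \<open>h\<close>.\<close>

lemma is_2product_iso:
  assumes q: "is_2product K I A q qr" and A: "\<And>i. i \<in> I \<Longrightarrow> A i \<in> Ob K" and p: "p \<in> Ob K"
    and h: "h \<in> Obj (HomCat K p q)" and k: "k \<in> Obj (HomCat K q p)"
    and kh: "comp1 K p q p k h = Id1 K p" and hk: "comp1 K q p q h k = Id1 K q"
  shows "is_2product K I A p (\<lambda>i. comp1 K p q (A i) (qr i) h)"
proof -
  have q_ob: "q \<in> Ob K" and qr: "\<And>i. i \<in> I \<Longrightarrow> qr i \<in> Obj (HomCat K q (A i))"
    using q by (auto simp: is_2product_def)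
  let ?pr = "\<lambda>i. comp1 K p q (A i) (qr i) h"
  let ?p = "\<lambda>x i v. comp1 K x p (A i) (?pr i) v" and ?q = "\<lambda>x i u. comp1 K x q (A i) (qr i) u"
    and ?h = "\<lambda>x v. comp1 K x p q h v" and ?k = "\<lambda>x u. comp1 K x q p k u"
  have pr: "?pr i \<in> Obj (HomCat K p (A i))" if "i \<in> I" for i
    using p q_ob A[OF that] h qr[OF that] by (rule comp1_in)
  have pr_u: "?p x i u = ?q x i (?h x u)"
    if "i \<in> I" "x \<in> Ob K" "u \<in> Obj (HomCat K x p)" for i x u
    using that A qr p q_ob h by (simp add: assoc_1)
  have khu: "?k x (?h x u) = u" if "x \<in> Ob K" "u \<in> Obj (HomCat K x p)" for x u
    using assoc_1[OF that(1) p q_ob p that(2) h k] kh unit_left_1[OF that(1) p that(2)] by simp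
  have hku: "?h x (?k x u) = u" if "x \<in> Ob K" "u \<in> Obj (HomCat K x q)" for x u
    using assoc_1[OF that(1) q_ob p q_ob that(2) k h] hk unit_left_1[OF that(1) q_ob that(2)] by simp
  show ?thesis unfolding is_2product_def
  proof (intro conjI ballI allI impI)
    fix x f assume x: "x \<in> Ob K" and f: "\<forall>i \<in> I. f i \<in> Obj (HomCat K x (A i))"
    then have ex: "\<exists>!u. u \<in> Obj (HomCat K x q) \<and> (\<forall>i \<in> I. ?q x i u = f i)"
      using q by (simp add: is_2product_def)
    then obtain u where u: "u \<in> Obj (HomCat K x q)" "\<forall>i \<in> I. ?q x i u = f i" by blast
    show "\<exists>!v. v \<in> Obj (HomCat K x p) \<and> (\<forall>i \<in> I. ?p x i v = f i)"
    proof (rule ex1I, intro conjI ballI)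
      show ku: "?k x u \<in> Obj (HomCat K x p)" using x q_ob p u(1) k by (rule comp1_in)
      fix i assume i: "i \<in> I"
      show "?p x i (?k x u) = f i"
        using pr_u[OF i x ku] hku[OF x u(1)] u(2) i by simp
    next
      fix v assume v: "v \<in> Obj (HomCat K x p) \<and> (\<forall>i \<in> I. ?p x i v = f i)"
      then have "?h x v \<in> Obj (HomCat K x q)" using x p q_ob h by (simp add: comp1_in)
      moreover have "\<forall>i \<in> I. ?q x i (?h x v) = f i"
        using pr_u[OF _ x, symmetric] v by simp
      ultimately have "?h x v = u" using ex u by blast
      then show "v = ?k x u" using khu x v by force
    qed
  next
    fix x u u' \<phi>
    assume x: "x \<in> Ob K" and u: "u \<in> Obj (HomCat K x p)" and u': "u' \<in> Obj (HomCat K x p)"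
      and phi: "\<forall>i \<in> I. \<phi> i \<in> Hom (HomCat K x (A i)) (?p x i u) (?p x i u')"
    let ?u = "?h x u" and ?u' = "?h x u'"
    have hu: "?u \<in> Obj (HomCat K x q)" "?u' \<in> Obj (HomCat K x q)"
      using x p q_ob h u u' by (simp_all add: comp1_in)
    have "\<forall>i \<in> I. \<phi> i \<in> Hom (HomCat K x (A i)) (?q x i ?u) (?q x i ?u')"
      using phi pr_u x u u' by simp
    then have ex: "\<exists>!\<theta>. \<theta> \<in> Hom (HomCat K x q) ?u ?u' \<and>
        (\<forall>i \<in> I. whisker K x q (A i) (qr i) ?u ?u' \<theta> = \<phi> i)"
      by (rule is_2product_cell[OF q x hu])
    then obtain \<theta> where t: "\<theta> \<in> Hom (HomCat K x q) ?u ?u'"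
      "\<forall>i \<in> I. whisker K x q (A i) (qr i) ?u ?u' \<theta> = \<phi> i" by blast
    have "\<exists>!\<theta>. \<theta> \<in> Hom (HomCat K x p) u u' \<and> (\<forall>i \<in> I. whisker K x p (A i) (?pr i) u u' \<theta> = \<phi> i)"
    proof (rule ex1I, intro conjI ballI)
      show kt: "whisker K x q p k ?u ?u' \<theta> \<in> Hom (HomCat K x p) u u'"
        using whisker_in[OF x q_ob p t(1) k] khu x u u' by simp
      fix i assume i: "i \<in> I"
      have "whisker K x p q h u u' (whisker K x q p k ?u ?u' \<theta>) = whisker K x q q (Id1 K q) ?u ?u' \<theta>"
        using whisker_comp1[OF x q_ob p q_ob t(1) k h] hk khu x u u' by simp
      also have "\<dots> = \<theta>" by (rule whisker_Id1[OF x q_ob t(1)])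
      finally show "whisker K x p (A i) (?pr i) u u' (whisker K x q p k ?u ?u' \<theta>) = \<phi> i"
        using whisker_comp1[OF x p q_ob A[OF i] kt h qr[OF i]] t(2) i by simp
    next
      fix \<psi> assume psi: "\<psi> \<in> Hom (HomCat K x p) u u' \<and> (\<forall>i \<in> I. whisker K x p (A i) (?pr i) u u' \<psi> = \<phi> i)"
      then have psi': "\<psi> \<in> Hom (HomCat K x p) u u'" by simp
      have "whisker K x p q h u u' \<psi> \<in> Hom (HomCat K x q) ?u ?u'"
        by (rule whisker_in[OF x p q_ob psi' h])
      moreover have "\<forall>i \<in> I. whisker K x q (A i) (qr i) ?u ?u' (whisker K x p q h u u' \<psi>) = \<phi> i"
        using whisker_comp1[OF x p q_ob A psi' h qr] psi by simp
      ultimately have "whisker K x p q h u u' \<psi> = \<theta>" using ex t by blast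
      then show "\<psi> = whisker K x q p k ?u ?u' \<theta>"
        using whisker_comp1[OF x p q_ob p psi' h k] kh whisker_Id1[OF x p psi'] by simp
    qed
    then show "\<exists>!\<theta>. \<theta> \<in> Hom (HomCat K x p) u u' \<and>
      (\<forall>i\<in>I. hcomp K x p (A i) (?pr i) (?pr i) u u' (id2 K p (A i) (?pr i)) \<theta> = \<phi> i)"
      unfolding whisker_def .
  qed (use p pr in auto)
qed

lemma is_2product_endo:
  assumes q: "is_2product K I A q qr" and A: "\<And>i. i \<in> I \<Longrightarrow> A i \<in> Ob K"
    and e: "e \<in> Obj (HomCat K q q)" "\<And>i. i \<in> I \<Longrightarrow> comp1 K q q (A i) (qr i) e = qr i"
  shows "e = Id1 K q"
proof -
  have q_ob: "q \<in> Ob K" and qr: "\<And>i. i \<in> I \<Longrightarrow> qr i \<in> Obj (HomCat K q (A i))"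
    using q by (auto simp: is_2product_def)
  have "\<exists>!u. u \<in> Obj (HomCat K q q) \<and> (\<forall>i \<in> I. comp1 K q q (A i) (qr i) u = qr i)"
    using q qr q_ob by (simp add: is_2product_def)
  moreover have "comp1 K q q (A i) (qr i) (Id1 K q) = qr i" if "i \<in> I" for i
    using that A qr q_ob by (simp add: unit_right_1)
  ultimately show ?thesis using e id1[OF q_ob] by blast
qed

text \<open>The comparison 1-cells between two 2-products are mutually inverse, since both composites are
  endo-1-cells compatible with projections.\<close>

lemma is_2product_unique:
  assumes p: "is_2product K I A p pr" and q: "is_2product K I A q qr" and A: "\<And>i. i \<in> I \<Longrightarrow> A i \<in> Ob K"
  obtains h k where "h \<in> Obj (HomCat K p q)" "k \<in> Obj (HomCat K q p)"
    "comp1 K p q p k h = Id1 K p" "comp1 K q p q h k = Id1 K q"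
    "\<And>i. i \<in> I \<Longrightarrow> pr i = comp1 K p q (A i) (qr i) h"
proof -
  have ob: "q \<in> Ob K" "p \<in> Ob K" and qr: "\<And>i. i \<in> I \<Longrightarrow> qr i \<in> Obj (HomCat K q (A i))"
    and pr: "\<And>i. i \<in> I \<Longrightarrow> pr i \<in> Obj (HomCat K p (A i))"
    using p q by (auto simp: is_2product_def)
  have "\<exists>!u. u \<in> Obj (HomCat K p q) \<and> (\<forall>i \<in> I. comp1 K p q (A i) (qr i) u = pr i)"
    using q pr ob by (simp add: is_2product_def)
  then obtain h where h: "h \<in> Obj (HomCat K p q)" "\<And>i. i \<in> I \<Longrightarrow> comp1 K p q (A i) (qr i) h = pr i" by blast
  have "\<exists>!u. u \<in> Obj (HomCat K q p) \<and> (\<forall>i \<in> I. comp1 K q p (A i) (pr i) u = qr i)"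
    using p qr ob by (simp add: is_2product_def)
  then obtain k where k: "k \<in> Obj (HomCat K q p)" "\<And>i. i \<in> I \<Longrightarrow> comp1 K q p (A i) (pr i) k = qr i" by blast
  have kh: "comp1 K p q p k h = Id1 K p"
    by (rule is_2product_endo[OF p A])
      (use ob h k A pr assoc_1[OF ob(2,1,2) _ h(1) k(1), symmetric] in \<open>auto simp: comp1_in\<close>)
  have hk: "comp1 K q p q h k = Id1 K q"
    by (rule is_2product_endo[OF q A])
      (use ob h k A qr assoc_1[OF ob(1,2,1) _ k(1) h(1), symmetric] in \<open>auto simp: comp1_in\<close>)
  show thesis using that[OF h(1) k(1) kh hk] h(2) by simp
qed

end

context two_functor
begin

lemma maps_obj1: "\<lbrakk>a \<in> Ob K; b \<in> Ob K; f \<in> Obj (HomCat K a b)\<rbrakk> \<Longrightarrow>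
    FOb (T1 T a b) f \<in> Obj (HomCat L (T0 T a) (T0 T b))"
  using hom_functor by (rule is_functor.maps_obj)

lemma maps_hom2: "\<lbrakk>a \<in> Ob K; b \<in> Ob K; \<alpha> \<in> Hom (HomCat K a b) f f'\<rbrakk> \<Longrightarrow>
    FAr (T1 T a b) f f' \<alpha> \<in> Hom (HomCat L (T0 T a) (T0 T b)) (FOb (T1 T a b) f) (FOb (T1 T a b) f')"
  using hom_functor by (rule is_functor.maps_hom)

lemma maps_whisker:
  assumes "a \<in> Ob K" "b \<in> Ob K" "c \<in> Ob K" "\<alpha> \<in> Hom (HomCat K a b) f f'" "g \<in> Obj (HomCat K b c)"
  shows "FAr (T1 T a c) (comp1 K a b c g f) (comp1 K a b c g f') (whisker K a b c g f f' \<alpha>) =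
    whisker L (T0 T a) (T0 T b) (T0 T c) (FOb (T1 T b c) g) (FOb (T1 T a b) f) (FOb (T1 T a b) f')
      (FAr (T1 T a b) f f' \<alpha>)"
  unfolding whisker_def
  using maps_hcomp[OF assms(1-4) dom.id2_in[OF assms(2,3,5)]]
    is_functor.maps_ident[OF hom_functor[OF assms(2,3)] assms(5)] by simp

text \<open>If one 2-product of a family is preserved, all are: any other one is isomorphic to it, compatibly
  with the projections, and a 2-functor sends this isomorphism to an isomorphism.\<close>

lemma preserves_2product:
  assumes A: "\<And>i. i \<in> I \<Longrightarrow> A i \<in> Ob K" and q: "is_2product K I A q qr"
    and Tq: "is_2product L I (\<lambda>i. T0 T (A i)) (T0 T q) (\<lambda>i. FOb (T1 T q (A i)) (qr i))"
    and p: "is_2product K I A p pr"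
  shows "is_2product L I (\<lambda>i. T0 T (A i)) (T0 T p) (\<lambda>i. FOb (T1 T p (A i)) (pr i))"
proof -
  have ob: "q \<in> Ob K" "p \<in> Ob K" and qr: "\<And>i. i \<in> I \<Longrightarrow> qr i \<in> Obj (HomCat K q (A i))"
    using p q by (auto simp: is_2product_def)
  obtain h k where h: "h \<in> Obj (HomCat K p q)" and k: "k \<in> Obj (HomCat K q p)"
    and kh: "comp1 K p q p k h = Id1 K p" and hk: "comp1 K q p q h k = Id1 K q"
    and pr: "\<And>i. i \<in> I \<Longrightarrow> pr i = comp1 K p q (A i) (qr i) h"
    using dom.is_2product_unique[OF p q A] by blast
  have T_h: "is_2product L I (\<lambda>i. T0 T (A i)) (T0 T p)
    (\<lambda>i. comp1 L (T0 T p) (T0 T q) (T0 T (A i)) (FOb (T1 T q (A i)) (qr i)) (FOb (T1 T p q) h))"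
  proof (rule cod.is_2product_iso[OF Tq])
    show "comp1 L (T0 T p) (T0 T q) (T0 T p) (FOb (T1 T q p) k) (FOb (T1 T p q) h) = Id1 L (T0 T p)"
      using maps_comp1[OF ob(2,1,2) h k] maps_id1[OF ob(2)] kh by simp
    show "comp1 L (T0 T q) (T0 T p) (T0 T q) (FOb (T1 T p q) h) (FOb (T1 T q p) k) = Id1 L (T0 T q)"
      using maps_comp1[OF ob(1,2,1) k h] maps_id1[OF ob(1)] hk by simp
  qed (use A ob h k maps_ob maps_obj1 in auto)
  have "FOb (T1 T p (A i)) (pr i) =
    comp1 L (T0 T p) (T0 T q) (T0 T (A i)) (FOb (T1 T q (A i)) (qr i)) (FOb (T1 T p q) h)" if "i \<in> I" for i
    using maps_comp1[OF ob(2,1) A[OF that] h qr[OF that]] pr[OF that] by simp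
  then show ?thesis by (rule is_2product_cong[OF T_h refl])
qed

end

lemma cartesian_2category_product:
  assumes "cartesian_2category K" "finite (I :: nat set)" "\<And>i. i \<in> I \<Longrightarrow> A i \<in> Ob K"
  shows "\<exists>p pr. is_2product K I A p pr"
  using assms unfolding cartesian_2category_def by simp

text \<open>It suffices to choose one 2-product for each finite family and to see that it is preserved.\<close>

lemma cartesian_2functorI:
  assumes "two_functor K L T" "cartesian_2category L"
    and ex: "\<And>(I :: nat set) A. \<lbrakk>finite I; \<And>i. i \<in> I \<Longrightarrow> A i \<in> Ob K\<rbrakk> \<Longrightarrow> \<exists>p pr. is_2product K I A p pr \<and>
      is_2product L I (\<lambda>i. T0 T (A i)) (T0 T p) (\<lambda>i. FOb (T1 T p (A i)) (pr i))"
  shows "cartesian_2functor K L T"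
proof -
  interpret two_functor K L T by fact
  show ?thesis unfolding cartesian_2functor_def
  proof (intro conjI allI impI)
    show "cartesian_2category K" unfolding cartesian_2category_def
      using ex dom.two_category_axioms by blast
    fix I :: "nat set" and A p pr
    assume a: "finite I \<and> (\<forall>i \<in> I. A i \<in> Ob K) \<and> is_2product K I A p pr"
    then obtain q qr where "is_2product K I A q qr"
      "is_2product L I (\<lambda>i. T0 T (A i)) (T0 T q) (\<lambda>i. FOb (T1 T q (A i)) (qr i))"
      using ex[of I A] by blast
    then show "is_2product L I (\<lambda>i. T0 T (A i)) (T0 T p) (\<lambda>i. FOb (T1 T p (A i)) (pr i))"
      using a preserves_2product[of I A] by blast
  qed (use assms in auto)
qed

text \<open>The relation \<open>lifts_along K U T V\<close> says that \<open>V\<close> is the composite of \<open>T\<close> and \<open>U\<close>. So this lemma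
  and the next one state that 2-functors and cartesian 2-functors compose.\<close>

lemma two_functor_lifts_along:
  assumes T: "two_functor K L T" and U: "two_functor L M U" and V: "lifts_along K U T V"
  shows "two_functor K M V"
proof -
  interpret T: two_functor K L T by fact
  interpret U: two_functor L M U by fact
  have V0: "T0 V a = T0 U (T0 T a)" if "a \<in> Ob K" for a
    using V that by (simp add: lifts_along_def)
  have V1: "T1 V a b = fctr_comp (HomCat K a b) (T1 U (T0 T a) (T0 T b)) (T1 T a b)"
    if "a \<in> Ob K" "b \<in> Ob K" for a b using V that by (simp add: lifts_along_def)
  have V1o: "FOb (T1 V a b) f = FOb (T1 U (T0 T a) (T0 T b)) (FOb (T1 T a b) f)"
    if "a \<in> Ob K" "b \<in> Ob K" "f \<in> Obj (HomCat K a b)" for a b f using that by (simp add: V1)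
  have V1h: "FAr (T1 V a b) f f' \<alpha> =
    FAr (T1 U (T0 T a) (T0 T b)) (FOb (T1 T a b) f) (FOb (T1 T a b) f') (FAr (T1 T a b) f f' \<alpha>)"
    if "a \<in> Ob K" "b \<in> Ob K" "\<alpha> \<in> Hom (HomCat K a b) f f'" for a b f f' \<alpha>
    using that T.dom.homcat by (simp add: V1)
  show ?thesis
  proof (rule two_functor.intro, goal_cases)
    case 1 show ?case by (rule T.dom.two_category_axioms)
  next
    case 2 show ?case by (rule U.cod.two_category_axioms)
  next
    case 3
    show ?case
    proof (rule two_functor_axioms.intro, goal_cases)
      case (1 a) then show ?case by (simp add: V0 T.maps_ob U.maps_ob)
    next
      case (2 a b) then show ?case
        using is_functor_comp[OF T.hom_functor[OF 2] U.hom_functor[OF T.maps_ob T.maps_ob]]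
        by (simp add: V0 V1)
    next
      case (3 a) then show ?case
        by (simp add: V0 V1o T.dom.id1 T.maps_id1 U.maps_id1 T.maps_ob)
    next
      case (4 a b c f g) then show ?case
        by (simp add: V0 V1o T.dom.comp1_in T.maps_comp1 U.maps_comp1 T.maps_ob T.maps_obj1)
    next
      case (5 a b c \<alpha> f f' \<beta> g g')
      note o = category.hom_obj[OF T.dom.homcat[OF 5(1,2)] 5(4)] category.hom_obj[OF T.dom.homcat[OF 5(2,3)] 5(5)]
      show ?case using 5 o T.dom.hcomp_in[OF 5]
        U.maps_hcomp[OF T.maps_ob[OF 5(1)] T.maps_ob[OF 5(2)] T.maps_ob[OF 5(3)]
           T.maps_hom2[OF 5(1,2,4)] T.maps_hom2[OF 5(2,3,5)]]
        by (simp add: V0 V1o V1h T.maps_hcomp T.maps_comp1)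
    qed
  qed
qed

lemma cartesian_2functor_lifts_along:
  assumes T: "cartesian_2functor K L T" and U: "cartesian_2functor L M U" and V: "lifts_along K U T V"
  shows "cartesian_2functor K M V"
proof (rule cartesian_2functorI)
  show "two_functor K M V" using assms two_functor_lifts_along by (auto simp: cartesian_2functor_def)
  show "cartesian_2category M" using U by (simp add: cartesian_2functor_def)
  interpret T: two_functor K L T using T by (simp add: cartesian_2functor_def)
  fix I :: "nat set" and A assume I: "finite I" "\<And>i. i \<in> I \<Longrightarrow> A i \<in> Ob K"
  have "cartesian_2category K" using T by (simp add: cartesian_2functor_def)
  then obtain p pr where p: "is_2product K I A p pr"
    using cartesian_2category_product[of K I A] I by auto
  then have ob: "p \<in> Ob K" "\<And>i. i \<in> I \<Longrightarrow> pr i \<in> Obj (HomCat K p (A i))" by (auto simp: is_2product_def)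
  have "is_2product L I (\<lambda>i. T0 T (A i)) (T0 T p) (\<lambda>i. FOb (T1 T p (A i)) (pr i))"
    using T I p by (simp add: cartesian_2functor_def)
  then have UT: "is_2product M I (\<lambda>i. T0 U (T0 T (A i))) (T0 U (T0 T p))
      (\<lambda>i. FOb (T1 U (T0 T p) (T0 T (A i))) (FOb (T1 T p (A i)) (pr i)))"
    using U I T.maps_ob by (simp add: cartesian_2functor_def)
  have V1: "FOb (T1 V p (A i)) (pr i) = FOb (T1 U (T0 T p) (T0 T (A i))) (FOb (T1 T p (A i)) (pr i))"
    "T0 V (A i) = T0 U (T0 T (A i))" if "i \<in> I" for i
  proof -
    have "T1 V p (A i) = fctr_comp (HomCat K p (A i)) (T1 U (T0 T p) (T0 T (A i))) (T1 T p (A i))"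
      using V I(2)[OF that] ob(1) by (simp add: lifts_along_def)
    then show "FOb (T1 V p (A i)) (pr i) = FOb (T1 U (T0 T p) (T0 T (A i))) (FOb (T1 T p (A i)) (pr i))"
      using ob(2)[OF that] by simp
    show "T0 V (A i) = T0 U (T0 T (A i))" using V I(2)[OF that] by (simp add: lifts_along_def)
  qed
  have "T0 V p = T0 U (T0 T p)" using V ob by (simp add: lifts_along_def)
  then have "is_2product M I (\<lambda>i. T0 V (A i)) (T0 V p) (\<lambda>i. FOb (T1 V p (A i)) (pr i))"
    using is_2product_cong[OF UT V1(2) V1(1)] by simp
  then show "\<exists>p pr. is_2product K I A p pr \<and>
      is_2product M I (\<lambda>i. T0 V (A i)) (T0 V p) (\<lambda>i. FOb (T1 V p (A i)) (pr i))"
    using p by blast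
qed

text \<open>The properties of an isomorphism of 2-categories along which 2-products are transported back.\<close>

locale surjective_2equivalence = two_functor +
  assumes surj_ob: "b \<in> Ob L \<Longrightarrow> \<exists>a \<in> Ob K. T0 T a = b"
    and bij1: "\<lbrakk>a \<in> Ob K; b \<in> Ob K\<rbrakk> \<Longrightarrow>
      bij_betw (FOb (T1 T a b)) (Obj (HomCat K a b)) (Obj (HomCat L (T0 T a) (T0 T b)))"
    and bij2: "\<lbrakk>a \<in> Ob K; b \<in> Ob K; f \<in> Obj (HomCat K a b); g \<in> Obj (HomCat K a b)\<rbrakk> \<Longrightarrow>
      bij_betw (FAr (T1 T a b) f g) (Hom (HomCat K a b) f g)
        (Hom (HomCat L (T0 T a) (T0 T b)) (FOb (T1 T a b) f) (FOb (T1 T a b) g))"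
begin

lemma bij_betw_ex1:
  assumes "bij_betw t X Y" "\<exists>!y. y \<in> Y \<and> P y" "\<And>x. x \<in> X \<Longrightarrow> Q x \<longleftrightarrow> P (t x)"
  shows "\<exists>!x. x \<in> X \<and> Q x"
  using assms unfolding bij_betw_def inj_on_def by (metis image_iff)

text \<open>The universal property in \<open>K\<close> is the one in \<open>L\<close>, read through the bijections on 1-cells and
  2-cells.\<close>

lemma reflects_2product:
  assumes A: "\<And>i. i \<in> I \<Longrightarrow> A i \<in> Ob K" and p: "p \<in> Ob K"
    and pr: "\<And>i. i \<in> I \<Longrightarrow> pr i \<in> Obj (HomCat K p (A i))"
    and Tp: "is_2product L I (\<lambda>i. T0 T (A i)) (T0 T p) (\<lambda>i. FOb (T1 T p (A i)) (pr i))"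
  shows "is_2product K I A p pr"
  unfolding is_2product_def
proof (intro conjI ballI allI impI)
  fix x f assume x: "x \<in> Ob K" and f: "\<forall>i \<in> I. f i \<in> Obj (HomCat K x (A i))"
  let ?p = "\<lambda>i. FOb (T1 T p (A i)) (pr i)" and ?f = "\<lambda>i. FOb (T1 T x (A i)) (f i)"
  have "\<forall>i \<in> I. ?f i \<in> Obj (HomCat L (T0 T x) (T0 T (A i)))"
    using f x A by (simp add: maps_obj1)
  then have ex: "\<exists>!u. u \<in> Obj (HomCat L (T0 T x) (T0 T p)) \<and>
      (\<forall>i \<in> I. comp1 L (T0 T x) (T0 T p) (T0 T (A i)) (?p i) u = ?f i)"
    using Tp maps_ob[OF x] by (simp add: is_2product_def)
  show "\<exists>!h. h \<in> Obj (HomCat K x p) \<and> (\<forall>i\<in>I. comp1 K x p (A i) (pr i) h = f i)"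
  proof (rule bij_betw_ex1[OF bij1[OF x p] ex], rule ball_cong[OF refl])
    fix h i assume h: "h \<in> Obj (HomCat K x p)" and i: "i \<in> I"
    have "comp1 K x p (A i) (pr i) h \<in> Obj (HomCat K x (A i))"
      using x p A[OF i] h pr[OF i] by (rule dom.comp1_in)
    then show "comp1 K x p (A i) (pr i) h = f i \<longleftrightarrow>
       comp1 L (T0 T x) (T0 T p) (T0 T (A i)) (?p i) (FOb (T1 T x p) h) = ?f i"
      using maps_comp1[OF x p A[OF i] h pr[OF i]] bij1[OF x A[OF i]] f i
      by (metis bij_betw_inv_into_left)
  qed
next
  fix x h h' \<phi>
  assume x: "x \<in> Ob K" and h: "h \<in> Obj (HomCat K x p)" and h': "h' \<in> Obj (HomCat K x p)"
    and phi: "\<forall>i \<in> I. \<phi> i \<in> Hom (HomCat K x (A i)) (comp1 K x p (A i) (pr i) h) (comp1 K x p (A i) (pr i) h')"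
  let ?p = "\<lambda>i. FOb (T1 T p (A i)) (pr i)" and ?h = "FOb (T1 T x p) h" and ?h' = "FOb (T1 T x p) h'"
  let ?\<phi> = "\<lambda>i. FAr (T1 T x (A i)) (comp1 K x p (A i) (pr i) h) (comp1 K x p (A i) (pr i) h') (\<phi> i)"
  have c: "comp1 K x p (A i) (pr i) h \<in> Obj (HomCat K x (A i))"
    "comp1 K x p (A i) (pr i) h' \<in> Obj (HomCat K x (A i))" if "i \<in> I" for i
    using x p A[OF that] h h' pr[OF that] by (simp_all add: dom.comp1_in)
  have "\<forall>i \<in> I. ?\<phi> i \<in> Hom (HomCat L (T0 T x) (T0 T (A i)))
      (comp1 L (T0 T x) (T0 T p) (T0 T (A i)) (?p i) ?h) (comp1 L (T0 T x) (T0 T p) (T0 T (A i)) (?p i) ?h')"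
    using maps_hom2[OF x A phi[rule_format]] maps_comp1[OF x p A h pr] maps_comp1[OF x p A h' pr] by simp
  then have ex: "\<exists>!\<theta>. \<theta> \<in> Hom (HomCat L (T0 T x) (T0 T p)) ?h ?h' \<and>
      (\<forall>i \<in> I. whisker L (T0 T x) (T0 T p) (T0 T (A i)) (?p i) ?h ?h' \<theta> = ?\<phi> i)"
    by (rule is_2product_cell[OF Tp maps_ob[OF x] maps_obj1[OF x p h] maps_obj1[OF x p h']])
  have "\<exists>!\<theta>. \<theta> \<in> Hom (HomCat K x p) h h' \<and> (\<forall>i\<in>I. whisker K x p (A i) (pr i) h h' \<theta> = \<phi> i)"
  proof (rule bij_betw_ex1[OF bij2[OF x p h h'] ex], rule ball_cong[OF refl])
    fix \<theta> i assume t: "\<theta> \<in> Hom (HomCat K x p) h h'" and i: "i \<in> I"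
    show "whisker K x p (A i) (pr i) h h' \<theta> = \<phi> i \<longleftrightarrow>
       whisker L (T0 T x) (T0 T p) (T0 T (A i)) (?p i) ?h ?h' (FAr (T1 T x p) h h' \<theta>) = ?\<phi> i"
      using maps_whisker[OF x p A[OF i] t pr[OF i]]
        inj_on_eq_iff[OF bij_betw_imp_inj_on[OF bij2[OF x A[OF i] c[OF i]]]
          dom.whisker_in[OF x p A[OF i] t pr[OF i]] phi[rule_format, OF i]]
      by simp
  qed
  then show "\<exists>!\<theta>. \<theta> \<in> Hom (HomCat K x p) h h' \<and>
      (\<forall>i\<in>I. hcomp K x p (A i) (pr i) (pr i) h h' (id2 K p (A i) (pr i)) \<theta> = \<phi> i)"
    unfolding whisker_def .
qed (use p pr in auto)

text \<open>A 2-product of the image of a family comes from a cone in \<open>K\<close>, which is a 2-product because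
  2-products are reflected. In particular \<open>K\<close> inherits finite 2-products from \<open>L\<close>.\<close>

lemma cartesian_surjective_2equivalence:
  assumes "cartesian_2category L"
  shows "cartesian_2functor K L T"
proof (rule cartesian_2functorI)
  show "two_functor K L T" by (rule two_functor_axioms)
  fix I :: "nat set" and A assume I: "finite I" and A: "\<And>i. i \<in> I \<Longrightarrow> A i \<in> Ob K"
  then obtain q qr where q: "is_2product L I (\<lambda>i. T0 T (A i)) q qr"
    using cartesian_2category_product[OF assms I, of "\<lambda>i. T0 T (A i)"] maps_ob by auto
  then obtain p where p: "p \<in> Ob K" "T0 T p = q" using surj_ob[OF is_2product_ob(1)[OF q]] by blast
  define pr where "pr i = inv_into (Obj (HomCat K p (A i))) (FOb (T1 T p (A i))) (qr i)" for i
  have qr: "qr i \<in> Obj (HomCat L (T0 T p) (T0 T (A i)))" if "i \<in> I" for i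
    using q p that by (auto simp: is_2product_def)
  have pr: "pr i \<in> Obj (HomCat K p (A i))" "FOb (T1 T p (A i)) (pr i) = qr i" if "i \<in> I" for i
    using bij1[OF p(1) A[OF that]] qr[OF that] unfolding pr_def bij_betw_def
    by (auto intro: inv_into_into f_inv_into_f)
  have "is_2product L I (\<lambda>i. T0 T (A i)) (T0 T p) (\<lambda>i. FOb (T1 T p (A i)) (pr i))"
    using q unfolding p(2)[symmetric] by (rule is_2product_cong) (simp_all add: pr(2))
  moreover from this have "is_2product K I A p pr"
    using A p pr by (intro reflects_2product)
  ultimately show "\<exists>p pr. is_2product K I A p pr \<and>
      is_2product L I (\<lambda>i. T0 T (A i)) (T0 T p) (\<lambda>i. FOb (T1 T p (A i)) (pr i))" by blast
qed (rule assms)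

end

section \<open>Terminal objects and pullbacks as finite limits\<close>

text \<open>The two shapes needed, the empty category and the cospan, are preorders. On their objects the
  hom-sets are empty or \<open>{0}\<close>, so that all equations between arrows hold trivially.\<close>

definition thin_cat :: "nat set \<Rightarrow> (nat \<Rightarrow> nat \<Rightarrow> bool) \<Rightarrow> (nat, nat) cat" where
  "thin_cat X le = make_cat X (\<lambda>x y. if le x y then {0} else {}) (\<lambda>_. 0) (\<lambda>_ _ _ _ _. 0)"

lemma finite_thin_cat:
  assumes "finite X" "\<And>x. x \<in> X \<Longrightarrow> le x x"
    "\<And>x y z. \<lbrakk>x \<in> X; y \<in> X; z \<in> X; le x y; le y z\<rbrakk> \<Longrightarrow> le x z"
  shows "finite_cat (thin_cat X le)"
proof -
  have "category (thin_cat X le)" unfolding thin_cat_def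
  proof (rule category_make_cat, goal_cases)
    case (2 x y z f g) then show ?case using assms(3)[of x y z] by (simp split: if_split_asm)
  qed (use assms(2) in \<open>simp_all split: if_split_asm\<close>)
  then show ?thesis using assms(1) by (simp add: finite_cat_def thin_cat_def)
qed

lemma finite_empty_cat: "finite_cat (thin_cat {} le)"
  by (rule finite_thin_cat) auto

lemma is_limit_empty: "is_limit C (thin_cat {} le) D x c \<longleftrightarrow> is_terminal C x"
  by (simp add: is_limit_def is_cone_def is_terminal_def thin_cat_def Ball_def)

text \<open>A terminal object is a limit of the empty diagram.\<close>

lemma preserves_terminal:
  assumes F: "is_functor C D F" "preserves_finite_limits C D F" and t: "is_terminal C t"
  shows "is_terminal D (FOb F t)"
proof -
  let ?J = "thin_cat {} (\<lambda>_ _. True)"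
  have "is_functor ?J C (make_fctr ?J undefined undefined)"
    by (rule is_functor_make_fctr)
      (use F finite_empty_cat[of "\<lambda>_ _. True"] in \<open>auto simp: thin_cat_def is_functor_def finite_cat_def\<close>)
  then show ?thesis
    using F(2) t finite_empty_cat unfolding preserves_finite_limits_def by (metis is_limit_empty)
qed

text \<open>The cospan \<open>0 \<rightarrow> 2 \<leftarrow> 1\<close>.\<close>

definition cospan :: "(nat, nat) cat" where
  "cospan = thin_cat {0, 1, 2} (\<lambda>i j. i = j \<or> j = 2)"

definition cospan_diagram ::
  "('o, 'm) cat \<Rightarrow> 'o \<Rightarrow> 'o \<Rightarrow> 'o \<Rightarrow> 'm \<Rightarrow> 'm \<Rightarrow> (nat, nat, 'o, 'm) fctr" where
  "cospan_diagram C x y z r l = make_fctr cospan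
     (\<lambda>i. if i = 0 then x else if i = 1 then y else z)
     (\<lambda>i j _. if i = 0 \<and> j = 0 then Ident C x else if i = 1 \<and> j = 1 then Ident C y
        else if i = 0 then r else if i = 1 then l else Ident C z)"

lemma cospan_simps [simp]:
  "Obj cospan = {0, 1, 2}"
  "u \<in> Hom cospan i j \<longleftrightarrow> u = 0 \<and> i \<in> {0, 1, 2} \<and> (i = j \<or> j = 2)"
  "i \<in> {0, 1, 2} \<Longrightarrow> Ident cospan i = 0"
  by (auto simp: cospan_def thin_cat_def)

lemma finite_cospan: "finite_cat cospan"
  unfolding cospan_def by (rule finite_thin_cat) auto

lemma category_cospan: "category cospan"
  using finite_cospan by (simp add: finite_cat_def)

lemma cospan_comp: "\<lbrakk>f \<in> Hom cospan i j; g \<in> Hom cospan j k\<rbrakk> \<Longrightarrow> Comp cospan i j k g f = 0"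
  using category.comp_in_hom[OF category_cospan, of f i j g k] by simp

lemma cospan_diagram_simps [simp]:
  "FOb (cospan_diagram C x y z r l) 0 = x"
  "FOb (cospan_diagram C x y z r l) (Suc 0) = y"
  "FOb (cospan_diagram C x y z r l) 2 = z"
  "FAr (cospan_diagram C x y z r l) 0 0 0 = Ident C x"
  "FAr (cospan_diagram C x y z r l) (Suc 0) (Suc 0) 0 = Ident C y"
  "FAr (cospan_diagram C x y z r l) 2 2 0 = Ident C z"
  "FAr (cospan_diagram C x y z r l) 0 2 0 = r"
  "FAr (cospan_diagram C x y z r l) (Suc 0) 2 0 = l"
  by (simp_all add: cospan_diagram_def category_cospan)

lemma is_functor_cospan_diagram:
  assumes "category C" "r \<in> Hom C x z" "l \<in> Hom C y z"
  shows "is_functor cospan C (cospan_diagram C x y z r l)"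
proof -
  interpret category C by fact
  note o = hom_obj[OF assms(2)] hom_obj[OF assms(3)]
  show ?thesis unfolding cospan_diagram_def
    by (rule is_functor_make_fctr)
      (use assms o in \<open>auto simp: category_cospan ident_in_hom cospan_comp comp_ident_left comp_ident_right\<close>)
qed

lemma fctr_comp_cospan_diagram:
  assumes F: "is_functor C D F" and rl: "r \<in> Hom C x z" "l \<in> Hom C y z"
  shows "fctr_comp cospan F (cospan_diagram C x y z r l) =
    cospan_diagram D (FOb F x) (FOb F y) (FOb F z) (FAr F x z r) (FAr F y z l)"
proof -
  interpret F: is_functor C D F by fact
  note o = F.dom.hom_obj[OF rl(1)] F.dom.hom_obj[OF rl(2)]
  show ?thesis
    by (rule fctr_eqI[OF is_functor_comp[OF is_functor_cospan_diagram[OF F.dom.category_axioms rl] F]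
          is_functor_cospan_diagram[OF F.cod.category_axioms F.maps_hom[OF rl(1)] F.maps_hom[OF rl(2)]]])
      (use o in \<open>auto simp: category_cospan F.maps_ident\<close>)
qed

lemma cospan_cone_iff:
  assumes "category C"
  shows "is_cone C cospan (cospan_diagram C x y z r l) q d \<longleftrightarrow> q \<in> Obj C \<and>
    d 0 \<in> Hom C q x \<and> d 1 \<in> Hom C q y \<and> d 2 \<in> Hom C q z \<and>
    Comp C q x z r (d 0) = d 2 \<and> Comp C q y z l (d 1) = d 2"
  by (auto simp: is_cone_def category.comp_ident_left[OF assms])

text \<open>A cone over a cospan is determined by its legs at the two outer objects, since its leg at the
  middle object is the common composite; dropping that leg turns the universal property of the
  limit into that of the pullback.\<close>

lemma is_pullback_iff_limit:
  assumes C: "category C" and r: "r \<in> Hom C x z" and l: "l \<in> Hom C y z"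
    and c: "c 2 = Comp C p x z r (c 0)"
  shows "is_limit C cospan (cospan_diagram C x y z r l) p c \<longleftrightarrow> is_pullback C p x y z (c 0) (c 1) r l"
proof -
  interpret category C by fact
  let ?D = "cospan_diagram C x y z r l"
  have lim: "is_limit C cospan ?D p c \<longleftrightarrow> is_cone C cospan ?D p c \<and>
     (\<forall>q d. is_cone C cospan ?D q d \<longrightarrow> (\<exists>!h. h \<in> Hom C q p \<and> Comp C q p x (c 0) h = d 0 \<and>
        Comp C q p y (c 1) h = d 1 \<and> Comp C q p z (c 2) h = d 2))"
    by (simp add: is_limit_def)
  have cone: "is_cone C cospan ?D p c \<longleftrightarrow>
    c 0 \<in> Hom C p x \<and> c 1 \<in> Hom C p y \<and> Comp C p x z r (c 0) = Comp C p y z l (c 1)"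
    using c comp_in_hom[OF _ r] hom_obj by (auto simp: cospan_cone_iff[OF C])
  show ?thesis
  proof
    assume L: "is_limit C cospan ?D p c"
    have "\<exists>!h. h \<in> Hom C q p \<and> Comp C q p x (c 0) h = q1 \<and> Comp C q p y (c 1) h = q2"
      if q: "q \<in> Obj C" "q1 \<in> Hom C q x" "q2 \<in> Hom C q y" "Comp C q x z r q1 = Comp C q y z l q2" for q q1 q2
    proof -
      let ?d = "\<lambda>i :: nat. if i = 0 then q1 else if i = 1 then q2 else Comp C q x z r q1"
      have "is_cone C cospan ?D q ?d"
        using q comp_in_hom[OF q(2) r] by (simp add: cospan_cone_iff[OF C])
      then have ex: "\<exists>!h. h \<in> Hom C q p \<and> Comp C q p x (c 0) h = q1 \<and>
        Comp C q p y (c 1) h = q2 \<and> Comp C q p z (c 2) h = Comp C q x z r q1"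
        using conjunct2[OF L[unfolded lim], rule_format, of q ?d] by simp
      have "Comp C q p z (c 2) h = Comp C q x z r q1"
        if "h \<in> Hom C q p" "Comp C q p x (c 0) h = q1" for h
        using comp_assoc[OF that(1) _ r, of "c 0"] that(2) L cone c unfolding lim by simp
      then show ?thesis using ex by (smt (verit, best))
    qed
    then show "is_pullback C p x y z (c 0) (c 1) r l"
      using L r l unfolding lim cone is_pullback_def by blast
  next
    assume P: "is_pullback C p x y z (c 0) (c 1) r l"
    have "\<exists>!h. h \<in> Hom C q p \<and> Comp C q p x (c 0) h = d 0 \<and>
        Comp C q p y (c 1) h = d 1 \<and> Comp C q p z (c 2) h = d 2"
      if "is_cone C cospan ?D q d" for q d
    proof -
      have d: "q \<in> Obj C" "d 0 \<in> Hom C q x" "d 1 \<in> Hom C q y"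
        "Comp C q x z r (d 0) = d 2" "Comp C q y z l (d 1) = d 2"
        using that by (simp_all add: cospan_cone_iff[OF C])
      have ex: "\<exists>!h. h \<in> Hom C q p \<and> Comp C q p x (c 0) h = d 0 \<and> Comp C q p y (c 1) h = d 1"
        using P d unfolding is_pullback_def by simp
      have "Comp C q p z (c 2) h = d 2" if "h \<in> Hom C q p" "Comp C q p x (c 0) h = d 0" for h
        using comp_assoc[OF that(1) _ r, of "c 0"] that(2) P c d(4) unfolding is_pullback_def by simp
      then show ?thesis using ex by (smt (verit, best))
    qed
    then show "is_limit C cospan ?D p c"
      using P unfolding lim cone is_pullback_def by blast
  qed
qed

text \<open>Together with its preservation by lex functors below, this makes \<open>all_triple\<close> an adequate triple
  and lex functors maps of adequate triples.\<close>

lemma pullback_exists: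
  assumes C: "category C" "has_finite_limits C" and rl: "r \<in> Hom C x z" "l \<in> Hom C y z"
  shows "\<exists>p p1 p2. is_pullback C p x y z p1 p2 r l"
proof -
  obtain p c where L: "is_limit C cospan (cospan_diagram C x y z r l) p c"
    using C(2) finite_cospan is_functor_cospan_diagram[OF C(1) rl] unfolding has_finite_limits_def by blast
  then have "c 2 = Comp C p x z r (c 0)"
    by (simp add: is_limit_def cospan_cone_iff[OF C(1)])
  then show ?thesis using is_pullback_iff_limit[OF C(1) rl] L by blast
qed

lemma is_limit_cong:
  assumes "D = D'" "x = x'" "\<And>j. j \<in> Obj J \<Longrightarrow> c j = c' j"
  shows "is_limit C J D x c \<longleftrightarrow> is_limit C J D' x' c'"
  using assms by (simp add: is_limit_def is_cone_def)

lemma preserves_pullback: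
  assumes F: "is_functor C D F" "preserves_finite_limits C D F" and P: "is_pullback C p x y z p1 p2 r l"
  shows "is_pullback D (FOb F p) (FOb F x) (FOb F y) (FOb F z)
    (FAr F p x p1) (FAr F p y p2) (FAr F x z r) (FAr F y z l)"
proof -
  interpret F: is_functor C D F by fact
  have rl: "r \<in> Hom C x z" "l \<in> Hom C y z" and p: "p1 \<in> Hom C p x" "p2 \<in> Hom C p y"
    using P by (simp_all add: is_pullback_def)
  let ?c = "\<lambda>i :: nat. if i = 0 then p1 else if i = 1 then p2 else Comp C p x z r p1"
  let ?c' = "\<lambda>i :: nat. if i = 0 then FAr F p x p1 else if i = 1 then FAr F p y p2
    else FAr F p z (Comp C p x z r p1)"
  have "is_limit C cospan (cospan_diagram C x y z r l) p ?c"
    using P is_pullback_iff_limit[OF F.dom.category_axioms rl, of ?c] by simp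
  then have "is_limit D cospan (fctr_comp cospan F (cospan_diagram C x y z r l)) (FOb F p)
      (\<lambda>j. FAr F p (FOb (cospan_diagram C x y z r l) j) (?c j))"
    using F(2) finite_cospan is_functor_cospan_diagram[OF F.dom.category_axioms rl]
    unfolding preserves_finite_limits_def by blast
  then have "is_limit D cospan (cospan_diagram D (FOb F x) (FOb F y) (FOb F z) (FAr F x z r) (FAr F y z l))
      (FOb F p) ?c'"
    unfolding fctr_comp_cospan_diagram[OF F(1) rl] by (rule iffD1[OF is_limit_cong[OF refl refl], rotated]) auto
  then show ?thesis
    using is_pullback_iff_limit[OF F.cod.category_axioms F.maps_hom[OF rl(1)] F.maps_hom[OF rl(2)], of ?c']
      F.maps_comp[OF p(1) rl(1)] by simp
qed

lemma preserves_finite_limits_id: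
  assumes "category C"
  shows "preserves_finite_limits C C (id_fctr C)"
  unfolding preserves_finite_limits_def
proof (intro allI impI, elim conjE)
  fix J :: "(nat, nat) cat" and D x c
  assume D: "is_functor J C D" and L: "is_limit C J D x c"
  then have "x \<in> Obj C" "\<And>j. j \<in> Obj J \<Longrightarrow> c j \<in> Hom C x (FOb D j)"
    by (simp_all add: is_limit_def is_cone_def)
  then show "is_limit C J (fctr_comp J (id_fctr C) D) (FOb (id_fctr C) x)
      (\<lambda>j. FAr (id_fctr C) x (FOb D j) (c j))"
    using L assms by (simp add: fctr_comp_id_left[OF D] cong: is_limit_cong)
qed

lemma preserves_finite_limits_comp:
  assumes F: "is_functor B C F" "preserves_finite_limits B C F"
    and G: "is_functor C D G" "preserves_finite_limits C D G"
  shows "preserves_finite_limits B D (fctr_comp B G F)"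
  unfolding preserves_finite_limits_def
proof (intro allI impI, elim conjE)
  fix J :: "(nat, nat) cat" and E x c
  assume J: "finite_cat J" and E: "is_functor J B E" and L: "is_limit B J E x c"
  have x: "x \<in> Obj B" and c: "\<And>j. j \<in> Obj J \<Longrightarrow> c j \<in> Hom B x (FOb E j)"
    using L by (simp_all add: is_limit_def is_cone_def)
  have B: "category B" using F by (simp add: is_functor_def)
  have "is_limit C J (fctr_comp J F E) (FOb F x) (\<lambda>j. FAr F x (FOb E j) (c j))"
    using F J E L unfolding preserves_finite_limits_def by blast
  then have "is_limit D J (fctr_comp J G (fctr_comp J F E)) (FOb G (FOb F x))
      (\<lambda>j. FAr G (FOb F x) (FOb (fctr_comp J F E) j) (FAr F x (FOb E j) (c j)))"
    using G J is_functor_comp[OF E F(1)] unfolding preserves_finite_limits_def by blast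
  then show "is_limit D J (fctr_comp J (fctr_comp B G F) E) (FOb (fctr_comp B G F) x)
      (\<lambda>j. FAr (fctr_comp B G F) x (FOb E j) (c j))"
    using x c B by (simp add: fctr_comp_assoc[OF E F(1)] cong: is_limit_cong)
qed

section \<open>Limits in a product of categories\<close>

context category_family
begin

text \<open>Limits in the product are computed componentwise because equations between arrows are.\<close>

lemma product_comp_eq_iff:
  assumes f: "f \<in> Hom (product C) x y" and g: "g \<in> Hom (product C) y z" and k: "k \<in> Hom (product C) x z"
  shows "Comp (product C) x y z g f = k \<longleftrightarrow>
    (\<forall>i \<in> I. Comp (C i) (prj i x) (prj i y) (prj i z) (prjm i g) (prjm i f) = prjm i k)"
  using prjm_comp[OF _ f g] product_hom_eqI[OF category.comp_in_hom[OF category_prod f g] k] by auto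

lemma product_cone_iff:
  assumes D: "is_functor J (product C) D" and x: "x \<in> Obj (product C)"
    and c: "\<And>j. j \<in> Obj J \<Longrightarrow> c j \<in> Hom (product C) x (FOb D j)"
  shows "is_cone (product C) J D x c \<longleftrightarrow>
    (\<forall>i \<in> I. is_cone (C i) J (fctr_comp J (projection C i) D) (prj i x) (\<lambda>j. prjm i (c j)))"
proof -
  interpret D: is_functor J "product C" D by fact
  show ?thesis
    unfolding is_cone_def
    using x c product_homD(3)[OF c] product_objD(2)[OF x] D.maps_obj
      product_comp_eq_iff[OF c D.maps_hom c] C
    by (auto simp: D.dom.category_axioms D.maps_hom)
qed

lemma product_limitI:
  assumes D: "is_functor J (product C) D" and x: "x \<in> Obj (product C)"
    and c: "\<And>j. j \<in> Obj J \<Longrightarrow> c j \<in> Hom (product C) x (FOb D j)"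
    and L: "\<And>i. i \<in> I \<Longrightarrow>
      is_limit (C i) J (fctr_comp J (projection C i) D) (prj i x) (\<lambda>j. prjm i (c j))"
  shows "is_limit (product C) J D x c"
proof -
  interpret D: is_functor J "product C" D by fact
  show ?thesis unfolding is_limit_def
  proof (intro conjI allI impI)
    show "is_cone (product C) J D x c"
      using L by (simp add: product_cone_iff[OF D x c] is_limit_def)
    fix y d assume cone: "is_cone (product C) J D y d"
    then have y: "y \<in> Obj (product C)" and d: "\<And>j. j \<in> Obj J \<Longrightarrow> d j \<in> Hom (product C) y (FOb D j)"
      by (simp_all add: is_cone_def)
    have ex: "\<exists>!h. h \<in> Hom (C i) (prj i y) (prj i x) \<and>
       (\<forall>j \<in> Obj J. Comp (C i) (prj i y) (prj i x) (prj i (FOb D j)) (prjm i (c j)) h = prjm i (d j))"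
      if i: "i \<in> I" for i
    proof -
      have "is_cone (C i) J (fctr_comp J (projection C i) D) (prj i y) (\<lambda>j. prjm i (d j))"
        using cone i by (simp add: product_cone_iff[OF D y d])
      then have "\<exists>!h. h \<in> Hom (C i) (prj i y) (prj i x) \<and>
       (\<forall>j \<in> Obj J. Comp (C i) (prj i y) (prj i x) (FOb (fctr_comp J (projection C i) D) j) (prjm i (c j)) h = prjm i (d j))"
        using L[OF i] unfolding is_limit_def by blast
      then show ?thesis by (simp add: D.maps_obj C)
    qed
    then obtain h where h: "\<And>i. i \<in> I \<Longrightarrow> h i \<in> Hom (C i) (prj i y) (prj i x) \<and>
       (\<forall>j \<in> Obj J. Comp (C i) (prj i y) (prj i x) (prj i (FOb D j)) (prjm i (c j)) (h i) = prjm i (d j))"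
      by metis
    have H: "tupm h \<in> Hom (product C) y x" by (rule tupm_in_hom[OF y x]) (use h in simp)
    show "\<exists>!h. h \<in> Hom (product C) y x \<and> (\<forall>j \<in> Obj J. Comp (product C) y x (FOb D j) (c j) h = d j)"
    proof (rule ex1I[of _ "tupm h"], intro conjI ballI H)
      fix j assume "j \<in> Obj J"
      then show "Comp (product C) y x (FOb D j) (c j) (tupm h) = d j"
        using h by (simp add: product_comp_eq_iff[OF H c d])
    next
      fix h' assume h': "h' \<in> Hom (product C) y x \<and> (\<forall>j \<in> Obj J. Comp (product C) y x (FOb D j) (c j) h' = d j)"
      show "h' = tupm h"
      proof (rule product_hom_eqI[OF conjunct1[OF h'] H])
        fix i assume i: "i \<in> I"
        have "\<forall>j \<in> Obj J. Comp (C i) (prj i y) (prj i x) (prj i (FOb D j)) (prjm i (c j)) (prjm i h') = prjm i (d j)"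
          using h' c d i product_comp_eq_iff by blast
        then show "prjm i h' = prjm i (tupm h)"
          using ex[OF i] h[OF i] product_homD(3)[OF conjunct1[OF h'] i] i by auto
      qed
    qed
  qed
qed

text \<open>A cone over one component extends to a cone over the whole diagram: in the other components
  the limit cone itself is taken. Such an extension would not be available without the limit, for
  example if some other factor were empty.\<close>

lemma product_limitD:
  assumes D: "is_functor J (product C) D" and L: "is_limit (product C) J D x c" and i: "i \<in> I"
  shows "is_limit (C i) J (fctr_comp J (projection C i) D) (prj i x) (\<lambda>j. prjm i (c j))"
proof -
  interpret D: is_functor J "product C" D by fact
  have cone: "is_cone (product C) J D x c" using L by (simp add: is_limit_def)
  then have x: "x \<in> Obj (product C)" and c: "\<And>j. j \<in> Obj J \<Longrightarrow> c j \<in> Hom (product C) x (FOb D j)"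
    by (simp_all add: is_cone_def)
  have cones: "\<And>k. k \<in> I \<Longrightarrow> is_cone (C k) J (fctr_comp J (projection C k) D) (prj k x) (\<lambda>j. prjm k (c j))"
    using cone by (simp add: product_cone_iff[OF D x c])
  show ?thesis unfolding is_limit_def
  proof (intro conjI allI impI)
    show "is_cone (C i) J (fctr_comp J (projection C i) D) (prj i x) (\<lambda>j. prjm i (c j))"
      using cones i by simp
    fix y d assume yd: "is_cone (C i) J (fctr_comp J (projection C i) D) y d"
    let ?y = "tup (\<lambda>k. if k = i then y else prj k x)"
    let ?d = "\<lambda>j. tupm (\<lambda>k. if k = i then d j else prjm k (c j))"
    have y: "?y \<in> Obj (product C)" using yd product_objD(2)[OF x] by (simp add: is_cone_def)
    have "d j \<in> Hom (C i) y (prj i (FOb D j))" if "j \<in> Obj J" for j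
      using yd that i C D.maps_obj by (auto simp: is_cone_def)
    then have d: "?d j \<in> Hom (product C) ?y (FOb D j)" if j: "j \<in> Obj J" for j
      using product_homD(3)[OF c[OF j]] j D.maps_obj by (intro tupm_in_hom[OF y]) simp_all
    have "is_cone (C k) J (fctr_comp J (projection C k) D) (prj k ?y) (\<lambda>j. prjm k (?d j))" if "k \<in> I" for k
      using yd cones[OF that] that by (cases "k = i") simp_all
    then have "is_cone (product C) J D ?y ?d" by (simp add: product_cone_iff[OF D y d])
    then have ex: "\<exists>!h. h \<in> Hom (product C) ?y x \<and> (\<forall>j \<in> Obj J. Comp (product C) ?y x (FOb D j) (c j) h = ?d j)"
      using L unfolding is_limit_def by blast
    then obtain H where H: "H \<in> Hom (product C) ?y x"
      "\<And>j. j \<in> Obj J \<Longrightarrow> Comp (product C) ?y x (FOb D j) (c j) H = ?d j" by blast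
    have Hk: "Comp (C k) (prj k ?y) (prj k x) (prj k (FOb D j)) (prjm k (c j)) (prjm k H) = prjm k (?d j)"
      if "k \<in> I" "j \<in> Obj J" for k j
      using H product_comp_eq_iff[OF H(1) c d] that by blast
    have obD: "FOb (fctr_comp J (projection C i) D) j = prj i (FOb D j)" if "j \<in> Obj J" for j
      using that C D.maps_obj by simp
    show "\<exists>!h. h \<in> Hom (C i) y (prj i x) \<and> (\<forall>j \<in> Obj J.
       Comp (C i) y (prj i x) (FOb (fctr_comp J (projection C i) D) j) (prjm i (c j)) h = d j)"
    proof (rule ex1I[of _ "prjm i H"], intro conjI ballI)
      show "prjm i H \<in> Hom (C i) y (prj i x)" using product_homD(3)[OF H(1) i] i by simp
      fix j assume "j \<in> Obj J"
      then show "Comp (C i) y (prj i x) (FOb (fctr_comp J (projection C i) D) j) (prjm i (c j)) (prjm i H) = d j"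
        using Hk[OF i] i by (simp add: C D.maps_obj)
    next
      fix h assume h: "h \<in> Hom (C i) y (prj i x) \<and> (\<forall>j \<in> Obj J.
       Comp (C i) y (prj i x) (FOb (fctr_comp J (projection C i) D) j) (prjm i (c j)) h = d j)"
      \<comment> \<open>Replacing the component at \<open>i\<close> of the comparison arrow by a competitor \<open>h\<close> yields a
          competitor of the comparison arrow itself.\<close>
      let ?H = "tupm (\<lambda>k. if k = i then h else prjm k H)"
      have "(if k = i then h else prjm k H) \<in> Hom (C k) (prj k ?y) (prj k x)" if "k \<in> I" for k
        using h i product_homD(3)[OF H(1) that] that by (cases "k = i") simp_all
      then have H': "?H \<in> Hom (product C) ?y x" by (rule tupm_in_hom[OF y x])
      have "Comp (product C) ?y x (FOb D j) (c j) ?H = ?d j" if j: "j \<in> Obj J" for j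
        unfolding product_comp_eq_iff[OF H' c[OF j] d[OF j]]
      proof
        fix k assume k: "k \<in> I"
        show "Comp (C k) (prj k ?y) (prj k x) (prj k (FOb D j)) (prjm k (c j)) (prjm k ?H) = prjm k (?d j)"
          using Hk[OF k j] h i j k obD by (cases "k = i") auto
      qed
      then have "?H = H" using ex H H' by blast
      then show "h = prjm i H" using i prjm_tupm[OF i, of "\<lambda>k. if k = i then h else prjm k H"] by simp
    qed
  qed
qed

lemma has_finite_limits_product:
  assumes "\<And>i. i \<in> I \<Longrightarrow> has_finite_limits (C i)"
  shows "has_finite_limits (product C)"
  unfolding has_finite_limits_def
proof (intro allI impI, elim conjE)
  fix J :: "(nat, nat) cat" and D assume J: "finite_cat J" and D: "is_functor J (product C) D"
  interpret D: is_functor J "product C" D by fact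
  have "\<exists>x c. is_limit (C i) J (fctr_comp J (projection C i) D) x c" if i: "i \<in> I" for i
    using assms[OF i] J is_functor_comp[OF D is_functor_projection[OF i]]
    unfolding has_finite_limits_def by blast
  then obtain x c where L: "\<And>i. i \<in> I \<Longrightarrow> is_limit (C i) J (fctr_comp J (projection C i) D) (x i) (c i)"
    by metis
  then have x: "\<And>i. i \<in> I \<Longrightarrow> x i \<in> Obj (C i)"
    and c: "\<And>i j. \<lbrakk>i \<in> I; j \<in> Obj J\<rbrakk> \<Longrightarrow> c i j \<in> Hom (C i) (x i) (prj i (FOb D j))"
    using C D.maps_obj by (auto simp: is_limit_def is_cone_def)
  have "is_limit (product C) J D (tup x) (\<lambda>j. tupm (\<lambda>i. c i j))"
    by (rule product_limitI[OF D])
      (use x c L D.maps_obj in \<open>auto intro!: tupm_in_hom cong: is_limit_cong\<close>)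
  then show "\<exists>x c. is_limit (product C) J D x c" by blast
qed

lemma is_terminal_product:
  assumes "\<And>i. i \<in> I \<Longrightarrow> is_terminal (C i) (t i)"
  shows "is_terminal (product C) (tup t)"
  unfolding is_terminal_def
proof (intro conjI ballI)
  show t: "tup t \<in> Obj (product C)" using assms by (simp add: is_terminal_def)
  fix x assume x: "x \<in> Obj (product C)"
  have ex: "\<exists>!f. f \<in> Hom (C i) (prj i x) (t i)" if "i \<in> I" for i
    using assms[OF that] product_objD(2)[OF x that] by (simp add: is_terminal_def)
  then obtain f where f: "\<And>i. i \<in> I \<Longrightarrow> f i \<in> Hom (C i) (prj i x) (t i)" by metis
  have F: "tupm f \<in> Hom (product C) x (tup t)" using f by (intro tupm_in_hom[OF x t]) simp
  show "\<exists>!f. f \<in> Hom (product C) x (tup t)"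
  proof (intro ex1I[of _ "tupm f"] F)
    fix g assume g: "g \<in> Hom (product C) x (tup t)"
    show "g = tupm f"
    proof (rule product_hom_eqI[OF g F])
      fix i assume i: "i \<in> I"
      then show "prjm i g = prjm i (tupm f)"
        using ex[OF i] f[OF i] product_homD(3)[OF g i] by auto
    qed
  qed
qed

lemma preserves_finite_limits_projection:
  assumes i: "i \<in> I"
  shows "preserves_finite_limits (product C) (C i) (projection C i)"
  unfolding preserves_finite_limits_def
proof (intro allI impI, elim conjE)
  fix J :: "(nat, nat) cat" and D x c
  assume D: "is_functor J (product C) D" and L: "is_limit (product C) J D x c"
  then have "x \<in> Obj (product C)" "\<And>j. j \<in> Obj J \<Longrightarrow> c j \<in> Hom (product C) x (FOb D j)"
    by (simp_all add: is_limit_def is_cone_def)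
  then show "is_limit (C i) J (fctr_comp J (projection C i) D) (FOb (projection C i) x)
       (\<lambda>j. FAr (projection C i) x (FOb D j) (c j))"
    using product_limitD[OF D L i] C by (simp cong: is_limit_cong)
qed

lemma preserves_finite_limits_pairing:
  assumes B: "category B" and F: "\<And>i. i \<in> I \<Longrightarrow> is_functor B (C i) (F i)"
    and pF: "\<And>i. i \<in> I \<Longrightarrow> preserves_finite_limits B (C i) (F i)"
  shows "preserves_finite_limits B (product C) (pairing B F)"
  unfolding preserves_finite_limits_def
proof (intro allI impI, elim conjE)
  fix J :: "(nat, nat) cat" and D x c
  assume J: "finite_cat J" and D: "is_functor J B D" and L: "is_limit B J D x c"
  have PF: "is_functor B (product C) (pairing B F)" using B F by (rule is_functor_pairing)
  have x: "x \<in> Obj B" and c: "\<And>j. j \<in> Obj J \<Longrightarrow> c j \<in> Hom B x (FOb D j)"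
    using L by (simp_all add: is_limit_def is_cone_def)
  show "is_limit (product C) J (fctr_comp J (pairing B F) D) (FOb (pairing B F) x)
     (\<lambda>j. FAr (pairing B F) x (FOb D j) (c j))"
  proof (rule product_limitI[OF is_functor_comp[OF D PF]])
    show "FOb (pairing B F) x \<in> Obj (product C)" by (rule is_functor.maps_obj[OF PF x])
    show "FAr (pairing B F) x (FOb D j) (c j) \<in> Hom (product C) (FOb (pairing B F) x)
        (FOb (fctr_comp J (pairing B F) D) j)" if "j \<in> Obj J" for j
      using is_functor.maps_hom[OF PF c[OF that]] that by simp
    fix i assume i: "i \<in> I"
    have "fctr_comp J (projection C i) (fctr_comp J (pairing B F) D) =
      fctr_comp J (fctr_comp B (projection C i) (pairing B F)) D"
      by (rule fctr_comp_assoc[OF D PF, symmetric])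
    also have "\<dots> = fctr_comp J (F i) D"
      using projection_pairing[of B F i] B F i by simp
    finally have eq: "fctr_comp J (projection C i) (fctr_comp J (pairing B F) D) = fctr_comp J (F i) D" .
    have "is_limit (C i) J (fctr_comp J (F i) D) (FOb (F i) x) (\<lambda>j. FAr (F i) x (FOb D j) (c j))"
      using pF[OF i] J D L unfolding preserves_finite_limits_def by blast
    then show "is_limit (C i) J (fctr_comp J (projection C i) (fctr_comp J (pairing B F) D))
         (prj i (FOb (pairing B F) x)) (\<lambda>j. prjm i (FAr (pairing B F) x (FOb D j) (c j)))"
      unfolding eq using x c i B C by (simp cong: is_limit_cong)
  qed
qed

text \<open>The projections preserve finite limits, and hence pullbacks.\<close>

lemma product_pullbackD:
  assumes "is_pullback (product C) p x y z p1 p2 r l" and i: "i \<in> I"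
  shows "is_pullback (C i) (prj i p) (prj i x) (prj i y) (prj i z)
    (prjm i p1) (prjm i p2) (prjm i r) (prjm i l)"
proof -
  have h: "p1 \<in> Hom (product C) p x" "p2 \<in> Hom (product C) p y"
    "r \<in> Hom (product C) x z" "l \<in> Hom (product C) y z"
    using assms(1) by (simp_all add: is_pullback_def)
  show ?thesis
    using preserves_pullback[OF is_functor_projection[OF i] preserves_finite_limits_projection[OF i] assms(1)]
      product_homD(1,2)[OF h(1)] product_homD(1,2)[OF h(2)] product_homD(1,2)[OF h(3)] h C
    by simp
qed

lemma product_pullbackI:
  assumes h: "p1 \<in> Hom (product C) p x" "p2 \<in> Hom (product C) p y"
    "r \<in> Hom (product C) x z" "l \<in> Hom (product C) y z"
    and P: "\<And>i. i \<in> I \<Longrightarrow> is_pullback (C i) (prj i p) (prj i x) (prj i y) (prj i z)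
      (prjm i p1) (prjm i p2) (prjm i r) (prjm i l)"
  shows "is_pullback (product C) p x y z p1 p2 r l"
proof -
  note PC = category_prod
  let ?c = "\<lambda>i :: nat. if i = 0 then p1 else if i = 1 then p2 else Comp (product C) p x z r p1"
  have rp: "Comp (product C) p x z r p1 \<in> Hom (product C) p z" by (rule category.comp_in_hom[OF PC h(1,3)])
  have "is_limit (product C) cospan (cospan_diagram (product C) x y z r l) p ?c"
  proof (rule product_limitI[OF is_functor_cospan_diagram[OF PC h(3,4)] product_homD(1)[OF h(1)]])
    fix j assume "j \<in> Obj cospan"
    then show "?c j \<in> Hom (product C) p (FOb (cospan_diagram (product C) x y z r l) j)"
      using h rp by auto
  next
    fix i assume i: "i \<in> I"
    have "is_limit (C i) cospan (cospan_diagram (C i) (prj i x) (prj i y) (prj i z) (prjm i r) (prjm i l))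
      (prj i p) (\<lambda>j. prjm i (?c j))"
      using P[OF i] is_pullback_iff_limit[OF C[OF i] product_homD(3)[OF h(3) i] product_homD(3)[OF h(4) i],
         of "\<lambda>j. prjm i (?c j)"] i h by simp
    then show "is_limit (C i) cospan (fctr_comp cospan (projection C i) (cospan_diagram (product C) x y z r l))
      (prj i p) (\<lambda>j. prjm i (?c j))"
      using fctr_comp_cospan_diagram[OF is_functor_projection[OF i] h(3,4)]
        product_homD(1,2)[OF h(3)] product_homD(1,2)[OF h(4)] h C by simp
  qed
  then show ?thesis using is_pullback_iff_limit[OF PC h(3,4), of ?c] by simp
qed

end

section \<open>The 2-categories of lex categories and of adequate triples\<close>

lemma structured_Lex:
  "structured {(C :: ('o, 'm) cat, t). category C \<and> has_finite_limits C \<and> is_terminal C t} fst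
     (\<lambda>(C, _) (D, _). {F. preserves_finite_limits C D F})"
  by unfold_locales
    (auto simp: preserves_finite_limits_id preserves_finite_limits_comp category_def
      intro: preserves_finite_limits_id preserves_finite_limits_comp)

lemma Lex_Ob: "a \<in> Ob Lex \<longleftrightarrow> category (fst a) \<and> has_finite_limits (fst a) \<and> is_terminal (fst a) (snd a)"
  by (cases a) (simp add: Lex_def)

lemma Lex_HomCat: "HomCat Lex a b = functor_cat (fst a) (fst b) {F. preserves_finite_limits (fst a) (fst b) F}"
  by (cases a; cases b) (simp add: Lex_def)

lemma Lex_Id1: "Id1 Lex a = id_fctr (fst a)" by (cases a) (simp add: Lex_def)

lemma Lex_comp1:
  "\<lbrakk>F \<in> Obj (HomCat Lex a b); G \<in> Obj (HomCat Lex b c)\<rbrakk> \<Longrightarrow> comp1 Lex a b c G F = fctr_comp (fst a) G F"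
  by (cases a; cases b; cases c) (simp add: Lex_def)

lemma Lex_hcomp:
  "\<lbrakk>\<alpha> \<in> Hom (HomCat Lex a b) F F'; \<beta> \<in> Hom (HomCat Lex b c) G G'\<rbrakk> \<Longrightarrow>
    hcomp Lex a b c G G' F F' \<beta> \<alpha> = hcomp_trans (fst a) (fst c) G G' F F' \<beta> \<alpha>"
  by (cases a; cases b; cases c) (simp add: Lex_def)

lemma two_category_Lex: "two_category Lex"
  unfolding Lex_def by (rule structured.two_category[OF structured_Lex])

lemma wide_classD:
  assumes "category C" "wide_class C L" "f \<in> L x y"
  shows "f \<in> Hom C x y" "x \<in> Obj C" "y \<in> Obj C"
proof -
  show "f \<in> Hom C x y" using assms(2,3) by (auto simp: wide_class_def)
  then show "x \<in> Obj C" "y \<in> Obj C" using category.hom_obj[OF assms(1)] by simp_all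
qed

lemma is_pullback_hom:
  assumes "category C" "is_pullback C p x y z p1 p2 r l"
  shows "p1 \<in> Hom C p x" "p2 \<in> Hom C p y" "r \<in> Hom C x z" "l \<in> Hom C y z"
    "p \<in> Obj C" "x \<in> Obj C" "y \<in> Obj C" "z \<in> Obj C"
proof -
  show h: "p1 \<in> Hom C p x" "p2 \<in> Hom C p y" "r \<in> Hom C x z" "l \<in> Hom C y z"
    using assms(2) by (simp_all add: is_pullback_def)
  show "p \<in> Obj C" "x \<in> Obj C" "y \<in> Obj C" "z \<in> Obj C"
    using category.hom_obj[OF assms(1) h(1)] category.hom_obj[OF assms(1) h(3)]
      category.hom_obj[OF assms(1) h(4)] by simp_all
qed

lemma adequate_triple_iff:
  "adequate_triple A \<longleftrightarrow> category (fst A) \<and> wide_class (fst A) (fst (snd A)) \<and> wide_class (fst A) (snd (snd A)) \<and>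
     (\<forall>x y z. \<forall>r \<in> snd (snd A) x z. \<forall>l \<in> fst (snd A) y z.
        (\<exists>p p1 p2. is_pullback (fst A) p x y z p1 p2 r l) \<and>
        (\<forall>p p1 p2. is_pullback (fst A) p x y z p1 p2 r l \<longrightarrow>
           p1 \<in> fst (snd A) p x \<and> p2 \<in> snd (snd A) p y))"
  by (simp only: adequate_triple_def case_prod_beta)

lemma adequate_tripleD:
  assumes "adequate_triple A"
  shows "category (fst A)" "wide_class (fst A) (fst (snd A))" "wide_class (fst A) (snd (snd A))"
    "\<lbrakk>r \<in> snd (snd A) x z; l \<in> fst (snd A) y z\<rbrakk> \<Longrightarrow> \<exists>p p1 p2. is_pullback (fst A) p x y z p1 p2 r l"
    "\<lbrakk>r \<in> snd (snd A) x z; l \<in> fst (snd A) y z; is_pullback (fst A) p x y z p1 p2 r l\<rbrakk> \<Longrightarrow>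
      p1 \<in> fst (snd A) p x \<and> p2 \<in> snd (snd A) p y"
  using assms unfolding adequate_triple_iff by blast+

lemma triple_mapI:
  assumes "\<And>x y f. f \<in> fst (snd A) x y \<Longrightarrow> FAr F x y f \<in> fst (snd B) (FOb F x) (FOb F y)"
    and "\<And>x y f. f \<in> snd (snd A) x y \<Longrightarrow> FAr F x y f \<in> snd (snd B) (FOb F x) (FOb F y)"
    and "\<And>p x y z p1 p2 r l. \<lbrakk>r \<in> snd (snd A) x z; l \<in> fst (snd A) y z;
      is_pullback (fst A) p x y z p1 p2 r l\<rbrakk> \<Longrightarrow>
      is_pullback (fst B) (FOb F p) (FOb F x) (FOb F y) (FOb F z)
        (FAr F p x p1) (FAr F p y p2) (FAr F x z r) (FAr F y z l)"
  shows "triple_map A B F"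
  using assms by (simp add: triple_map_def case_prod_beta)

lemma triple_mapD:
  assumes "triple_map A B F"
  shows "f \<in> fst (snd A) x y \<Longrightarrow> FAr F x y f \<in> fst (snd B) (FOb F x) (FOb F y)"
    and "f \<in> snd (snd A) x y \<Longrightarrow> FAr F x y f \<in> snd (snd B) (FOb F x) (FOb F y)"
    and "\<lbrakk>r \<in> snd (snd A) x z; l \<in> fst (snd A) y z;
      is_pullback (fst A) p x y z p1 p2 r l\<rbrakk> \<Longrightarrow>
      is_pullback (fst B) (FOb F p) (FOb F x) (FOb F y) (FOb F z)
        (FAr F p x p1) (FAr F p y p2) (FAr F x z r) (FAr F y z l)"
  using assms by (simp_all add: triple_map_def case_prod_beta)

lemma structured_AdTr:
  "structured {A :: ('o, 'm) triple. adequate_triple A} fst (\<lambda>A B. {F. triple_map A B F})"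
proof (rule structured.intro, goal_cases)
  case (1 A) then show ?case by (auto simp: adequate_triple_def)
next
  case (2 A)
  then have "adequate_triple A" by simp
  note C = adequate_tripleD(1)[OF this] and L = wide_classD[OF adequate_tripleD(1,2)[OF this]]
    and R = wide_classD[OF adequate_tripleD(1,3)[OF this]]
  have "triple_map A A (id_fctr (fst A))"
  proof (rule triple_mapI, goal_cases)
    case (3 p x y z p1 p2 r l)
    then show ?case using is_pullback_hom[OF C 3(3)] C by simp
  qed (use C L R in simp_all)
  then show ?case by simp
next
  case (3 A B E F G)
  then have A: "adequate_triple A" and F: "triple_map A B F" and G: "triple_map B E G" by simp_all
  note C = adequate_tripleD(1)[OF A] and L = wide_classD[OF adequate_tripleD(1,2)[OF A]]
    and R = wide_classD[OF adequate_tripleD(1,3)[OF A]]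
  have "triple_map A E (fctr_comp (fst A) G F)"
  proof (rule triple_mapI, goal_cases)
    case (3 p x y z p1 p2 r l)
    show ?case
      using triple_mapD(3)[OF G triple_mapD(2)[OF F 3(1)] triple_mapD(1)[OF F 3(2)] triple_mapD(3)[OF F 3]]
        is_pullback_hom[OF C 3(3)] C by simp
  qed (use C L R triple_mapD[OF F] triple_mapD[OF G] in simp_all)
  then show ?case by simp
qed

lemma AdTr_simps [simp]:
  "A \<in> Ob AdTr \<longleftrightarrow> adequate_triple A"
  "Id1 AdTr A = id_fctr (fst A)"
  by (simp_all add: AdTr_def)

lemma HomCat_AdTr: "HomCat AdTr A B = functor_cat (fst A) (fst B) {F. triple_map A B F}"
  by (simp add: AdTr_def)

lemma AdTr_comp1:
  "\<lbrakk>F \<in> Obj (HomCat AdTr A B); G \<in> Obj (HomCat AdTr B E)\<rbrakk> \<Longrightarrow> comp1 AdTr A B E G F = fctr_comp (fst A) G F"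
  by (simp add: AdTr_def)

lemma AdTr_hcomp:
  "\<lbrakk>\<alpha> \<in> Hom (HomCat AdTr A B) F F'; \<beta> \<in> Hom (HomCat AdTr B E) G G'\<rbrakk> \<Longrightarrow>
    hcomp AdTr A B E G G' F F' \<beta> \<alpha> = hcomp_trans (fst A) (fst E) G G' F F' \<beta> \<alpha>"
  by (simp add: AdTr_def)

lemma two_category_AdTr: "two_category AdTr"
  unfolding AdTr_def by (rule structured.two_category[OF structured_AdTr])

context tupling
begin

text \<open>Finite limits, terminal objects and preservation of limits are all componentwise, so that the
  product category with the tuple of the chosen terminal objects is the 2-product.\<close>

lemma Lex_2product:
  assumes "\<And>i. i \<in> I \<Longrightarrow> A i \<in> Ob Lex"
  shows "is_2product Lex I A (product (\<lambda>i. fst (A i)), tup (\<lambda>i. snd (A i))) (projection (\<lambda>i. fst (A i)))"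
    and "(product (\<lambda>i. fst (A i)), tup (\<lambda>i. snd (A i))) \<in> Ob Lex"
proof -
  have A: "category (fst (A i)) \<and> has_finite_limits (fst (A i)) \<and> is_terminal (fst (A i)) (snd (A i))"
    if "i \<in> I" for i
    using assms[OF that] by (simp add: Lex_Ob)
  interpret P: category_family I tup prj tupm prjm "\<lambda>i. fst (A i)"
    using tupling_axioms A by (simp add: category_family_def category_family_axioms_def)
  have p: "category (product (\<lambda>i. fst (A i))) \<and> has_finite_limits (product (\<lambda>i. fst (A i))) \<and>
      is_terminal (product (\<lambda>i. fst (A i))) (tup (\<lambda>i. snd (A i)))"
    using A by (simp add: P.category_prod P.has_finite_limits_product P.is_terminal_product)
  then show "(product (\<lambda>i. fst (A i)), tup (\<lambda>i. snd (A i))) \<in> Ob Lex" by (simp add: Lex_Ob)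
  show "is_2product Lex I A (product (\<lambda>i. fst (A i)), tup (\<lambda>i. snd (A i))) (projection (\<lambda>i. fst (A i)))"
    unfolding Lex_def
  proof (rule structured_2product[OF structured_Lex], goal_cases)
    case (1 i) then show ?case using A by (simp add: case_prod_beta)
  next
    case (4 i) then show ?case
      using P.preserves_finite_limits_projection[OF 4] by (simp add: case_prod_beta)
  next
    case (5 x F)
    then have "preserves_finite_limits (fst x) (product (\<lambda>i. fst (A i))) (pairing (fst x) F)"
      by (intro P.preserves_finite_limits_pairing) (simp_all add: case_prod_beta)
    then show ?case by (simp add: case_prod_beta)
  qed (use p in auto)
qed

definition product_class ::
  "('i \<Rightarrow> ('o, 'm) cat) \<Rightarrow> ('i \<Rightarrow> ('o, 'm) arrow_class) \<Rightarrow> ('o, 'm) arrow_class" where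
  "product_class C L = (\<lambda>x y. {f \<in> Hom (product C) x y. \<forall>i \<in> I. prjm i f \<in> L i (prj i x) (prj i y)})"

definition product_triple :: "('i \<Rightarrow> ('o, 'm) triple) \<Rightarrow> ('o, 'm) triple" where
  "product_triple A = (product (\<lambda>i. fst (A i)),
     (product_class (\<lambda>i. fst (A i)) (\<lambda>i. fst (snd (A i))),
      product_class (\<lambda>i. fst (A i)) (\<lambda>i. snd (snd (A i)))))"

text \<open>The two componentwise constructions agree on the nose: the product of the triples with all
  arrows consists of the product category with all arrows.\<close>

lemma product_all_triple: "product_triple (\<lambda>i. all_triple (C i)) = all_triple (product C)"
  by (auto simp: product_triple_def all_triple_def product_class_def fun_eq_iff product_hom_iff)

end

context category_family
begin

lemma wide_product_class:
  assumes "\<And>i. i \<in> I \<Longrightarrow> wide_class (C i) (L i)"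
  shows "wide_class (product C) (product_class C L)"
  using assms category.ident_in_hom[OF category_prod] category.comp_in_hom[OF category_prod]
    product_objD(2)
  by (simp add: wide_class_def product_class_def)

lemma product_pullback_exists:
  assumes rl: "r \<in> Hom (product C) x z" "l \<in> Hom (product C) y z"
    and ex: "\<And>i. i \<in> I \<Longrightarrow> \<exists>p p1 p2. is_pullback (C i) p (prj i x) (prj i y) (prj i z) p1 p2 (prjm i r) (prjm i l)"
  shows "\<exists>p p1 p2. is_pullback (product C) p x y z p1 p2 r l"
proof -
  obtain p p1 p2 where P: "\<And>i. i \<in> I \<Longrightarrow>
      is_pullback (C i) (p i) (prj i x) (prj i y) (prj i z) (p1 i) (p2 i) (prjm i r) (prjm i l)"
    using ex by metis
  have h: "p1 i \<in> Hom (C i) (p i) (prj i x)" "p2 i \<in> Hom (C i) (p i) (prj i y)" "p i \<in> Obj (C i)"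
    if "i \<in> I" for i
    using P[OF that] category.hom_obj[OF C[OF that]] unfolding is_pullback_def by blast+
  have "tup p \<in> Obj (product C)" using h by simp
  then have "is_pullback (product C) (tup p) x y z (tupm p1) (tupm p2) r l"
    using h P rl product_homD(1)[OF rl(1)] product_homD(1)[OF rl(2)]
    by (intro product_pullbackI) (auto intro!: tupm_in_hom)
  then show ?thesis by blast
qed

end

context tupling
begin

text \<open>Since a square in the product is a pullback if and only if all its components are, both conditions on
  \<open>L\<close>-\<open>R\<close> pullbacks are inherited from the factors.\<close>

lemma adequate_product_triple:
  assumes A: "\<And>i. i \<in> I \<Longrightarrow> adequate_triple (A i)"
  shows "adequate_triple (product_triple A)"
proof -
  let ?C = "\<lambda>i. fst (A i)" and ?L = "\<lambda>i. fst (snd (A i))" and ?R = "\<lambda>i. snd (snd (A i))"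
  have A': "category (?C i)" "wide_class (?C i) (?L i)" "wide_class (?C i) (?R i)"
    "\<And>x y z r l. \<lbrakk>r \<in> ?R i x z; l \<in> ?L i y z\<rbrakk> \<Longrightarrow> \<exists>p p1 p2. is_pullback (?C i) p x y z p1 p2 r l"
    "\<And>x y z r l p p1 p2. \<lbrakk>r \<in> ?R i x z; l \<in> ?L i y z; is_pullback (?C i) p x y z p1 p2 r l\<rbrakk> \<Longrightarrow>
      p1 \<in> ?L i p x \<and> p2 \<in> ?R i p y" if "i \<in> I" for i
    using adequate_tripleD[OF A[OF that]] by blast+
  interpret P: category_family I tup prj tupm prjm ?C
    using tupling_axioms A'(1) by (simp add: category_family_def category_family_axioms_def)
  have "\<exists>p p1 p2. is_pullback (product ?C) p x y z p1 p2 r l"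
    if "r \<in> product_class ?C ?R x z" "l \<in> product_class ?C ?L y z" for x y z r l
    by (rule P.product_pullback_exists) (use that A'(4) in \<open>auto simp: product_class_def\<close>)
  moreover have "p1 \<in> product_class ?C ?L p x \<and> p2 \<in> product_class ?C ?R p y"
    if rl: "r \<in> product_class ?C ?R x z" "l \<in> product_class ?C ?L y z"
      and P: "is_pullback (product ?C) p x y z p1 p2 r l" for x y z r l p p1 p2
  proof -
    have "prjm i p1 \<in> ?L i (prj i p) (prj i x) \<and> prjm i p2 \<in> ?R i (prj i p) (prj i y)" if i: "i \<in> I" for i
      using A'(5)[OF i _ _ P.product_pullbackD[OF P i]] rl i by (simp add: product_class_def)
    then show ?thesis using P by (simp add: product_class_def is_pullback_def)
  qed
  ultimately show ?thesis
    unfolding adequate_triple_iff product_triple_def fst_conv snd_conv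
    using P.category_prod P.wide_product_class[OF A'(2)] P.wide_product_class[OF A'(3)] by blast
qed

lemma triple_map_projection:
  assumes A: "\<And>i. i \<in> I \<Longrightarrow> adequate_triple (A i)" and i: "i \<in> I"
  shows "triple_map (product_triple A) (A i) (projection (\<lambda>i. fst (A i)) i)"
proof -
  let ?C = "\<lambda>i. fst (A i)"
  interpret P: category_family I tup prj tupm prjm ?C
    using tupling_axioms A by (simp add: category_family_def category_family_axioms_def adequate_tripleD(1))
  have "is_pullback (?C i) (FOb (projection ?C i) p) (FOb (projection ?C i) x) (FOb (projection ?C i) y)
      (FOb (projection ?C i) z) (FAr (projection ?C i) p x p1) (FAr (projection ?C i) p y p2)
      (FAr (projection ?C i) x z r) (FAr (projection ?C i) y z l)"
    if "is_pullback (product ?C) p x y z p1 p2 r l" for p x y z p1 p2 r l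
    using preserves_pullback[OF P.is_functor_projection[OF i] P.preserves_finite_limits_projection[OF i] that] .
  moreover have "FAr (projection ?C i) x y f \<in> L i (FOb (projection ?C i) x) (FOb (projection ?C i) y)"
    if "f \<in> product_class ?C L x y" for L x y f
    using that i product_homD(1,2)[of f ?C x y] by (simp add: product_class_def)
  ultimately show ?thesis
    by (intro triple_mapI) (simp_all add: product_triple_def)
qed

lemma triple_map_pairing:
  assumes A: "\<And>i. i \<in> I \<Longrightarrow> adequate_triple (A i)" and B: "adequate_triple B"
    and F: "\<And>i. i \<in> I \<Longrightarrow> is_functor (fst B) (fst (A i)) (F i)"
    and tF: "\<And>i. i \<in> I \<Longrightarrow> triple_map B (A i) (F i)"
  shows "triple_map B (product_triple A) (pairing (fst B) F)"
proof -
  let ?C = "\<lambda>i. fst (A i)"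
  interpret P: category_family I tup prj tupm prjm ?C
    using tupling_axioms A by (simp add: category_family_def category_family_axioms_def adequate_tripleD(1))
  let ?D = "fst B" and ?L = "fst (snd B)" and ?R = "snd (snd B)"
  note D = adequate_tripleD(1)[OF B] and L = wide_classD[OF adequate_tripleD(1,2)[OF B]]
    and R = wide_classD[OF adequate_tripleD(1,3)[OF B]]
  have PF: "is_functor ?D (product ?C) (pairing ?D F)"
    using F by (intro P.is_functor_pairing D)
  let ?F = "pairing ?D F"
  have cls: "FAr ?F x y f \<in> product_class ?C M (FOb ?F x) (FOb ?F y)"
    if "f \<in> Hom ?D x y" "\<And>i. i \<in> I \<Longrightarrow> FAr (F i) x y f \<in> M i (FOb (F i) x) (FOb (F i) y)" for f x y M
    using that category.hom_obj[OF D that(1)] D is_functor.maps_hom[OF PF that(1)]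
    by (simp add: product_class_def)
  show ?thesis
  proof (rule triple_mapI, goal_cases)
    case (1 x y f)
    then show ?case using cls[OF L(1)[OF 1]] triple_mapD(1)[OF tF 1] by (simp add: product_triple_def)
  next
    case (2 x y f)
    then show ?case using cls[OF R(1)[OF 2]] triple_mapD(2)[OF tF 2] by (simp add: product_triple_def)
  next
    case (3 p x y z p1 p2 r l)
    note m = is_pullback_hom[OF D 3(3)]
    have "is_pullback (product ?C) (FOb ?F p) (FOb ?F x) (FOb ?F y) (FOb ?F z)
      (FAr ?F p x p1) (FAr ?F p y p2) (FAr ?F x z r) (FAr ?F y z l)"
      by (rule P.product_pullbackI)
        (use m triple_mapD(3)[OF tF 3] D is_functor.maps_hom[OF PF m(1)] is_functor.maps_hom[OF PF m(2)]
           is_functor.maps_hom[OF PF m(3)] is_functor.maps_hom[OF PF m(4)] in simp_all)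
    then show ?case by (simp add: product_triple_def)
  qed
qed

lemma AdTr_2product:
  assumes A: "\<And>i. i \<in> I \<Longrightarrow> A i \<in> Ob AdTr"
  shows "is_2product AdTr I A (product_triple A) (projection (\<lambda>i. fst (A i)))"
  unfolding AdTr_def
proof (rule structured_2product[OF structured_AdTr], goal_cases)
  case 2 then show ?case using A by (simp add: adequate_product_triple)
next
  case 3 show ?case by (simp add: product_triple_def)
next
  case (4 i) then show ?case using A by (simp add: triple_map_projection)
next
  case (5 x F) then show ?case using A by (simp add: triple_map_pairing)
qed (use A in auto)

end

lemma cartesian_AdTr:
  assumes "infinite (UNIV :: 'o set)" "infinite (UNIV :: 'm set)"
  shows "cartesian_2category (AdTr :: (('o, 'm) triple, _, _) tcat)"
  unfolding cartesian_2category_def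
proof (intro conjI allI impI)
  fix I :: "nat set" and A :: "nat \<Rightarrow> ('o, 'm) triple"
  assume "finite I \<and> (\<forall>i \<in> I. A i \<in> Ob AdTr)"
  then have I: "finite I" and A: "\<forall>i \<in> I. A i \<in> Ob AdTr" by simp_all
  obtain tup :: "(nat \<Rightarrow> 'o) \<Rightarrow> 'o" and prj and tupm :: "(nat \<Rightarrow> 'm) \<Rightarrow> 'm" and prjm
    where "tupling I tup prj tupm prjm" using tupling_exists[OF I assms] by blast
  then show "\<exists>p pr. is_2product AdTr I A p pr" using tupling.AdTr_2product A by blast
qed (rule two_category_AdTr)

section \<open>The 2-category of pointed adequate triples\<close>

lemma is_iso_ident: "\<lbrakk>category C; x \<in> Obj C\<rbrakk> \<Longrightarrow> is_iso C x x (Ident C x)"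
  unfolding is_iso_def
  by (intro conjI bexI[of _ "Ident C x"]) (simp_all add: category.ident_in_hom category.comp_ident_left)

lemma is_iso_comp:
  assumes "category C" and f: "is_iso C x y f" and g: "is_iso C y z g"
  shows "is_iso C x z (Comp C x y z g f)"
proof -
  interpret category C by fact
  obtain f' where f': "f' \<in> Hom C y x" "Comp C x y x f' f = Ident C x" "Comp C y x y f f' = Ident C y"
    using f by (auto simp: is_iso_def)
  obtain g' where g': "g' \<in> Hom C z y" "Comp C y z y g' g = Ident C y" "Comp C z y z g g' = Ident C z"
    using g by (auto simp: is_iso_def)
  have h: "f \<in> Hom C x y" "g \<in> Hom C y z" using f g by (simp_all add: is_iso_def)
  let ?k = "Comp C z y x f' g'"
  have "Comp C x z x ?k (Comp C x y z g f) = Ident C x"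
    using comp_assoc[OF comp_in_hom[OF h] g'(1) f'(1)] comp_assoc[OF h g'(1)] g' f' comp_ident_left[OF h(1)]
    by simp
  moreover have "Comp C z x z (Comp C x y z g f) ?k = Ident C z"
    using comp_assoc[OF comp_in_hom[OF g'(1) f'(1)] h] comp_assoc[OF g'(1) f'(1) h(1)] g' f' comp_ident_left[OF g'(1)]
    by simp
  ultimately show ?thesis
    unfolding is_iso_def using comp_in_hom[OF h] comp_in_hom[OF g'(1) f'(1)] by blast
qed

lemma is_iso_functor:
  assumes "is_functor C D F" and f: "is_iso C x y f"
  shows "is_iso D (FOb F x) (FOb F y) (FAr F x y f)"
proof -
  interpret F: is_functor C D F by fact
  obtain g where g: "g \<in> Hom C y x" "Comp C x y x g f = Ident C x" "Comp C y x y f g = Ident C y"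
    using f by (auto simp: is_iso_def)
  have h: "f \<in> Hom C x y" using f by (simp add: is_iso_def)
  show ?thesis unfolding is_iso_def
    using F.maps_hom[OF h] F.maps_hom[OF g(1)] F.maps_comp[OF h g(1)] F.maps_comp[OF g(1) h] g
      F.maps_ident F.dom.hom_obj[OF h] by auto
qed

text \<open>The definition of \<open>pointed_cells\<close>, in terms of the components of pairs: the case distinctions in
  its original form would force all objects and 1-cells to be split.\<close>

lemma pointed_cells_Obj:
  "f \<in> Obj (pointed_cells a b) \<longleftrightarrow> fst f \<in> Obj (HomCat AdTr (fst a) (fst b)) \<and>
     is_iso (fst (fst b)) (FOb (fst f) (snd a)) (snd b) (snd f) \<and>
     snd f \<in> fst (snd (fst b)) (FOb (fst f) (snd a)) (snd b)"
  by (auto simp: pointed_cells_def case_prod_unfold)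

lemma pointed_cells_Hom:
  "\<alpha> \<in> Hom (pointed_cells a b) f g \<longleftrightarrow> f \<in> Obj (pointed_cells a b) \<and> g \<in> Obj (pointed_cells a b) \<and>
     \<alpha> \<in> Hom (HomCat AdTr (fst a) (fst b)) (fst f) (fst g) \<and>
     Comp (fst (fst b)) (FOb (fst f) (snd a)) (FOb (fst g) (snd a)) (snd b) (snd g) (\<alpha> (snd a)) = snd f"
  by (auto simp: pointed_cells_def case_prod_unfold)

lemma pointed_cells_Ident:
  "f \<in> Obj (pointed_cells a b) \<Longrightarrow> Ident (pointed_cells a b) f = Ident (HomCat AdTr (fst a) (fst b)) (fst f)"
  by (auto simp: pointed_cells_def case_prod_unfold)

lemma pointed_cells_Comp:
  "\<lbrakk>\<alpha> \<in> Hom (pointed_cells a b) f g; \<beta> \<in> Hom (pointed_cells a b) g h\<rbrakk> \<Longrightarrow>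
    Comp (pointed_cells a b) f g h \<beta> \<alpha> = Comp (HomCat AdTr (fst a) (fst b)) (fst f) (fst g) (fst h) \<beta> \<alpha>"
  by (auto simp: pointed_cells_def case_prod_unfold split: if_split_asm)

lemma AdTr_pt_Ob: "a \<in> Ob AdTr_pt \<longleftrightarrow> adequate_triple (fst a) \<and> snd a \<in> Obj (fst (fst a))"
  by (auto simp: AdTr_pt_def)

lemma AdTr_pt_simps [simp]:
  "HomCat AdTr_pt = pointed_cells"
  "Id1 AdTr_pt a = (id_fctr (fst (fst a)), Ident (fst (fst a)) (snd a))"
  by (simp_all add: AdTr_pt_def case_prod_beta)

lemma pointed_cells_make_cat:
  "pointed_cells a b = make_cat (Obj (pointed_cells a b))
    (\<lambda>f g. {\<alpha> \<in> Hom (HomCat AdTr (fst a) (fst b)) (fst f) (fst g).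
       Comp (fst (fst b)) (FOb (fst f) (snd a)) (FOb (fst g) (snd a)) (snd b) (snd g) (\<alpha> (snd a)) = snd f})
    (\<lambda>f. Ident (HomCat AdTr (fst a) (fst b)) (fst f))
    (\<lambda>f g h \<beta> \<alpha>. Comp (HomCat AdTr (fst a) (fst b)) (fst f) (fst g) (fst h) \<beta> \<alpha>)"
  by (simp add: pointed_cells_def case_prod_unfold)

text \<open>Compatibility with the points is stable under vertical composition; apart from this, vertical
  composition is the one of \<open>AdTr\<close>.\<close>

lemma category_pointed_cells:
  assumes a: "a \<in> Ob AdTr_pt" and b: "b \<in> Ob AdTr_pt"
  shows "category (pointed_cells a b)"
proof -
  let ?H = "HomCat AdTr (fst a) (fst b)" and ?D = "fst (fst b)"
  have c: "snd a \<in> Obj (fst (fst a))" and H: "category ?H"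
    using a b two_category.homcat[OF two_category_AdTr, of "fst a" "fst b"] by (simp_all add: AdTr_pt_Ob)
  have D: "category ?D" using b adequate_tripleD(1)[of "fst b"] by (simp add: AdTr_pt_Ob)
  show ?thesis
  proof (subst pointed_cells_make_cat, rule category_make_cat, goal_cases)
    case (1 f)
    then show ?case using c category.ident_in_hom[OF H, of "fst f"] category.comp_ident_right[OF D]
      by (simp add: pointed_cells_Obj HomCat_AdTr is_iso_def)
  next
    case (2 f g h \<alpha> \<beta>)
    then have ab: "\<alpha> \<in> Hom ?H (fst f) (fst g)" "\<beta> \<in> Hom ?H (fst g) (fst h)" by simp_all
    then have n: "\<alpha> \<in> nat_trans (fst (fst a)) ?D (fst f) (fst g)" "\<beta> \<in> nat_trans (fst (fst a)) ?D (fst g) (fst h)"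
      by (simp_all add: HomCat_AdTr)
    have "Comp ?H (fst f) (fst g) (fst h) \<beta> \<alpha> (snd a) = Comp ?D (FOb (fst f) (snd a))
        (FOb (fst g) (snd a)) (FOb (fst h) (snd a)) (\<beta> (snd a)) (\<alpha> (snd a))"
      using ab c by (simp add: HomCat_AdTr)
    moreover have m: "\<alpha> (snd a) \<in> Hom ?D (FOb (fst f) (snd a)) (FOb (fst g) (snd a))"
      "\<beta> (snd a) \<in> Hom ?D (FOb (fst g) (snd a)) (FOb (fst h) (snd a))"
      "snd h \<in> Hom ?D (FOb (fst h) (snd a)) (snd b)"
      using nat_transD(1)[OF n(1) c] nat_transD(1)[OF n(2) c] 2 by (simp_all add: pointed_cells_Obj is_iso_def)
    ultimately show ?case
      using 2 category.comp_in_hom[OF H ab] category.comp_assoc[OF D m] by simp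
  qed (simp_all add: category.comp_ident_left[OF H] category.comp_ident_right[OF H] category.comp_assoc[OF H])
qed

lemma AdTr_pt_CompF:
  "CompF AdTr_pt a b e = make_fctr (prod_cat (pointed_cells b e) (pointed_cells a b))
     (\<lambda>(g, f). (comp1 AdTr (fst a) (fst b) (fst e) (fst g) (fst f),
        Comp (fst (fst e)) (FOb (fst g) (FOb (fst f) (snd a))) (FOb (fst g) (snd b)) (snd e) (snd g)
          (FAr (fst g) (FOb (fst f) (snd a)) (snd b) (snd f))))
     (\<lambda>(g, f) (g', f') (\<beta>, \<alpha>). hcomp AdTr (fst a) (fst b) (fst e) (fst g) (fst g') (fst f) (fst f') \<beta> \<alpha>)"
  by (simp add: AdTr_pt_def case_prod_unfold)

lemma AdTr_pt_comp1:
  "\<lbrakk>f \<in> Obj (pointed_cells a b); g \<in> Obj (pointed_cells b e)\<rbrakk> \<Longrightarrow>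
    comp1 AdTr_pt a b e g f = (comp1 AdTr (fst a) (fst b) (fst e) (fst g) (fst f),
        Comp (fst (fst e)) (FOb (fst g) (FOb (fst f) (snd a))) (FOb (fst g) (snd b)) (snd e) (snd g)
          (FAr (fst g) (FOb (fst f) (snd a)) (snd b) (snd f)))"
  by (simp add: AdTr_pt_CompF)

lemma AdTr_pt_hcomp:
  "\<lbrakk>a \<in> Ob AdTr_pt; b \<in> Ob AdTr_pt; e \<in> Ob AdTr_pt;
     \<alpha> \<in> Hom (pointed_cells a b) f f'; \<beta> \<in> Hom (pointed_cells b e) g g'\<rbrakk> \<Longrightarrow>
    hcomp AdTr_pt a b e g g' f f' \<beta> \<alpha> = hcomp AdTr (fst a) (fst b) (fst e) (fst g) (fst g') (fst f) (fst f') \<beta> \<alpha>"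
  by (simp add: AdTr_pt_CompF category_prod_cat category_pointed_cells)

text \<open>Functors preserve isomorphisms, and maps of triples preserve the left class, so the isomorphism
  attached to a composite is again an isomorphism in the left class.\<close>

lemma AdTr_pt_comp1_in:
  assumes a: "a \<in> Ob AdTr_pt" "b \<in> Ob AdTr_pt" "e \<in> Ob AdTr_pt"
    and f: "f \<in> Obj (pointed_cells a b)" and g: "g \<in> Obj (pointed_cells b e)"
  shows "comp1 AdTr_pt a b e g f \<in> Obj (pointed_cells a e)"
proof -
  let ?E = "fst (fst e)" and ?L = "fst (snd (fst e))"
  let ?x = "FOb (fst g) (FOb (fst f) (snd a))" and ?u = "FAr (fst g) (FOb (fst f) (snd a)) (snd b) (snd f)"
  have E: "category ?E" "wide_class ?E ?L"
    using a(3) adequate_tripleD(1,2)[of "fst e"] by (simp_all add: AdTr_pt_Ob)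
  have fg: "fst f \<in> Obj (HomCat AdTr (fst a) (fst b))" "fst g \<in> Obj (HomCat AdTr (fst b) (fst e))"
    using f g by (simp_all add: pointed_cells_Obj)
  then have G: "is_functor (fst (fst b)) ?E (fst g)" "triple_map (fst b) (fst e) (fst g)"
    by (simp_all add: HomCat_AdTr)
  have "is_iso ?E ?x (FOb (fst g) (snd b)) ?u"
    using f by (intro is_iso_functor[OF G(1)]) (simp add: pointed_cells_Obj)
  then have "is_iso ?E ?x (snd e) (Comp ?E ?x (FOb (fst g) (snd b)) (snd e) (snd g) ?u)"
    using g by (intro is_iso_comp[OF E(1)]) (simp_all add: pointed_cells_Obj)
  moreover have "Comp ?E ?x (FOb (fst g) (snd b)) (snd e) (snd g) ?u \<in> ?L ?x (snd e)"
    using f g triple_mapD(1)[OF G(2)] E(2) by (auto simp: pointed_cells_Obj wide_class_def)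
  moreover have "comp1 AdTr (fst a) (fst b) (fst e) (fst g) (fst f) \<in> Obj (HomCat AdTr (fst a) (fst e))"
    using a fg by (intro two_category.comp1_in[OF two_category_AdTr]) (simp_all add: AdTr_pt_Ob)
  moreover have "FOb (fctr_comp (fst (fst a)) (fst g) (fst f)) (snd a) = ?x"
    using a by (simp add: AdTr_pt_Ob)
  ultimately show ?thesis using fg
    by (simp add: AdTr_pt_comp1[OF f g] pointed_cells_Obj[of _ a e] AdTr_comp1)
qed

text \<open>The isomorphisms attached to the two composites agree along a horizontal composite by
  naturality of \<open>\<beta>\<close> at the isomorphism \<open>snd f\<close>.\<close>

lemma AdTr_pt_hcomp_in:
  assumes ob: "a \<in> Ob AdTr_pt" "b \<in> Ob AdTr_pt" "e \<in> Ob AdTr_pt"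
    and \<alpha>: "\<alpha> \<in> Hom (pointed_cells a b) f f'" and \<beta>: "\<beta> \<in> Hom (pointed_cells b e) g g'"
  shows "hcomp AdTr_pt a b e g g' f f' \<beta> \<alpha> \<in>
    Hom (pointed_cells a e) (comp1 AdTr_pt a b e g f) (comp1 AdTr_pt a b e g' f')"
proof -
  let ?E = "fst (fst e)" and ?c = "snd a" and ?d = "snd b" and ?F = "fst f" and ?F' = "fst f'"
    and ?G = "fst g" and ?G' = "fst g'"
  have o: "f \<in> Obj (pointed_cells a b)" "f' \<in> Obj (pointed_cells a b)"
    "g \<in> Obj (pointed_cells b e)" "g' \<in> Obj (pointed_cells b e)"
    and \<alpha>': "\<alpha> \<in> Hom (HomCat AdTr (fst a) (fst b)) ?F ?F'"
    and \<beta>': "\<beta> \<in> Hom (HomCat AdTr (fst b) (fst e)) ?G ?G'"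
    and eq: "Comp (fst (fst b)) (FOb ?F ?c) (FOb ?F' ?c) ?d (snd f') (\<alpha> ?c) = snd f"
      "Comp ?E (FOb ?G ?d) (FOb ?G' ?d) (snd e) (snd g') (\<beta> ?d) = snd g"
    using \<alpha> \<beta> by (simp_all add: pointed_cells_Hom)
  have a: "?c \<in> Obj (fst (fst a))" and b: "?d \<in> Obj (fst (fst b))"
    using ob by (simp_all add: AdTr_pt_Ob)
  have n: "\<alpha> \<in> nat_trans (fst (fst a)) (fst (fst b)) ?F ?F'" "\<beta> \<in> nat_trans (fst (fst b)) ?E ?G ?G'"
    and F: "is_functor (fst (fst a)) (fst (fst b)) ?F" "is_functor (fst (fst a)) (fst (fst b)) ?F'"
      "is_functor (fst (fst b)) ?E ?G" "is_functor (fst (fst b)) ?E ?G'"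
    using \<alpha>' \<beta>' by (simp_all add: HomCat_AdTr)
  interpret F: is_functor "fst (fst a)" "fst (fst b)" ?F by fact
  interpret G: is_functor "fst (fst b)" ?E ?G by fact
  interpret G': is_functor "fst (fst b)" ?E ?G' by fact
  have i: "snd f \<in> Hom (fst (fst b)) (FOb ?F ?c) ?d" "snd f' \<in> Hom (fst (fst b)) (FOb ?F' ?c) ?d"
    "snd g \<in> Hom ?E (FOb ?G ?d) (snd e)" "snd g' \<in> Hom ?E (FOb ?G' ?d) (snd e)"
    using o by (simp_all add: pointed_cells_Obj is_iso_def)
  note Fc = F.maps_obj[OF a]
  note ac = nat_transD(1)[OF n(1) a] and bd = nat_transD(1)[OF n(2) b] and bF = nat_transD(1)[OF n(2) Fc]
  have nat: "Comp ?E (FOb ?G (FOb ?F ?c)) (FOb ?G ?d) (FOb ?G' ?d) (\<beta> ?d) (FAr ?G (FOb ?F ?c) ?d (snd f)) =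
    Comp ?E (FOb ?G (FOb ?F ?c)) (FOb ?G' (FOb ?F ?c)) (FOb ?G' ?d) (FAr ?G' (FOb ?F ?c) ?d (snd f)) (\<beta> (FOb ?F ?c))"
    by (rule nat_transD(2)[OF n(2) Fc b i(1)])
  note u = G'.maps_hom[OF ac] and v = G'.maps_hom[OF i(2)] and w = G.maps_hom[OF i(1)]
  have "Comp ?E (FOb ?G (FOb ?F ?c)) (FOb ?G' (FOb ?F' ?c)) (snd e)
     (Comp ?E (FOb ?G' (FOb ?F' ?c)) (FOb ?G' ?d) (snd e) (snd g') (FAr ?G' (FOb ?F' ?c) ?d (snd f')))
     (hcomp_trans (fst (fst a)) ?E ?G ?G' ?F ?F' \<beta> \<alpha> ?c) =
     Comp ?E (FOb ?G (FOb ?F ?c)) (FOb ?G ?d) (snd e) (snd g) (FAr ?G (FOb ?F ?c) ?d (snd f))"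
    using a nat eq G'.maps_comp[OF ac i(2)]
      G.cod.comp_assoc[OF G.cod.comp_in_hom[OF bF u] v i(4)]
      G.cod.comp_assoc[OF bF u v] G.cod.comp_assoc[OF w bd i(4)]
    by (simp add: hcomp_trans_def)
  moreover have "hcomp AdTr (fst a) (fst b) (fst e) ?G ?G' ?F ?F' \<beta> \<alpha> \<in> Hom (HomCat AdTr (fst a) (fst e))
    (comp1 AdTr (fst a) (fst b) (fst e) ?G ?F) (comp1 AdTr (fst a) (fst b) (fst e) ?G' ?F')"
    using ob \<alpha>' \<beta>' by (intro two_category.hcomp_in[OF two_category_AdTr]) (simp_all add: AdTr_pt_Ob)
  moreover have "?F \<in> Obj (HomCat AdTr (fst a) (fst b))" "?F' \<in> Obj (HomCat AdTr (fst a) (fst b))"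
    "?G \<in> Obj (HomCat AdTr (fst b) (fst e))" "?G' \<in> Obj (HomCat AdTr (fst b) (fst e))"
    using o by (simp_all add: pointed_cells_Obj)
  ultimately show ?thesis
    using AdTr_pt_comp1_in[OF ob o(1,3)] AdTr_pt_comp1_in[OF ob o(2,4)] a
    by (simp add: pointed_cells_Hom[of _ a e] AdTr_pt_hcomp[OF ob \<alpha> \<beta>] AdTr_pt_comp1[OF o(1,3)]
        AdTr_pt_comp1[OF o(2,4)] AdTr_hcomp[OF \<alpha>' \<beta>'] AdTr_comp1)
qed

text \<open>On 2-cells all operations agree with those of \<open>AdTr\<close>, from which the equations are inherited.\<close>

lemma AdTr_pt_comp_functor:
  assumes ob: "a \<in> Ob AdTr_pt" "b \<in> Ob AdTr_pt" "e \<in> Ob AdTr_pt"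
  shows "is_functor (prod_cat (pointed_cells b e) (pointed_cells a b)) (pointed_cells a e) (CompF AdTr_pt a b e)"
proof -
  note cat = category_pointed_cells[OF ob(2,3)] category_pointed_cells[OF ob(1,2)] category_pointed_cells[OF ob(1,3)]
  have ob': "fst a \<in> Ob AdTr" "fst b \<in> Ob AdTr" "fst e \<in> Ob AdTr" using ob by (simp_all add: AdTr_pt_Ob)
  interpret T: two_category AdTr by (rule two_category_AdTr)
  have C: "CompF AdTr_pt a b e = make_fctr (prod_cat (pointed_cells b e) (pointed_cells a b))
      (FOb (CompF AdTr_pt a b e)) (FAr (CompF AdTr_pt a b e))"
    by (simp add: AdTr_pt_CompF make_fctr_idem)
  show ?thesis
  proof (subst C, rule is_functor_make_fctr, goal_cases)
    case 1 show ?case using cat(1,2) by (rule category_prod_cat)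
  next
    case 2 show ?case by (rule cat(3))
  next
    case (3 x) then show ?case using AdTr_pt_comp1_in[OF ob] by (cases x) simp
  next
    case (4 x y f) then show ?case
      using AdTr_pt_hcomp_in[OF ob] cat by (cases x; cases y; cases f) simp
  next
    case (5 x)
    then obtain g f where x: "x = (g, f)" and o: "f \<in> Obj (pointed_cells a b)" "g \<in> Obj (pointed_cells b e)"
      by (cases x) simp
    show ?case
      using T.hcomp_id2[OF ob', of "fst f" "fst g"] o AdTr_pt_comp1_in[OF ob o]
        category.ident_in_hom[OF cat(1) o(2)] category.ident_in_hom[OF cat(2) o(1)]
      by (simp add: x AdTr_pt_hcomp[OF ob] pointed_cells_Ident AdTr_pt_comp1 pointed_cells_Obj[of f] pointed_cells_Obj[of g])
  next
    case (6 x y z s t)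
    obtain g f where x: "x = (g, f)" by (cases x)
    obtain g' f' where y: "y = (g', f')" by (cases y)
    obtain g'' f'' where z: "z = (g'', f'')" by (cases z)
    obtain \<beta> \<alpha> where s: "s = (\<beta>, \<alpha>)" by (cases s)
    obtain \<beta>' \<alpha>' where t: "t = (\<beta>', \<alpha>')" by (cases t)
    have h: "\<alpha> \<in> Hom (pointed_cells a b) f f'" "\<alpha>' \<in> Hom (pointed_cells a b) f' f''"
      "\<beta> \<in> Hom (pointed_cells b e) g g'" "\<beta>' \<in> Hom (pointed_cells b e) g' g''"
      using 6 cat by (simp_all add: x y z s t)
    have o: "f \<in> Obj (pointed_cells a b)" "f' \<in> Obj (pointed_cells a b)" "f'' \<in> Obj (pointed_cells a b)"
      "g \<in> Obj (pointed_cells b e)" "g' \<in> Obj (pointed_cells b e)" "g'' \<in> Obj (pointed_cells b e)"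
      using h by (simp_all add: pointed_cells_Hom)
    have h': "\<alpha> \<in> Hom (HomCat AdTr (fst a) (fst b)) (fst f) (fst f')" "\<alpha>' \<in> Hom (HomCat AdTr (fst a) (fst b)) (fst f') (fst f'')"
      "\<beta> \<in> Hom (HomCat AdTr (fst b) (fst e)) (fst g) (fst g')" "\<beta>' \<in> Hom (HomCat AdTr (fst b) (fst e)) (fst g') (fst g'')"
      using h by (simp_all add: pointed_cells_Hom)
    note H = T.homcat[OF ob'(2,3)] T.homcat[OF ob'(1,2)]
    have "Comp (prod_cat (HomCat AdTr (fst b) (fst e)) (HomCat AdTr (fst a) (fst b)))
       (fst g, fst f) (fst g', fst f') (fst g'', fst f'') (\<beta>', \<alpha>') (\<beta>, \<alpha>) =
       (Comp (pointed_cells b e) g g' g'' \<beta>' \<beta>, Comp (pointed_cells a b) f f' f'' \<alpha>' \<alpha>)"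
      using H h h' by (simp add: pointed_cells_Comp)
    then show ?case
      using is_functor.maps_comp[OF T.comp_functor[OF ob'], of "(\<beta>, \<alpha>)" "(fst g, fst f)" "(fst g', fst f')"
          "(\<beta>', \<alpha>')" "(fst g'', fst f'')"] H h h' cat
        category.comp_in_hom[OF cat(1) h(3,4)] category.comp_in_hom[OF cat(2) h(1,2)]
        pointed_cells_Comp[OF AdTr_pt_hcomp_in[OF ob h(1,3)] AdTr_pt_hcomp_in[OF ob h(2,4)]]
      by (simp add: x y z s t AdTr_pt_hcomp[OF ob] AdTr_pt_comp1[OF o(1,4)] AdTr_pt_comp1[OF o(2,5)]
          AdTr_pt_comp1[OF o(3,6)])
  qed
qed

text \<open>Beyond the laws of \<open>AdTr\<close>, only the isomorphisms attached to 1-cells have to be compared. Both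
  sides of the associative law attach the composite of \<open>h\<close>, the image of \<open>g\<close> and the twofold image
  of \<open>f\<close>.\<close>

lemma two_category_AdTr_pt: "two_category AdTr_pt"
proof -
  interpret T: two_category AdTr by (rule two_category_AdTr)
  have ob': "adequate_triple (fst a)" "category (fst (fst a))" "snd a \<in> Obj (fst (fst a))" if "a \<in> Ob AdTr_pt" for a
    using that adequate_tripleD(1)[of "fst a"] by (simp_all add: AdTr_pt_Ob)
  have id1: "Id1 AdTr_pt a \<in> Obj (pointed_cells a a)" if "a \<in> Ob AdTr_pt" for a
    using ob'[OF that] T.id1[of "fst a"] adequate_tripleD(2)[of "fst a"]
    by (simp add: pointed_cells_Obj is_iso_ident wide_class_def)
  have Fobj: "is_functor (fst (fst a)) (fst (fst b)) (fst f) \<and> fst f \<in> Obj (HomCat AdTr (fst a) (fst b)) \<and>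
     snd f \<in> Hom (fst (fst b)) (FOb (fst f) (snd a)) (snd b)"
    if "f \<in> Obj (pointed_cells a b)" for f a b
    using that by (simp add: pointed_cells_Obj HomCat_AdTr is_iso_def)
  have id2: "Ident (HomCat AdTr (fst a) (fst a)) (id_fctr (fst (fst a))) \<in> Hom (pointed_cells a a) (Id1 AdTr_pt a) (Id1 AdTr_pt a)"
    if "a \<in> Ob AdTr_pt" for a
    using category.ident_in_hom[OF category_pointed_cells[OF that that] id1[OF that]]
    by (simp add: pointed_cells_Ident[OF id1[OF that, simplified]])
  show ?thesis
  proof (rule two_category.intro, unfold AdTr_pt_simps(1), goal_cases)
    case (1 a b) then show ?case by (rule category_pointed_cells)
  next
    case (2 a) then show ?case by (rule id1)
  next
    case (3 a b c) then show ?case by (rule AdTr_pt_comp_functor)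
  next
    case (4 a b f)
    note F = Fobj[OF 4(3)]
    show ?case
      using AdTr_pt_comp1[OF id1[OF 4(1)] 4(3)] T.unit_right_1[of "fst a" "fst b" "fst f"] F ob'[OF 4(1)] ob'[OF 4(2)]
        is_functor.maps_ident[OF conjunct1[OF F] ob'(3)[OF 4(1)]]
        category.comp_ident_right[OF ob'(2)[OF 4(2)] conjunct2[OF conjunct2[OF F]]]
      by (simp add: prod_eq_iff)
  next
    case (5 a b f)
    note F = Fobj[OF 5(3)]
    show ?case
      using AdTr_pt_comp1[OF 5(3) id1[OF 5(2)]] T.unit_left_1[of "fst a" "fst b" "fst f"] F ob'[OF 5(1)] ob'[OF 5(2)]
        is_functor.maps_obj[OF conjunct1[OF F] ob'(3)[OF 5(1)]]
        category.comp_ident_left[OF ob'(2)[OF 5(2)] conjunct2[OF conjunct2[OF F]]]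
      by (simp add: prod_eq_iff)
  next
    case (6 a b \<alpha> f f')
    then have "\<alpha> \<in> Hom (HomCat AdTr (fst a) (fst b)) (fst f) (fst f')" by (simp add: pointed_cells_Hom)
    then show ?case
      using AdTr_pt_hcomp[OF 6(1,1,2) id2[OF 6(1)] 6(3)] T.unit_right_2[of "fst a" "fst b" \<alpha> "fst f" "fst f'"]
        ob'[OF 6(1)] ob'[OF 6(2)] by (simp add: pointed_cells_Ident[OF id1[OF 6(1), simplified]])
  next
    case (7 a b \<alpha> f f')
    then have "\<alpha> \<in> Hom (HomCat AdTr (fst a) (fst b)) (fst f) (fst f')" by (simp add: pointed_cells_Hom)
    then show ?case
      using AdTr_pt_hcomp[OF 7(1,2,2,3) id2[OF 7(2)]] T.unit_left_2[of "fst a" "fst b" \<alpha> "fst f" "fst f'"]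
        ob'[OF 7(1)] ob'[OF 7(2)] by (simp add: pointed_cells_Ident[OF id1[OF 7(2), simplified]])
  next
    case (8 a b c d f g h)
    let ?F = "fst f" and ?G = "fst g" and ?H = "fst h" and ?D = "fst (fst d)"
    note F = Fobj[OF 8(5)] and G = Fobj[OF 8(6)] and H = Fobj[OF 8(7)]
    interpret F: is_functor "fst (fst a)" "fst (fst b)" ?F using F by simp
    interpret G: is_functor "fst (fst b)" "fst (fst c)" ?G using G by simp
    interpret H: is_functor "fst (fst c)" ?D ?H using H by simp
    note gf = AdTr_pt_comp1_in[OF 8(1-3,5,6)] and hg = AdTr_pt_comp1_in[OF 8(2-4,6,7)]
    have Gi: "FAr ?G (FOb ?F (snd a)) (snd b) (snd f) \<in> Hom (fst (fst c)) (FOb ?G (FOb ?F (snd a))) (FOb ?G (snd b))"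
      using F by (intro G.maps_hom) simp
    have j: "snd g \<in> Hom (fst (fst c)) (FOb ?G (snd b)) (snd c)"
      and k: "snd h \<in> Hom ?D (FOb ?H (snd c)) (snd d)" using G H by simp_all
    show ?case
      using AdTr_pt_comp1[OF 8(5) hg] AdTr_pt_comp1[OF gf 8(7)] AdTr_pt_comp1[OF 8(5,6)] AdTr_pt_comp1[OF 8(6,7)]
        T.assoc_1[of "fst a" "fst b" "fst c" "fst d" ?F ?G ?H] F G H
        ob'[OF 8(1)] ob'[OF 8(2)] ob'[OF 8(3)] ob'[OF 8(4)]
        H.maps_comp[OF Gi j] H.cod.comp_assoc[OF H.maps_hom[OF Gi] H.maps_hom[OF j] k]
      by (simp add: AdTr_comp1 F.maps_obj)
  next
    case (9 a b c d \<alpha> f f' \<beta> g g' \<gamma> h h')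
    have h': "\<alpha> \<in> Hom (HomCat AdTr (fst a) (fst b)) (fst f) (fst f')"
      "\<beta> \<in> Hom (HomCat AdTr (fst b) (fst c)) (fst g) (fst g')" "\<gamma> \<in> Hom (HomCat AdTr (fst c) (fst d)) (fst h) (fst h')"
      and o: "f \<in> Obj (pointed_cells a b)" "f' \<in> Obj (pointed_cells a b)" "g \<in> Obj (pointed_cells b c)"
      "g' \<in> Obj (pointed_cells b c)" "h \<in> Obj (pointed_cells c d)" "h' \<in> Obj (pointed_cells c d)"
      using 9(5-7) by (simp_all add: pointed_cells_Hom)
    note ba = AdTr_pt_hcomp_in[OF 9(1-3,5,6)] and cb = AdTr_pt_hcomp_in[OF 9(2-4,6,7)]
    show ?case
      using AdTr_pt_hcomp[OF 9(1,3,4) ba 9(7)] AdTr_pt_hcomp[OF 9(1,2,4,5) cb]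
        AdTr_pt_hcomp[OF 9(1-3,5,6)] AdTr_pt_hcomp[OF 9(2-4,6,7)]
        T.assoc_2[OF _ _ _ _ h'] ob'[OF 9(1)] ob'[OF 9(2)] ob'[OF 9(3)] ob'[OF 9(4)]
        AdTr_pt_comp1[OF o(1,3)] AdTr_pt_comp1[OF o(2,4)] AdTr_pt_comp1[OF o(3,5)] AdTr_pt_comp1[OF o(4,6)]
      by simp
  qed
qed

section \<open>Products of pointed adequate triples\<close>

lemma (in category_family) is_iso_product:
  assumes xy: "x \<in> Obj (product C)" "y \<in> Obj (product C)"
    and f: "\<And>i. i \<in> I \<Longrightarrow> is_iso (C i) (prj i x) (prj i y) (f i)"
  shows "is_iso (product C) x y (tupm f)"
proof -
  have "\<exists>g. g \<in> Hom (C i) (prj i y) (prj i x) \<and>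
      Comp (C i) (prj i x) (prj i y) (prj i x) g (f i) = Ident (C i) (prj i x) \<and>
      Comp (C i) (prj i y) (prj i x) (prj i y) (f i) g = Ident (C i) (prj i y)" if "i \<in> I" for i
    using f[OF that] by (auto simp: is_iso_def)
  then obtain g where g: "\<And>i. i \<in> I \<Longrightarrow> g i \<in> Hom (C i) (prj i y) (prj i x) \<and>
      Comp (C i) (prj i x) (prj i y) (prj i x) (g i) (f i) = Ident (C i) (prj i x) \<and>
      Comp (C i) (prj i y) (prj i x) (prj i y) (f i) (g i) = Ident (C i) (prj i y)" by metis
  have F: "tupm f \<in> Hom (product C) x y" by (rule tupm_in_hom[OF xy]) (use f in \<open>simp add: is_iso_def\<close>)
  have G: "tupm g \<in> Hom (product C) y x" by (rule tupm_in_hom[OF xy(2,1)]) (use g in simp)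
  have "Comp (product C) x y x (tupm g) (tupm f) = Ident (product C) x"
    using product_comp_eq_iff[OF F G category.ident_in_hom[OF category_prod xy(1)]] g xy by simp
  moreover have "Comp (product C) y x y (tupm f) (tupm g) = Ident (product C) y"
    using product_comp_eq_iff[OF G F category.ident_in_hom[OF category_prod xy(2)]] g xy by simp
  ultimately show ?thesis using F G by (auto simp: is_iso_def)
qed

text \<open>The product is pointed by the tuple of the points, and its projections carry identities, as they
  preserve the points strictly. A 1-cell into it is a family of functors with a family of
  isomorphisms, and the latter is an isomorphism in the product category, with membership in the
  left class tested componentwise. For 2-cells the 2-product in \<open>AdTr\<close> already supplies the unique
  candidate, and compatibility with the points is tested componentwise as well.\<close>

lemma (in tupling) AdTr_pt_2product:
  assumes A: "\<And>i. i \<in> I \<Longrightarrow> A i \<in> Ob AdTr_pt"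
  shows "is_2product AdTr_pt I A (product_triple (\<lambda>i. fst (A i)), tup (\<lambda>i. snd (A i)))
    (\<lambda>i. (projection (\<lambda>i. fst (fst (A i))) i, Ident (fst (fst (A i))) (snd (A i))))"
proof -
  let ?A = "\<lambda>i. fst (A i)" and ?C = "\<lambda>i. fst (fst (A i))"
  let ?t = "tup (\<lambda>i. snd (A i))" and ?P = "product_triple (\<lambda>i. fst (A i))"
  let ?pr = "\<lambda>i. (projection ?C i, Ident (?C i) (snd (A i)))"
  let ?H = "\<lambda>x. pointed_cells x (?P, ?t)" and ?K = "\<lambda>x. HomCat AdTr (fst x) ?P"
  let ?c = "\<lambda>x i k. comp1 AdTr (fst x) ?P (?A i) (projection ?C i) k"
    and ?cp = "\<lambda>x i h. comp1 AdTr_pt x (?P, ?t) (A i) (?pr i) h"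
  let ?w = "\<lambda>x h h' i \<theta>. whisker AdTr (fst x) ?P (?A i) (projection ?C i) (fst h) (fst h') \<theta>"
    and ?wp = "\<lambda>x h h' i \<theta>. whisker AdTr_pt x (?P, ?t) (A i) (?pr i) h h' \<theta>"
  have A': "?A i \<in> Ob AdTr" "adequate_triple (?A i)" "category (?C i)" "snd (A i) \<in> Obj (?C i)" if "i \<in> I" for i
    using A[OF that] adequate_tripleD(1)[of "fst (A i)"] by (simp_all add: AdTr_pt_Ob)
  interpret P: category_family I tup prj tupm prjm ?C
    using tupling_axioms A'(3) by (simp add: category_family_def category_family_axioms_def)
  have prod: "is_2product AdTr I ?A ?P (projection ?C)" using A'(1) by (rule AdTr_2product)
  have fstP: "fst ?P = product ?C" "fst (snd ?P) = product_class ?C (\<lambda>i. fst (snd (?A i)))"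
    by (simp_all add: product_triple_def)
  have t: "?t \<in> Obj (product ?C)" using A'(4) by simp
  have p: "(?P, ?t) \<in> Ob AdTr_pt"
    using t adequate_product_triple[of ?A] A'(2) by (simp add: AdTr_pt_Ob fstP)
  have pr: "?pr i \<in> Obj (pointed_cells (?P, ?t) (A i))" if "i \<in> I" for i
    using is_2product_ob(2)[OF prod that] is_iso_ident[OF A'(3,4)[OF that]] t that
      adequate_tripleD(2)[OF A'(2)[OF that]] A'(4)[OF that]
    by (simp add: pointed_cells_Obj wide_class_def)
  have PF: "is_functor (fst (fst x)) (product ?C) (fst h)" "FOb (fst h) (snd x) \<in> Obj (product ?C)"
    "snd h \<in> Hom (product ?C) (FOb (fst h) (snd x)) ?t"
    if "x \<in> Ob AdTr_pt" "h \<in> Obj (?H x)" for x h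
    using that is_functor.maps_obj[of "fst (fst x)" "product ?C" "fst h" "snd x"]
    by (simp_all add: pointed_cells_Obj AdTr_pt_Ob HomCat_AdTr fstP is_iso_def)
  have comp: "?cp x i h =
      (?c x i (fst h), prjm i (snd h))"
    if "x \<in> Ob AdTr_pt" "h \<in> Obj (?H x)" "i \<in> I" for x h i
    using AdTr_pt_comp1[OF that(2) pr[OF that(3)]] PF[OF that(1,2)] t that(3)
      category.comp_ident_left[OF A'(3)[OF that(3)] product_homD(3)[OF PF(3)[OF that(1,2)] that(3)]] by simp
  have at_point: "FOb (?c x i k) (snd x) = prj i (FOb k (snd x))"
    if "x \<in> Ob AdTr_pt" "k \<in> Obj (?K x)" "i \<in> I" for x k i
    using AdTr_comp1[OF that(2) is_2product_ob(2)[OF prod that(3)]] that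
      is_functor.maps_obj[of "fst (fst x)" "product ?C" k "snd x"]
    by (simp add: AdTr_pt_Ob HomCat_AdTr fstP)
  show ?thesis
    unfolding is_2product_def AdTr_pt_simps(1)
  proof (intro conjI ballI allI impI)
    show "(?P, ?t) \<in> Ob AdTr_pt" by (rule p)
    fix i assume "i \<in> I" then show "?pr i \<in> Obj (pointed_cells (?P, ?t) (A i))" by (rule pr)
  next
    fix x f assume x: "x \<in> Ob AdTr_pt" and "\<forall>i \<in> I. f i \<in> Obj (pointed_cells x (A i))"
    then have f: "f i \<in> Obj (pointed_cells x (A i))" if "i \<in> I" for i using that by simp
    have x': "fst x \<in> Ob AdTr" "snd x \<in> Obj (fst (fst x))" using x by (simp_all add: AdTr_pt_Ob)
    have ex: "\<exists>!k. k \<in> Obj (?K x) \<and>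
        (\<forall>i \<in> I. ?c x i k = fst (f i))"
      using prod x' f by (simp add: is_2product_def pointed_cells_Obj)
    then obtain k where k: "k \<in> Obj (?K x)"
      "\<And>i. i \<in> I \<Longrightarrow> ?c x i k = fst (f i)" by blast
    let ?v = "tupm (\<lambda>i. snd (f i))"
    have kx: "FOb k (snd x) \<in> Obj (product ?C)"
      using k(1) x' is_functor.maps_obj[of "fst (fst x)" "product ?C" k "snd x"]
      by (simp add: HomCat_AdTr fstP)
    have iso: "is_iso (?C i) (prj i (FOb k (snd x))) (prj i ?t) (snd (f i)) \<and>
      snd (f i) \<in> fst (snd (?A i)) (prj i (FOb k (snd x))) (prj i ?t)" if i: "i \<in> I" for i
      using f[OF i] at_point[OF x k(1) i] k(2)[OF i] i by (simp add: pointed_cells_Obj)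
    have viso: "is_iso (product ?C) (FOb k (snd x)) ?t ?v"
      by (rule P.is_iso_product[OF kx t]) (use iso in simp)
    then have "?v \<in> product_class ?C (\<lambda>i. fst (snd (?A i))) (FOb k (snd x)) ?t"
      using iso by (simp add: product_class_def is_iso_def)
    then have kv: "(k, ?v) \<in> Obj (?H x)"
      using viso k(1) by (simp add: pointed_cells_Obj fstP)
    show "\<exists>!h. h \<in> Obj (?H x) \<and> (\<forall>i\<in>I. ?cp x i h = f i)"
    proof (intro ex1I[of _ "(k, ?v)"] conjI ballI kv)
      fix i assume i: "i \<in> I"
      show "?cp x i (k, ?v) = f i"
        using comp[OF x kv i] k(2)[OF i] i by simp
    next
      fix h assume h: "h \<in> Obj (?H x) \<and> (\<forall>i\<in>I. ?cp x i h = f i)"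
      then have h1: "h \<in> Obj (?H x)" by simp
      have hi: "?c x i (fst h) = fst (f i) \<and> prjm i (snd h) = snd (f i)"
        if "i \<in> I" for i using h comp[OF x h1 that] that by auto
      have "fst h \<in> Obj (?K x) \<and>
          (\<forall>i \<in> I. ?c x i (fst h) = fst (f i))"
        using h1 hi by (simp add: pointed_cells_Obj)
      then have "fst h = k" using ex k by blast
      moreover have "snd h = ?v"
        by (rule product_hom_eqI[OF PF(3)[OF x h1], of _ ?C "FOb k (snd x)" ?t])
          (use hi viso in \<open>simp_all add: is_iso_def\<close>)
      ultimately show "h = (k, ?v)" by (simp add: prod_eq_iff)
    qed
  next
    fix x h h' \<phi>
    assume x: "x \<in> Ob AdTr_pt" and h: "h \<in> Obj (?H x)" and h': "h' \<in> Obj (?H x)"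
      and phi': "\<forall>i \<in> I. \<phi> i \<in> Hom (pointed_cells x (A i)) (?cp x i h)
           (?cp x i h')"
    have phi: "\<phi> i \<in> Hom (pointed_cells x (A i))
           (?c x i (fst h), prjm i (snd h))
           (?c x i (fst h'), prjm i (snd h'))" if "i \<in> I" for i
      using bspec[OF phi' that] unfolding comp[OF x h that] comp[OF x h' that] .
    have x': "fst x \<in> Ob AdTr" "snd x \<in> Obj (fst (fst x))" using x by (simp_all add: AdTr_pt_Ob)
    have o: "fst h \<in> Obj (?K x)" "fst h' \<in> Obj (?K x)"
      using h h' by (simp_all add: pointed_cells_Obj)
    have w: "?wp x h h' i \<theta> =
      ?w x h h' i \<theta>"
      if i: "i \<in> I" and th: "\<theta> \<in> Hom (?H x) h h'" for i \<theta>
      unfolding whisker_def AdTr_pt_simps(1)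
      using AdTr_pt_hcomp[OF x p A[OF i] th category.ident_in_hom[OF category_pointed_cells[OF p A[OF i]] pr[OF i]]]
        pointed_cells_Ident[OF pr[OF i]] by simp
    have w': "?w x h h' i \<theta> (snd x) = prjm i (\<theta> (snd x))"
      if i: "i \<in> I" and th: "\<theta> \<in> Hom (?K x) (fst h) (fst h')" for i \<theta>
    proof -
      note pi = is_2product_ob(2)[OF prod i]
      have id_hom: "id2 AdTr ?P (?A i) (projection ?C i) \<in> Hom (HomCat AdTr ?P (?A i)) (projection ?C i) (projection ?C i)"
        by (rule two_category.id2_in[OF two_category_AdTr is_2product_ob(1)[OF prod] A'(1)[OF i] pi])
      have id_eq: "id2 AdTr ?P (?A i) (projection ?C i) =
          (\<lambda>y \<in> Obj (product ?C). Ident (?C i) (FOb (projection ?C i) y))"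
        using pi by (simp add: HomCat_AdTr fstP)
      have th': "\<theta> \<in> nat_trans (fst (fst x)) (product ?C) (fst h) (fst h')"
        using th by (simp add: HomCat_AdTr fstP)
      show ?thesis
        unfolding whisker_def AdTr_hcomp[OF th id_hom] unfolding id_eq
        using P.whisker_projection[OF PF(1)[OF x h] PF(1)[OF x h'] th' i] x' by simp
    qed
    have ex: "\<exists>!\<theta>. \<theta> \<in> Hom (?K x) (fst h) (fst h') \<and>
       (\<forall>i \<in> I. ?w x h h' i \<theta> = \<phi> i)"
      by (rule is_2product_cell[OF prod x'(1) o]) (use phi in \<open>simp add: pointed_cells_Hom\<close>)
    have pt: "\<theta> \<in> Hom (?H x) h h'"
      if th: "\<theta> \<in> Hom (?K x) (fst h) (fst h')"
        and wh: "\<And>i. i \<in> I \<Longrightarrow> ?w x h h' i \<theta> = \<phi> i" for \<theta>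
    proof -
      have tx: "\<theta> (snd x) \<in> Hom (product ?C) (FOb (fst h) (snd x)) (FOb (fst h') (snd x))"
        using th x' nat_transD(1)[of \<theta> "fst (fst x)" "product ?C" "fst h" "fst h'" "snd x"]
        by (simp add: HomCat_AdTr fstP)
      have "Comp (product ?C) (FOb (fst h) (snd x)) (FOb (fst h') (snd x)) ?t (snd h') (\<theta> (snd x)) = snd h"
        unfolding P.product_comp_eq_iff[OF tx PF(3)[OF x h'] PF(3)[OF x h]]
      proof
        fix i assume i: "i \<in> I"
        show "Comp (?C i) (prj i (FOb (fst h) (snd x))) (prj i (FOb (fst h') (snd x))) (prj i ?t)
           (prjm i (snd h')) (prjm i (\<theta> (snd x))) = prjm i (snd h)"
          using phi[OF i] at_point[OF x o(1) i] at_point[OF x o(2) i] w'[OF i th] wh[OF i] i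
          by (simp add: pointed_cells_Hom)
      qed
      then show ?thesis using h h' th by (simp add: pointed_cells_Hom fstP)
    qed
    have "\<exists>!\<theta>. \<theta> \<in> Hom (?H x) h h' \<and>
       (\<forall>i \<in> I. ?wp x h h' i \<theta> = \<phi> i)"
    proof -
      obtain \<theta> where th: "\<theta> \<in> Hom (?K x) (fst h) (fst h')"
        "\<And>i. i \<in> I \<Longrightarrow> ?w x h h' i \<theta> = \<phi> i"
        using ex by blast
      show ?thesis
      proof (intro ex1I[of _ \<theta>] conjI ballI)
        show th': "\<theta> \<in> Hom (?H x) h h'" using th by (rule pt)
        show "?wp x h h' i \<theta> = \<phi> i" if "i \<in> I" for i
          using w[OF that th'] th(2)[OF that] by simp
        fix \<psi> assume psi: "\<psi> \<in> Hom (?H x) h h' \<and>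
          (\<forall>i \<in> I. ?wp x h h' i \<psi> = \<phi> i)"
        then have "\<psi> \<in> Hom (?K x) (fst h) (fst h')" by (simp add: pointed_cells_Hom)
        moreover have "\<forall>i \<in> I. ?w x h h' i \<psi> = \<phi> i"
        proof
          fix i assume i: "i \<in> I"
          show "?w x h h' i \<psi> = \<phi> i"
            using w[OF i conjunct1[OF psi]] bspec[OF conjunct2[OF psi] i] by (rule trans[OF sym])
        qed
        ultimately show "\<psi> = \<theta>" using ex th by blast
      qed
    qed
    then show "\<exists>!\<theta>. \<theta> \<in> Hom (?H x) h h' \<and>
       (\<forall>i \<in> I. hcomp AdTr_pt x (?P, ?t) (A i) (?pr i) (?pr i) h h'
          (Ident (pointed_cells (?P, ?t) (A i)) (?pr i)) \<theta> = \<phi> i)"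
      unfolding whisker_def AdTr_pt_simps(1) .
  qed
qed

lemma two_functor_forget_point: "two_functor AdTr_pt AdTr forget_point"
proof -
  interpret T: two_category AdTr by (rule two_category_AdTr)
  interpret P: two_category AdTr_pt by (rule two_category_AdTr_pt)
  have ob: "fst a \<in> Ob AdTr" if "a \<in> Ob AdTr_pt" for a using that by (simp add: AdTr_pt_Ob)
  have cat: "category (pointed_cells a b)" if "a \<in> Ob AdTr_pt" "b \<in> Ob AdTr_pt" for a b
    using that by (rule category_pointed_cells)
  show ?thesis
  proof (rule two_functor.intro, rule P.two_category_axioms, rule T.two_category_axioms,
      rule two_functor_axioms.intro, goal_cases)
    case (1 a) then show ?case using ob by (simp add: forget_point_def)
  next
    case (2 a b) then show ?case
      unfolding forget_point_def using cat[OF 2] T.homcat[OF ob[OF 2(1)] ob[OF 2(2)]]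
      by (auto intro!: is_functor_make_fctr simp: pointed_cells_Obj pointed_cells_Hom pointed_cells_Ident pointed_cells_Comp)
  next
    case (3 a) then show ?case using P.id1[OF 3] by (simp add: forget_point_def)
  next
    case (4 a b c f g) then show ?case
      using P.comp1_in[OF 4] by (simp add: forget_point_def AdTr_pt_comp1)
  next
    case (5 a b c \<alpha> f f' \<beta> g g')
    then have "f \<in> Obj (pointed_cells a b)" "f' \<in> Obj (pointed_cells a b)"
      "g \<in> Obj (pointed_cells b c)" "g' \<in> Obj (pointed_cells b c)"
      by (simp_all add: pointed_cells_Hom)
    then show ?case using 5 P.hcomp_in[OF 5] cat[OF 5(1,2)] cat[OF 5(2,3)] cat[OF 5(1,3)]
      by (simp add: forget_point_def AdTr_pt_hcomp)
  qed
qed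

lemma cartesian_forget_point:
  assumes "infinite (UNIV :: 'o set)" "infinite (UNIV :: 'm set)"
  shows "cartesian_2functor (AdTr_pt :: (('o, 'm) triple \<times> 'o, _, _) tcat) AdTr forget_point"
proof (rule cartesian_2functorI[OF two_functor_forget_point cartesian_AdTr[OF assms]])
  fix I :: "nat set" and A :: "nat \<Rightarrow> ('o, 'm) triple \<times> 'o"
  assume I: "finite I" and A: "\<And>i. i \<in> I \<Longrightarrow> A i \<in> Ob AdTr_pt"
  obtain tup :: "(nat \<Rightarrow> 'o) \<Rightarrow> 'o" and prj and tupm :: "(nat \<Rightarrow> 'm) \<Rightarrow> 'm" and prjm
    where "tupling I tup prj tupm prjm" using tupling_exists[OF I assms] by blast
  then interpret tupling I tup prj tupm prjm .
  let ?p = "(product_triple (\<lambda>i. fst (A i)), tup (\<lambda>i. snd (A i)))"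
  let ?pr = "\<lambda>i. (projection (\<lambda>i. fst (fst (A i))) i, Ident (fst (fst (A i))) (snd (A i)))"
  have P: "is_2product AdTr_pt I A ?p ?pr" using A by (rule AdTr_pt_2product)
  have "is_2product AdTr I (\<lambda>i. fst (A i)) (product_triple (\<lambda>i. fst (A i))) (projection (\<lambda>i. fst (fst (A i))))"
    using A by (intro AdTr_2product) (simp add: AdTr_pt_Ob)
  then have "is_2product AdTr I (\<lambda>i. T0 forget_point (A i)) (product_triple (\<lambda>i. fst (A i)))
    (\<lambda>i. FOb (T1 forget_point ?p (A i)) (?pr i))"
    by (rule is_2product_cong) (use is_2product_ob(2)[OF P] in \<open>simp_all add: forget_point_def\<close>)
  then have "is_2product AdTr I (\<lambda>i. T0 forget_point (A i)) (T0 forget_point ?p)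
    (\<lambda>i. FOb (T1 forget_point ?p (A i)) (?pr i))"
    by (simp add: forget_point_def)
  then show "\<exists>p pr. is_2product AdTr_pt I A p pr \<and> is_2product AdTr I (\<lambda>i. T0 forget_point (A i))
    (T0 forget_point p) (\<lambda>i. FOb (T1 forget_point p (A i)) (pr i))"
    using P by blast
qed

section \<open>Pointing a lex category by its terminal object\<close>

text \<open>The isomorphism attached to a lex functor \<open>F\<close> is the only arrow from \<open>F t\<close> to the chosen terminal
  object of the codomain.\<close>

definition Lex_to_AdTr_pt ::
  "(('o, 'm) cat \<times> 'o, ('o, 'm, 'o, 'm) fctr, 'o \<Rightarrow> 'm,
    ('o, 'm) triple \<times> 'o, ('o, 'm, 'o, 'm) fctr \<times> 'm, 'o \<Rightarrow> 'm) tfun" where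
  "Lex_to_AdTr_pt =
    \<lparr> T0 = (\<lambda>(C, t). (all_triple C, t)),
      T1 = (\<lambda>a b. make_fctr (HomCat Lex a b)
        (\<lambda>F. (F, THE i. i \<in> Hom (fst b) (FOb F (snd a)) (snd b))) (\<lambda>_ _ \<alpha>. \<alpha>)) \<rparr>"

lemma adequate_all_triple:
  assumes "category C" "has_finite_limits C"
  shows "adequate_triple (all_triple C)"
proof -
  interpret category C by fact
  have "wide_class C (Hom C)" by (simp add: wide_class_def ident_in_hom comp_in_hom)
  then show ?thesis
    using assms pullback_exists[OF assms]
    by (simp add: adequate_triple_iff all_triple_def is_pullback_def)
qed

lemma triple_map_all:
  assumes "is_functor C D F" "preserves_finite_limits C D F"
  shows "triple_map (all_triple C) (all_triple D) F"
  using preserves_pullback[OF assms] is_functor.maps_hom[OF assms(1)]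
  by (intro triple_mapI) (simp_all add: all_triple_def)

lemma is_terminal_unique:
  assumes "is_terminal C t" "category C" "f \<in> Hom C x t" "g \<in> Hom C x t"
  shows "f = g"
  using assms category.hom_obj(1)[OF assms(2,3)] unfolding is_terminal_def by blast

lemma is_iso_terminal:
  assumes C: "category C" and s: "is_terminal C s" and t: "is_terminal C t" and f: "f \<in> Hom C s t"
  shows "is_iso C s t f"
proof -
  interpret category C by fact
  obtain g where g: "g \<in> Hom C t s" using s t unfolding is_terminal_def by blast
  have "Comp C s t s g f = Ident C s"
    by (rule is_terminal_unique[OF s C comp_in_hom[OF f g]]) (use hom_obj[OF f] ident_in_hom in simp)
  moreover have "Comp C t s t f g = Ident C t"
    by (rule is_terminal_unique[OF t C comp_in_hom[OF g f]]) (use hom_obj[OF f] ident_in_hom in simp)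
  ultimately show ?thesis using f g by (auto simp: is_iso_def)
qed

lemma Lex_to_AdTr_pt_T0: "T0 Lex_to_AdTr_pt a = (all_triple (fst a), snd a)"
  by (cases a) (simp add: Lex_to_AdTr_pt_def)

lemma Lex_to_AdTr_pt_T1:
  assumes b: "b \<in> Ob Lex" and i: "i \<in> Hom (fst b) (FOb F (snd a)) (snd b)"
    and F: "F \<in> Obj (HomCat Lex a b)"
  shows "FOb (T1 Lex_to_AdTr_pt a b) F = (F, i)"
proof -
  have "(THE i. i \<in> Hom (fst b) (FOb F (snd a)) (snd b)) = i"
    using b i is_terminal_unique[of "fst b" "snd b"] by (intro the_equality) (auto simp: Lex_Ob)
  then show ?thesis using F by (simp add: Lex_to_AdTr_pt_def)
qed

lemma Lex_to_AdTr_pt_T1_in: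
  assumes a: "a \<in> Ob Lex" and b: "b \<in> Ob Lex" and F: "F \<in> Obj (HomCat Lex a b)"
  obtains i where "FOb (T1 Lex_to_AdTr_pt a b) F = (F, i)" "i \<in> Hom (fst b) (FOb F (snd a)) (snd b)"
    "(F, i) \<in> Obj (pointed_cells (T0 Lex_to_AdTr_pt a) (T0 Lex_to_AdTr_pt b))"
proof -
  have F': "is_functor (fst a) (fst b) F" "preserves_finite_limits (fst a) (fst b) F"
    using F by (simp_all add: Lex_HomCat)
  have t: "is_terminal (fst b) (FOb F (snd a))" "is_terminal (fst b) (snd b)" and C: "category (fst b)"
    using preserves_terminal[OF F'] a b by (simp_all add: Lex_Ob)
  then obtain i where i: "i \<in> Hom (fst b) (FOb F (snd a)) (snd b)" unfolding is_terminal_def by blast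
  have "(F, i) \<in> Obj (pointed_cells (T0 Lex_to_AdTr_pt a) (T0 Lex_to_AdTr_pt b))"
    using is_iso_terminal[OF C t i] triple_map_all[OF F'] F' i
    by (simp add: pointed_cells_Obj Lex_to_AdTr_pt_T0 HomCat_AdTr) (simp add: all_triple_def)
  then show thesis using that Lex_to_AdTr_pt_T1[OF b i F] i by blast
qed

text \<open>Lex functors preserve terminal objects, so every 1-cell in the image ends in a terminal object and
  carries the unique available isomorphism. Hence all conditions on these isomorphisms, for
  identities, composites and 2-cells, hold because there is at most one arrow into a terminal
  object.\<close>

lemma two_functor_Lex_to_AdTr_pt: "two_functor Lex AdTr_pt Lex_to_AdTr_pt"
proof -
  interpret T: two_category Lex by (rule two_category_Lex)
  interpret P: two_category AdTr_pt by (rule two_category_AdTr_pt)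
  let ?T = "T0 Lex_to_AdTr_pt" and ?F = "\<lambda>a b. FOb (T1 Lex_to_AdTr_pt a b)"
  have ob: "?T a \<in> Ob AdTr_pt" if "a \<in> Ob Lex" for a
    using that adequate_all_triple[of "fst a"]
    by (simp add: Lex_to_AdTr_pt_T0 AdTr_pt_Ob Lex_Ob is_terminal_def) (simp add: all_triple_def)
  have fstT: "fst (fst (?T a)) = fst a" "snd (?T a) = snd a" for a
    by (simp_all add: Lex_to_AdTr_pt_T0 all_triple_def)
  have o: "?F a b f \<in> Obj (pointed_cells (?T a) (?T b))" "fst (?F a b f) = f"
    if abf: "a \<in> Ob Lex" "b \<in> Ob Lex" "f \<in> Obj (HomCat Lex a b)" for a b f
  proof -
    obtain i where "?F a b f = (f, i)" "(f, i) \<in> Obj (pointed_cells (?T a) (?T b))"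
      using Lex_to_AdTr_pt_T1_in[OF abf] by metis
    then show "?F a b f \<in> Obj (pointed_cells (?T a) (?T b))" "fst (?F a b f) = f" by simp_all
  qed
  \<comment> \<open>A 1-cell into a triple pointed by a terminal object is determined by its functor.\<close>
  have eqI: "u = v" if "b \<in> Ob Lex" "u \<in> Obj (pointed_cells x (?T b))" "v \<in> Obj (pointed_cells x (?T b))"
    "fst u = fst v" for b u v x
    using that is_terminal_unique[of "fst b" "snd b" "snd u" _ "snd v"]
    by (auto simp: pointed_cells_Obj fstT is_iso_def Lex_Ob prod_eq_iff)
  have h: "\<alpha> \<in> Hom (pointed_cells (?T a) (?T b)) (?F a b f) (?F a b g) \<and>
      FAr (T1 Lex_to_AdTr_pt a b) f g \<alpha> = \<alpha>"
    if ab: "a \<in> Ob Lex" "b \<in> Ob Lex" and al: "\<alpha> \<in> Hom (HomCat Lex a b) f g" for a b f g \<alpha>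
  proof -
    have fg: "f \<in> Obj (HomCat Lex a b)" "g \<in> Obj (HomCat Lex a b)" using al by (simp_all add: Lex_HomCat)
    have B: "category (fst b)" "is_terminal (fst b) (snd b)" and A: "snd a \<in> Obj (fst a)"
      using ab by (simp_all add: Lex_Ob is_terminal_def)
    have n: "\<alpha> \<in> nat_trans (fst a) (fst b) f g" using al by (simp add: Lex_HomCat)
    have "snd (?F a b f) \<in> Hom (fst b) (FOb f (snd a)) (snd b)" "snd (?F a b g) \<in> Hom (fst b) (FOb g (snd a)) (snd b)"
      using o[OF ab fg(1)] o[OF ab fg(2)] by (simp_all add: pointed_cells_Obj fstT is_iso_def)
    then have "Comp (fst b) (FOb f (snd a)) (FOb g (snd a)) (snd b) (snd (?F a b g)) (\<alpha> (snd a)) = snd (?F a b f)"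
      using is_terminal_unique[OF B(2,1)] category.comp_in_hom[OF B(1) nat_transD(1)[OF n A]] by blast
    moreover have "\<alpha> \<in> Hom (HomCat AdTr (fst (?T a)) (fst (?T b))) f g"
      using n o[OF ab fg(1)] o[OF ab fg(2)] by (simp add: pointed_cells_Obj HomCat_AdTr fstT)
    ultimately show ?thesis using o[OF ab fg(1)] o[OF ab fg(2)] al T.homcat[OF ab]
      by (simp add: pointed_cells_Hom fstT) (simp add: Lex_to_AdTr_pt_def)
  qed
  show ?thesis
  proof (rule two_functor.intro, rule T.two_category_axioms, rule P.two_category_axioms,
      rule two_functor_axioms.intro, goal_cases)
    case (1 a) then show ?case by (rule ob)
  next
    case (2 a b)
    note H = T.homcat[OF 2]
    have eq: "T1 Lex_to_AdTr_pt a b = make_fctr (HomCat Lex a b) (?F a b) (FAr (T1 Lex_to_AdTr_pt a b))"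
      by (simp add: Lex_to_AdTr_pt_def make_fctr_idem)
    show ?case
    proof (subst eq, rule is_functor_make_fctr, goal_cases)
      case 1 show ?case by (rule H)
    next
      case 2 show ?case using P.homcat[OF ob ob] \<open>a \<in> Ob Lex\<close> \<open>b \<in> Ob Lex\<close> by simp
    next
      case (3 f) then show ?case using o(1)[OF \<open>a \<in> Ob Lex\<close> \<open>b \<in> Ob Lex\<close>] by simp
    next
      case (4 f g \<alpha>) then show ?case using h[OF \<open>a \<in> Ob Lex\<close> \<open>b \<in> Ob Lex\<close>] by simp
    next
      case (5 f)
      note of = o[OF \<open>a \<in> Ob Lex\<close> \<open>b \<in> Ob Lex\<close> 5]
      show ?case
        using h[OF \<open>a \<in> Ob Lex\<close> \<open>b \<in> Ob Lex\<close> category.ident_in_hom[OF H 5]] 5 of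
        by (simp add: pointed_cells_Ident pointed_cells_Obj) (simp add: HomCat_AdTr Lex_HomCat fstT)
    next
      case (6 f g k \<alpha> \<beta>)
      note ab = \<open>a \<in> Ob Lex\<close> \<open>b \<in> Ob Lex\<close>
      note ha = conjunct1[OF h[OF ab 6(4)]] and hb = conjunct1[OF h[OF ab 6(5)]]
      show ?case
        using h[OF ab category.comp_in_hom[OF H 6(4,5)]] h[OF ab 6(4)] h[OF ab 6(5)]
          pointed_cells_Comp[OF ha hb] o[OF ab 6(1)] o[OF ab 6(2)] o[OF ab 6(3)] 6
        by (simp add: pointed_cells_Obj) (simp add: HomCat_AdTr Lex_HomCat fstT)
    qed
  next
    case (3 a)
    show ?case
    proof (rule eqI[OF 3])
      show "?F a a (Id1 Lex a) \<in> Obj (pointed_cells (?T a) (?T a))" using o[OF 3 3 T.id1[OF 3]] by simp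
      show "Id1 AdTr_pt (?T a) \<in> Obj (pointed_cells (?T a) (?T a))" using P.id1[OF ob[OF 3]] by simp
      show "fst (?F a a (Id1 Lex a)) = fst (Id1 AdTr_pt (?T a))"
        using o[OF 3 3 T.id1[OF 3]] by (simp add: Lex_Id1 fstT)
    qed
  next
    case (4 a b c f g)
    note of = o[OF 4(1,2,4)] and og = o[OF 4(2,3,5)]
    show ?case
    proof (rule eqI[OF 4(3)])
      show "?F a c (comp1 Lex a b c g f) \<in> Obj (pointed_cells (?T a) (?T c))"
        using o[OF 4(1,3) T.comp1_in[OF 4]] by simp
      show "comp1 AdTr_pt (?T a) (?T b) (?T c) (?F b c g) (?F a b f) \<in> Obj (pointed_cells (?T a) (?T c))"
        using 4(1-3) of(1) og(1) by (intro AdTr_pt_comp1_in ob)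
      show "fst (?F a c (comp1 Lex a b c g f)) = fst (comp1 AdTr_pt (?T a) (?T b) (?T c) (?F b c g) (?F a b f))"
        using o(2)[OF 4(1,3) T.comp1_in[OF 4]] of og Lex_comp1[OF 4(4,5)]
        by (simp add: AdTr_pt_comp1[OF of(1) og(1)] pointed_cells_Obj AdTr_comp1 fstT)
    qed
  next
    case (5 a b c \<alpha> f f' \<beta> g g')
    note ha = h[OF 5(1,2,4)] and hb = h[OF 5(2,3,5)]
    note Hom = category.hom_obj[OF T.homcat[OF 5(1,2)] 5(4)] category.hom_obj[OF T.homcat[OF 5(2,3)] 5(5)]
    have "\<alpha> \<in> Hom (HomCat AdTr (fst (?T a)) (fst (?T b))) f f'" "\<beta> \<in> Hom (HomCat AdTr (fst (?T b)) (fst (?T c))) g g'"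
      using ha hb o(2)[OF 5(1,2) Hom(1)] o(2)[OF 5(1,2) Hom(2)] o(2)[OF 5(2,3) Hom(3)] o(2)[OF 5(2,3) Hom(4)]
      by (simp_all add: pointed_cells_Hom)
    then show ?case
      using h[OF 5(1,3) T.hcomp_in[OF 5]] Lex_hcomp[OF 5(4,5)] ha hb
        AdTr_pt_hcomp[OF ob[OF 5(1)] ob[OF 5(2)] ob[OF 5(3)] conjunct1[OF ha] conjunct1[OF hb]]
        o(2)[OF 5(1,2) Hom(1)] o(2)[OF 5(1,2) Hom(2)] o(2)[OF 5(2,3) Hom(3)] o(2)[OF 5(2,3) Hom(4)]
      by (simp add: AdTr_hcomp fstT)
  qed
qed

lemma cartesian_AdTr_pt:
  assumes "infinite (UNIV :: 'o set)" "infinite (UNIV :: 'm set)"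
  shows "cartesian_2category (AdTr_pt :: (('o, 'm) triple \<times> 'o, _, _) tcat)"
  using cartesian_forget_point[OF assms] by (simp add: cartesian_2functor_def)

text \<open>The product of lex categories is sent to the product of pointed triples, with equal objects and
  equal projections: the arrow attached to a projection goes from the chosen terminal object of a
  factor to itself and is therefore the identity.\<close>

lemma cartesian_Lex_to_AdTr_pt:
  assumes "infinite (UNIV :: 'o set)" "infinite (UNIV :: 'm set)"
  shows "cartesian_2functor (Lex :: (('o, 'm) cat \<times> 'o, _, _) tcat) AdTr_pt Lex_to_AdTr_pt"
proof (rule cartesian_2functorI[OF two_functor_Lex_to_AdTr_pt cartesian_AdTr_pt[OF assms]])
  fix I :: "nat set" and A :: "nat \<Rightarrow> ('o, 'm) cat \<times> 'o"
  assume I: "finite I" and A: "\<And>i. i \<in> I \<Longrightarrow> A i \<in> Ob Lex"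
  interpret T: two_functor Lex AdTr_pt Lex_to_AdTr_pt by (rule two_functor_Lex_to_AdTr_pt)
  obtain tup :: "(nat \<Rightarrow> 'o) \<Rightarrow> 'o" and prj and tupm :: "(nat \<Rightarrow> 'm) \<Rightarrow> 'm" and prjm
    where "tupling I tup prj tupm prjm" using tupling_exists[OF I assms] by blast
  then interpret tupling I tup prj tupm prjm .
  let ?T = "T0 Lex_to_AdTr_pt" and ?C = "\<lambda>i. fst (A i)" and ?t = "tup (\<lambda>i. snd (A i))"
  let ?p = "(product ?C, ?t)"
  have P: "is_2product Lex I A ?p (projection ?C)" and p: "?p \<in> Ob Lex"
    using A by (simp_all only: Lex_2product)
  have fstT: "fst (?T (A i)) = all_triple (?C i)" "fst (fst (?T (A i))) = ?C i" "snd (?T (A i)) = snd (A i)" for i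
    by (simp_all add: Lex_to_AdTr_pt_T0 all_triple_def)
  interpret C: category_family I tup prj tupm prjm ?C
    using tupling_axioms A by (simp add: category_family_def category_family_axioms_def Lex_Ob)
  have t: "?t \<in> Obj (product ?C)" using p by (simp add: Lex_Ob is_terminal_def)
  have pr: "FOb (T1 Lex_to_AdTr_pt ?p (A i)) (projection ?C i) = (projection ?C i, Ident (?C i) (snd (A i)))"
    if i: "i \<in> I" for i
    using A[OF i] C.C[OF i] t i is_2product_ob(2)[OF P i]
    by (intro Lex_to_AdTr_pt_T1) (auto simp: Lex_Ob is_terminal_def category.ident_in_hom)
  have "is_2product AdTr_pt I (\<lambda>i. ?T (A i))
     (product_triple (\<lambda>i. fst (?T (A i))), tup (\<lambda>i. snd (?T (A i))))
     (\<lambda>i. (projection (\<lambda>i. fst (fst (?T (A i)))) i, Ident (fst (fst (?T (A i)))) (snd (?T (A i)))))"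
    by (rule AdTr_pt_2product) (rule T.maps_ob, rule A)
  then have "is_2product AdTr_pt I (\<lambda>i. ?T (A i)) (product_triple (\<lambda>i. all_triple (?C i)), ?t)
     (\<lambda>i. (projection ?C i, Ident (?C i) (snd (A i))))"
    unfolding fstT(2,3) unfolding fstT(1) .
  then have "is_2product AdTr_pt I (\<lambda>i. ?T (A i)) (?T ?p) (\<lambda>i. (projection ?C i, Ident (?C i) (snd (A i))))"
    by (simp add: product_all_triple Lex_to_AdTr_pt_T0)
  then have "is_2product AdTr_pt I (\<lambda>i. ?T (A i)) (?T ?p) (\<lambda>i. FOb (T1 Lex_to_AdTr_pt ?p (A i)) (projection ?C i))"
    by (rule is_2product_cong) (use pr in simp_all)
  then show "\<exists>p pr. is_2product Lex I A p pr \<and> is_2product AdTr_pt I (\<lambda>i. ?T (A i)) (?T p)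
     (\<lambda>i. FOb (T1 Lex_to_AdTr_pt p (A i)) (pr i))"
    using P by blast
qed

lemma lifts_along_forget:
  assumes "two_functor K AdTr_pt S" "\<And>a. a \<in> Ob K \<Longrightarrow> fst (T0 S a) = T0 T a"
    and "\<And>a b. \<lbrakk>a \<in> Ob K; b \<in> Ob K\<rbrakk> \<Longrightarrow> T1 T a b = make_fctr (HomCat K a b) (F a b) (G a b)"
    and "\<And>a b f. \<lbrakk>a \<in> Ob K; b \<in> Ob K; f \<in> Obj (HomCat K a b)\<rbrakk> \<Longrightarrow> fst (FOb (T1 S a b) f) = F a b f"
    and "\<And>a b f g \<alpha>. \<lbrakk>a \<in> Ob K; b \<in> Ob K; \<alpha> \<in> Hom (HomCat K a b) f g\<rbrakk> \<Longrightarrow> FAr (T1 S a b) f g \<alpha> = G a b f g \<alpha>"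
  shows "lifts_along K forget_point S T"
proof -
  interpret S: two_functor K AdTr_pt S by fact
  show ?thesis unfolding lifts_along_def
  proof (intro conjI ballI)
    fix a assume "a \<in> Ob K" then show "T0 forget_point (T0 S a) = T0 T a"
      using assms(2) by (simp add: forget_point_def)
    fix b assume "b \<in> Ob K"
    note ab = \<open>a \<in> Ob K\<close> \<open>b \<in> Ob K\<close>
    have cat: "category (pointed_cells (T0 S a) (T0 S b))"
      using S.cod.homcat[OF S.maps_ob S.maps_ob] ab by simp
    show "fctr_comp (HomCat K a b) (T1 forget_point (T0 S a) (T0 S b)) (T1 S a b) = T1 T a b"
      unfolding assms(3)[OF ab] fctr_comp_def
      by (rule make_fctr_cong)
        (use S.maps_obj1[OF ab] S.maps_hom2[OF ab] assms(4,5)[OF ab] cat in \<open>simp_all add: forget_point_def\<close>)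
  qed
qed

lemma Lex_to_AdTr_lift: "lifts_along Lex forget_point Lex_to_AdTr_pt Lex_to_AdTr"
  by (rule lifts_along_forget[OF two_functor_Lex_to_AdTr_pt])
    (auto simp: Lex_to_AdTr_pt_def Lex_to_AdTr_def two_category.homcat[OF two_category_Lex])

section \<open>Opposites: rex categories as lex categories\<close>

lemma Opp_simps [simp]:
  "Obj (Opp C) = Obj C" "Hom (Opp C) x y = Hom C y x" "Ident (Opp C) = Ident C"
  "Comp (Opp C) x y z g f = Comp C z y x f g" "Opp (Opp C) = C"
  by (simp_all add: Opp_def)

lemma Opp_fctr_simps [simp]:
  "FOb (Opp_fctr F) = FOb F" "FAr (Opp_fctr F) x y = FAr F y x" "Opp_fctr (Opp_fctr F) = F"
  by (simp_all add: Opp_fctr_def)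

lemma Opp_make_cat:
  "Opp (make_cat X H i m) = make_cat X (\<lambda>x y. H y x) i (\<lambda>x y z g f. m z y x f g)"
  by (auto simp: Opp_def make_cat_def fun_eq_iff)

lemma Opp_make_fctr: "Opp_fctr (make_fctr C a h) = make_fctr (Opp C) a (\<lambda>x y. h y x)"
  by (auto simp: Opp_fctr_def make_fctr_def fun_eq_iff)

lemma category_Opp:
  assumes "category C"
  shows "category (Opp C)"
proof -
  interpret category C by fact
  have "Opp C = make_cat (Obj C) (\<lambda>x y. Hom C y x) (Ident C) (\<lambda>x y z g f. Comp C z y x f g)"
    by (subst extensional) (rule Opp_make_cat)
  also have "category \<dots>"
    by (rule category_make_cat)
      (simp_all add: ident_in_hom comp_in_hom comp_ident_left comp_ident_right comp_assoc)
  finally show ?thesis .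
qed

lemma is_functor_Opp:
  assumes "is_functor C D F"
  shows "is_functor (Opp C) (Opp D) (Opp_fctr F)"
proof -
  interpret F: is_functor C D F by fact
  have "Opp_fctr F = make_fctr (Opp C) (FOb F) (\<lambda>x y. FAr F y x)"
    by (subst F.extensional) (rule Opp_make_fctr)
  also have "is_functor (Opp C) (Opp D) \<dots>"
    by (rule is_functor_make_fctr)
      (simp_all add: category_Opp F.dom.category_axioms F.cod.category_axioms F.maps_obj F.maps_hom
        F.maps_ident F.maps_comp)
  finally show ?thesis .
qed

lemma is_functor_Opp_iff [simp]: "is_functor (Opp C) (Opp D) (Opp_fctr F) \<longleftrightarrow> is_functor C D F"
  using is_functor_Opp[of C D F] is_functor_Opp[of "Opp C" "Opp D" "Opp_fctr F"] by auto

lemma category_Opp_iff [simp]: "category (Opp C) \<longleftrightarrow> category C"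
  using category_Opp[of C] category_Opp[of "Opp C"] by auto

lemma finite_cat_Opp [simp]: "finite_cat (Opp J) \<longleftrightarrow> finite_cat J"
  by (auto simp: finite_cat_def)

lemma fctr_comp_Opp: "fctr_comp (Opp C) (Opp_fctr G) (Opp_fctr F) = Opp_fctr (fctr_comp C G F)"
  by (simp add: fctr_comp_def Opp_make_fctr)

lemma id_fctr_Opp: "id_fctr (Opp C) = Opp_fctr (id_fctr C)"
  by (simp add: id_fctr_def Opp_make_fctr)

lemma is_terminal_Opp [simp]: "is_terminal (Opp C) t \<longleftrightarrow> is_initial C t"
  by (simp add: is_terminal_def is_initial_def)

lemma is_cone_Opp: "is_cone (Opp C) (Opp J) (Opp_fctr D) x c \<longleftrightarrow> is_cocone C J D x c"
  by (auto simp: is_cone_def is_cocone_def)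

text \<open>Colimits are limits in the opposite category, also for the opposite shape.\<close>

lemma is_limit_Opp: "is_limit (Opp C) (Opp J) (Opp_fctr D) = is_colimit C J D"
  by (simp add: fun_eq_iff is_limit_def is_colimit_def is_cone_Opp)

text \<open>Taking opposites permutes the diagrams, so that quantifiers over them may be reindexed.\<close>

lemma all_diagrams_Opp:
  fixes P :: "('j, 'k) cat \<Rightarrow> ('j, 'k, 'o, 'm) fctr \<Rightarrow> bool"
  shows "(\<forall>J D. P J D) \<longleftrightarrow> (\<forall>J D. P (Opp J) (Opp_fctr D))"
  by (metis Opp_simps(5) Opp_fctr_simps(3))

lemma has_finite_limits_Opp [simp]: "has_finite_limits (Opp C) \<longleftrightarrow> has_finite_colimits C"
  unfolding has_finite_limits_def has_finite_colimits_def
  by (subst all_diagrams_Opp) (simp add: is_limit_Opp)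

lemma preserves_finite_limits_Opp [simp]:
  "preserves_finite_limits (Opp C) (Opp D) (Opp_fctr F) \<longleftrightarrow> preserves_finite_colimits C D F"
  unfolding preserves_finite_limits_def preserves_finite_colimits_def
  by (subst all_diagrams_Opp) (simp add: is_limit_Opp fctr_comp_Opp)

lemma nat_trans_Opp [simp]:
  "nat_trans (Opp C) (Opp D) (Opp_fctr F) (Opp_fctr G) = nat_trans C D G F"
  by (auto simp: nat_trans_def)

lemma preserves_finite_colimits_id: "category C \<Longrightarrow> preserves_finite_colimits C C (id_fctr C)"
  using preserves_finite_limits_id[of "Opp C"] by (simp add: id_fctr_Opp)

lemma preserves_finite_colimits_comp:
  assumes "is_functor B C F" "preserves_finite_colimits B C F"
    and "is_functor C D G" "preserves_finite_colimits C D G"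
  shows "preserves_finite_colimits B D (fctr_comp B G F)"
  using preserves_finite_limits_comp[of "Opp B" "Opp C" "Opp_fctr F" "Opp D" "Opp_fctr G"] assms
  by (simp add: fctr_comp_Opp)

lemma structured_Rex:
  "structured {(C :: ('o, 'm) cat, t). category C \<and> has_finite_colimits C \<and> is_initial C t} fst
     (\<lambda>(C, _) (D, _). {F. preserves_finite_colimits C D F})"
  by (rule structured.intro)
    (auto intro: preserves_finite_colimits_id preserves_finite_colimits_comp)

lemma prod_cat_Opp: "prod_cat (Opp C) (Opp D) = Opp (prod_cat C D)"
  by (simp add: prod_cat_def Opp_make_cat case_prod_unfold)

lemma co_simps [simp]:
  "Ob (co K) = Ob K" "HomCat (co K) a b = Opp (HomCat K a b)" "Id1 (co K) = Id1 K"
  "CompF (co K) a b c = Opp_fctr (CompF K a b c)"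
  by (simp_all add: co_def)

lemma two_category_co:
  assumes "two_category K"
  shows "two_category (co K)"
proof -
  interpret two_category K by fact
  show ?thesis
    by (rule two_category.intro)
      (simp_all add: homcat id1 comp_functor prod_cat_Opp unit_right_1 unit_left_1 unit_right_2
        unit_left_2 assoc_1 assoc_2)
qed

lemma two_category_Rex: "two_category Rex"
  unfolding Rex_def by (rule structured.two_category[OF structured_Rex])

lemma Rex_Ob: "a \<in> Ob Rex \<longleftrightarrow> category (fst a) \<and> has_finite_colimits (fst a) \<and> is_initial (fst a) (snd a)"
  by (cases a) (simp add: Rex_def)

lemma Rex_HomCat: "HomCat Rex a b = functor_cat (fst a) (fst b) {F. preserves_finite_colimits (fst a) (fst b) F}"
  by (cases a; cases b) (simp add: Rex_def)

lemma Rex_Id1: "Id1 Rex a = id_fctr (fst a)" by (cases a) (simp add: Rex_def)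

lemma Rex_comp1:
  "\<lbrakk>F \<in> Obj (HomCat Rex a b); G \<in> Obj (HomCat Rex b c)\<rbrakk> \<Longrightarrow> comp1 Rex a b c G F = fctr_comp (fst a) G F"
  by (cases a; cases b; cases c) (simp add: Rex_def)

lemma Rex_hcomp:
  "\<lbrakk>\<alpha> \<in> Hom (HomCat Rex a b) F F'; \<beta> \<in> Hom (HomCat Rex b c) G G'\<rbrakk> \<Longrightarrow>
    hcomp Rex a b c G G' F F' \<beta> \<alpha> = hcomp_trans (fst a) (fst c) G G' F F' \<beta> \<alpha>"
  by (cases a; cases b; cases c) (simp add: Rex_def)

text \<open>The passage to opposite categories. It reverses natural transformations, which is compensated by
  reversing the 2-cells of \<open>Rex\<close>, and it keeps the direction of 1-cells.\<close>

definition Rex_co_to_Lex ::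
  "(('o, 'm) cat \<times> 'o, ('o, 'm, 'o, 'm) fctr, 'o \<Rightarrow> 'm,
    ('o, 'm) cat \<times> 'o, ('o, 'm, 'o, 'm) fctr, 'o \<Rightarrow> 'm) tfun" where
  "Rex_co_to_Lex =
    \<lparr> T0 = (\<lambda>(C, i). (Opp C, i)),
      T1 = (\<lambda>a b. make_fctr (HomCat (co Rex) a b) Opp_fctr (\<lambda>_ _ \<alpha>. \<alpha>)) \<rparr>"

lemma Rex_co_to_Lex_T0: "T0 Rex_co_to_Lex a = (Opp (fst a), snd a)"
  by (cases a) (simp add: Rex_co_to_Lex_def)

text \<open>The component at \<open>x\<close> of a horizontal composite is one of the two sides of the naturality
  square of \<open>\<beta>\<close> at \<open>\<alpha> x\<close>. Passing to opposites replaces it by the other side.\<close>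

lemma hcomp_trans_Opp:
  assumes F: "is_functor C D F" "is_functor C D F'"
    and a: "\<alpha> \<in> nat_trans C D F' F" and b: "\<beta> \<in> nat_trans D E G' G"
  shows "hcomp_trans (Opp C) (Opp E) (Opp_fctr G) (Opp_fctr G') (Opp_fctr F) (Opp_fctr F') \<beta> \<alpha> =
    hcomp_trans C E G' G F' F \<beta> \<alpha>"
  using nat_transD(2)[OF b is_functor.maps_obj[OF F(2)] is_functor.maps_obj[OF F(1)] nat_transD(1)[OF a]]
  by (auto simp: hcomp_trans_def intro!: restrict_ext)

lemma two_functor_Rex_co_to_Lex: "two_functor (co Rex) Lex Rex_co_to_Lex"
proof -
  interpret R: two_category "co Rex" by (rule two_category_co[OF two_category_Rex])
  interpret T: two_category Lex by (rule two_category_Lex)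
  let ?T = "T0 Rex_co_to_Lex"
  have T1: "FOb (T1 Rex_co_to_Lex a b) f = Opp_fctr f" if "f \<in> Obj (HomCat (co Rex) a b)" for a b f
    using that by (simp add: Rex_co_to_Lex_def)
  have T2: "FAr (T1 Rex_co_to_Lex a b) f g \<alpha> = \<alpha>" if "\<alpha> \<in> Hom (HomCat (co Rex) a b) f g" for a b f g \<alpha>
    using that by (simp add: Rex_co_to_Lex_def Rex_HomCat category_functor_cat)
  have o: "Opp_fctr f \<in> Obj (HomCat Lex (?T a) (?T b))" if "f \<in> Obj (HomCat (co Rex) a b)" for a b f
    using that by (simp add: Rex_HomCat Lex_HomCat Rex_co_to_Lex_T0)
  have h: "\<alpha> \<in> Hom (HomCat Lex (?T a) (?T b)) (Opp_fctr f) (Opp_fctr g)"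
    if "\<alpha> \<in> Hom (HomCat (co Rex) a b) f g" for a b f g \<alpha>
    using that by (simp add: Rex_HomCat Lex_HomCat Rex_co_to_Lex_T0)
  show ?thesis
  proof (rule two_functor.intro, rule R.two_category_axioms, rule T.two_category_axioms,
      rule two_functor_axioms.intro, goal_cases)
    case (1 a) then show ?case by (simp add: Rex_Ob Lex_Ob Rex_co_to_Lex_T0)
  next
    case (2 a b)
    have "is_functor (HomCat (co Rex) a b) (HomCat Lex (?T a) (?T b))
        (make_fctr (HomCat (co Rex) a b) Opp_fctr (\<lambda>_ _ \<alpha>. \<alpha>))"
    proof (rule is_functor_make_fctr, goal_cases)
      case 1 show ?case by (simp add: Rex_HomCat category_functor_cat)
    next
      case 2 show ?case by (simp add: Lex_HomCat category_functor_cat)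
    next
      case (3 f) then show ?case by (rule o)
    next
      case (4 f g \<alpha>) then show ?case by (intro h)
    qed (simp_all add: Rex_HomCat Lex_HomCat Rex_co_to_Lex_T0)
    then show ?case by (simp add: Rex_co_to_Lex_def)
  next
    case (3 a) then show ?case
      using T1[OF R.id1[OF 3]] by (simp add: Rex_Id1 Lex_Id1 Rex_co_to_Lex_T0 id_fctr_Opp)
  next
    case (4 a b c f g) then show ?case
      using T1[OF R.comp1_in[OF 4]] T1[OF 4(4)] T1[OF 4(5)] Lex_comp1[OF o[OF 4(4)] o[OF 4(5)]]
      by (simp add: Rex_comp1 Rex_co_to_Lex_T0 fctr_comp_Opp)
  next
    case (5 a b c \<alpha> f f' \<beta> g g')
    have n: "is_functor (fst a) (fst b) f" "is_functor (fst a) (fst b) f'"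
      "\<alpha> \<in> nat_trans (fst a) (fst b) f' f" "\<beta> \<in> nat_trans (fst b) (fst c) g' g"
      and fg: "f \<in> Obj (HomCat (co Rex) a b)" "f' \<in> Obj (HomCat (co Rex) a b)"
      "g \<in> Obj (HomCat (co Rex) b c)" "g' \<in> Obj (HomCat (co Rex) b c)"
      using 5(4,5) by (simp_all add: Rex_HomCat)
    have "hcomp (co Rex) a b c g g' f f' \<beta> \<alpha> = hcomp_trans (fst a) (fst c) g' g f' f \<beta> \<alpha>"
      using 5(4,5) Rex_hcomp[of \<alpha> a b f' f \<beta> c g' g] by simp
    then show ?case
      using T2[OF R.hcomp_in[OF 5]] T2[OF 5(4)] T2[OF 5(5)] T1[OF fg(1)] T1[OF fg(2)] T1[OF fg(3)] T1[OF fg(4)]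
        Lex_hcomp[OF h[OF 5(4)] h[OF 5(5)]] hcomp_trans_Opp[OF n]
      by (simp add: Rex_co_to_Lex_T0)
  qed
qed

text \<open>Taking opposites is an involution, which exchanges rex and lex categories.\<close>

lemma cartesian_Rex_co_to_Lex:
  assumes "infinite (UNIV :: 'o set)" "infinite (UNIV :: 'm set)"
  shows "cartesian_2functor (co Rex :: (('o, 'm) cat \<times> 'o, _, _) tcat) Lex Rex_co_to_Lex"
proof (rule surjective_2equivalence.cartesian_surjective_2equivalence)
  let ?T = "Rex_co_to_Lex :: (('o, 'm) cat \<times> 'o, _, _, _, _, _) tfun"
  show "cartesian_2category (Lex :: (('o, 'm) cat \<times> 'o, _, _) tcat)"
    using cartesian_Lex_to_AdTr_pt[OF assms] by (simp add: cartesian_2functor_def)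
  show "surjective_2equivalence (co Rex) Lex ?T"
  proof (rule surjective_2equivalence.intro[OF two_functor_Rex_co_to_Lex], unfold_locales)
    fix b :: "('o, 'm) cat \<times> 'o" assume "b \<in> Ob Lex"
    then have "(Opp (fst b), snd b) \<in> Ob (co Rex)"
      using has_finite_limits_Opp[of "Opp (fst b)"] is_terminal_Opp[of "Opp (fst b)"]
      by (simp add: Rex_Ob Lex_Ob)
    then show "\<exists>a \<in> Ob (co Rex). T0 ?T a = b"
      by (intro bexI[of _ "(Opp (fst b), snd b)"]) (simp_all add: Rex_co_to_Lex_T0)
  next
    fix a b :: "('o, 'm) cat \<times> 'o"
    have "Opp_fctr g \<in> Obj (HomCat (co Rex) a b)" if "g \<in> Obj (HomCat Lex (T0 ?T a) (T0 ?T b))" for g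
      using that is_functor_Opp_iff[of "fst a" "fst b" "Opp_fctr g"]
        preserves_finite_limits_Opp[of "fst a" "fst b" "Opp_fctr g"]
      by (simp add: Rex_HomCat Lex_HomCat Rex_co_to_Lex_T0)
    then show "bij_betw (FOb (T1 ?T a b)) (Obj (HomCat (co Rex) a b)) (Obj (HomCat Lex (T0 ?T a) (T0 ?T b)))"
      by (intro bij_betw_byWitness[where f' = Opp_fctr])
        (auto simp: Rex_co_to_Lex_def Rex_HomCat Lex_HomCat case_prod_unfold)
  next
    fix a b :: "('o, 'm) cat \<times> 'o" and f g
    assume "f \<in> Obj (HomCat (co Rex) a b)" "g \<in> Obj (HomCat (co Rex) a b)"
    then show "bij_betw (FAr (T1 ?T a b) f g) (Hom (HomCat (co Rex) a b) f g)
        (Hom (HomCat Lex (T0 ?T a) (T0 ?T b)) (FOb (T1 ?T a b) f) (FOb (T1 ?T a b) g))"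
      by (intro bij_betw_byWitness[where f' = "\<lambda>\<alpha>. \<alpha>"])
        (auto simp: Rex_co_to_Lex_def Rex_HomCat Lex_HomCat category_functor_cat case_prod_unfold)
  qed
qed

section \<open>The lifted 2-functor from rex categories\<close>

definition tfun_comp ::
  "('a, 'b, 'c) tcat \<Rightarrow> ('d, 'e, 'f, 'g, 'h, 'k) tfun \<Rightarrow> ('a, 'b, 'c, 'd, 'e, 'f) tfun \<Rightarrow>
   ('a, 'b, 'c, 'g, 'h, 'k) tfun" where
  "tfun_comp K U T =
    \<lparr> T0 = (\<lambda>a. T0 U (T0 T a)),
      T1 = (\<lambda>a b. fctr_comp (HomCat K a b) (T1 U (T0 T a) (T0 T b)) (T1 T a b)) \<rparr>"

lemma lifts_along_tfun_comp: "lifts_along K U T (tfun_comp K U T)"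
  by (simp add: lifts_along_def tfun_comp_def)

text \<open>The lift for rex categories is the one for lex categories, precomposed with the passage to
  opposites.\<close>

lemma Rex_co_to_AdTr_lift:
  "lifts_along (co Rex) forget_point (tfun_comp (co Rex) Lex_to_AdTr_pt Rex_co_to_Lex) Rex_co_to_AdTr"
    (is "lifts_along _ _ ?S _")
proof (rule lifts_along_forget)
  interpret T: two_functor "co Rex" Lex Rex_co_to_Lex by (rule two_functor_Rex_co_to_Lex)
  show "two_functor (co Rex) AdTr_pt ?S"
    by (rule two_functor_lifts_along[OF two_functor_Rex_co_to_Lex two_functor_Lex_to_AdTr_pt lifts_along_tfun_comp])
  show "fst (T0 ?S a) = T0 Rex_co_to_AdTr a" for a
    by (cases a) (simp add: tfun_comp_def Lex_to_AdTr_pt_T0 Rex_co_to_Lex_T0 Rex_co_to_AdTr_def)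
  show "T1 Rex_co_to_AdTr a b = make_fctr (HomCat (co Rex) a b) Opp_fctr (\<lambda>_ _ \<alpha>. \<alpha>)" for a b
    by (simp add: Rex_co_to_AdTr_def)
  show "fst (FOb (T1 ?S a b) f) = Opp_fctr f"
    if "a \<in> Ob (co Rex)" "b \<in> Ob (co Rex)" "f \<in> Obj (HomCat (co Rex) a b)" for a b f
    using T.maps_obj1[OF that] that
    by (simp add: tfun_comp_def Lex_to_AdTr_pt_def Rex_co_to_Lex_def)
  show "FAr (T1 ?S a b) f g \<alpha> = \<alpha>"
    if "a \<in> Ob (co Rex)" "b \<in> Ob (co Rex)" "\<alpha> \<in> Hom (HomCat (co Rex) a b) f g" for a b f g \<alpha>
    using T.maps_hom2[OF that] that T.dom.homcat[OF that(1,2)] T.cod.homcat[OF T.maps_ob T.maps_ob, OF that(1,2)]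
    by (simp add: tfun_comp_def Lex_to_AdTr_pt_def Rex_co_to_Lex_def)
qed

theorem lemma6p5:
  assumes "infinite (UNIV :: 'o set)" and "infinite (UNIV :: 'm set)"
  shows "(cartesian_2functor (Lex :: (('o, 'm) cat \<times> 'o, _, _) tcat) AdTr Lex_to_AdTr \<and>
          (\<exists>S. cartesian_2functor (Lex :: (('o, 'm) cat \<times> 'o, _, _) tcat) AdTr_pt S \<and>
               lifts_along Lex forget_point S Lex_to_AdTr \<and>
               (\<forall>(C, t) \<in> Ob Lex. T0 S (C, t) = (all_triple C, t)))) \<and>
         (cartesian_2functor (co Rex :: (('o, 'm) cat \<times> 'o, _, _) tcat) AdTr Rex_co_to_AdTr \<and>
          (\<exists>S. cartesian_2functor (co Rex :: (('o, 'm) cat \<times> 'o, _, _) tcat) AdTr_pt S \<and>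
               lifts_along (co Rex) forget_point S Rex_co_to_AdTr \<and>
               (\<forall>(C, i) \<in> Ob (co Rex). T0 S (C, i) = (all_triple (Opp C), i))))"
proof -
  note forget = cartesian_forget_point[OF assms]
  note lex = cartesian_Lex_to_AdTr_pt[OF assms]
  let ?S = "tfun_comp (co Rex) Lex_to_AdTr_pt Rex_co_to_Lex ::
    (('o, 'm) cat \<times> 'o, _, _, _, _, _) tfun"
  have rex: "cartesian_2functor (co Rex) AdTr_pt ?S"
    by (rule cartesian_2functor_lifts_along[OF cartesian_Rex_co_to_Lex[OF assms] lex lifts_along_tfun_comp])
  have "T0 Lex_to_AdTr_pt (C, t) = (all_triple C, t)" for C :: "('o, 'm) cat" and t
    by (simp add: Lex_to_AdTr_pt_T0)
  moreover have "T0 ?S (C, i) = (all_triple (Opp C), i)" for C i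
    by (simp add: tfun_comp_def Lex_to_AdTr_pt_T0 Rex_co_to_Lex_T0)
  ultimately show ?thesis
    using lex rex Lex_to_AdTr_lift Rex_co_to_AdTr_lift
      cartesian_2functor_lifts_along[OF lex forget Lex_to_AdTr_lift]
      cartesian_2functor_lifts_along[OF rex forget Rex_co_to_AdTr_lift] by blast
qed

end
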